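(* Let $d\ge 2$ be an integer and let $(a_n)_{n=1}^\infty$ be a sequence of complex numbers with $a_n=n^{o(1)}$ as $n\to\infty$. For any $s\ge 1$, any $0<\delta<1$ and $N>1/\delta$ we have $$\int_\delta^1\left|\sum_{n=1}^N a_n\,\mathbf{e}(tn+t^2n^2+\ldots+t^dn^d)\right|^{2s}dt\le \delta^{(1-d)/2}\left(N^s+N^{2s-s(d)/2}\right)N^{s(d)/2-d/2+o(1)},$$ where the $o(1)$ is as $N\to\infty$, uniformly over $\delta$ with $1/N<\delta<1$.
   Context: $\mathbf{e}(x)=\exp(2\pi i x)$, $s(d)=d(d+1)/2$, $N\in\mathbb{N}$. $U=V^{o(1)}$ means that for every $\varepsilon>0$, $|U|\le V^{\varepsilon}$ once $V$ is large enough; a factor $N^{c+o(1)}$ in an upper bound means that for every $\varepsilon>0$ the bound holds with $N^{c+\varepsilon}$ for all sufficiently large $N$. *)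

theory Defs
  imports "HOL-Analysis.Analysis"
begin

definition e :: "real \<Rightarrow> complex" where
  "e x = exp (2 * of_real pi * \<i> * of_real x)"

definition crit_exp :: "nat \<Rightarrow> real" where
  "crit_exp d = real d * (real d + 1) / 2"

(* a(n) = n^{o(1)}; the value a 0 plays no role. *)
definition subpolynomial :: "(nat \<Rightarrow> complex) \<Rightarrow> bool" where
  "subpolynomial a \<longleftrightarrow>
     (\<forall>\<epsilon>>0. eventually (\<lambda>n. norm (a n) \<le> real n powr \<epsilon>) sequentially)"

definition curve_sum :: "nat \<Rightarrow> (nat \<Rightarrow> complex) \<Rightarrow> nat \<Rightarrow> real \<Rightarrow> complex" where
  "curve_sum d a N t = (\<Sum>n=1..N. a n * e (\<Sum>j=1..d. t ^ j * real n ^ j))"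

end

theory Submission
  imports Defs "HOL-Number_Theory.Cong" "HOL-Complex_Analysis.Complex_Analysis"
begin

text \<open>
  By Hoelder-type interpolation everything reduces to the exponent \<open>r = d (d + 1) / 2\<close>. Cut \<open>{\<delta>..1}\<close> into
  \<open>X ^ d\<close> pieces on which \<open>t ^ d\<close> varies by \<open>X ^ (- d)\<close>, with \<open>X\<close> comparable to \<open>N\<close>; then every \<open>t ^ j\<close> varies
  by at most \<open>X ^ (- j)\<close>, so on each piece the sum is controlled by its values at the points of a box of a grid in
  the torus. Boxes belonging to different pieces are disjoint, and Cauchy--Schwarz bounds the \<open>r\<close>-th moment along the
  curve by the square root of the \<open>2 r\<close>-th moment over the whole grid; the lengths of the pieces
  produce the factor \<open>\<delta> powr ((1 - d) / 2)\<close>.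

  The grid moment is Vinogradov's mean value at the critical exponent \<open>d (d + 1)\<close>. It is obtained from a
  \<open>p\<close>-adic, \<open>\<ell>\<^sup>p\<close> version of the Guo--Li--Yung--Zorin-Kranich proof of decoupling for the moment curve:
  induct on the degree, reduce to bilinear expressions in two residue classes that differ modulo \<open>p\<close>, refine one of the
  classes by decoupling in lower degree, exchange the roles of the two classes by Hoelder's inequality, and iterate.
\<close>

section \<open>Characters and exponential sums\<close>

text \<open>Residue classes modulo powers of one fixed prime replace the usual weights and tails by
  exact identities: characters are periodic, translating the frequency box is a bijection, and a
  polynomial that is constant modulo \<open>p ^ Q\<close> on a class only changes a phase there. The
  obstacle is to use degree \<open>l < k\<close> information inside a degree \<open>k\<close>
  moment. For classes of \<xi> and \<eta> with \<open>p\<close> not dividing \<xi> - \<eta>, one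
  needs frequency translations that act on the first class like polynomials of degree
  \<open>l\<close> and are invisible on the second. Combinations of powers above
  \<open>k - l\<close> of the distance to \<eta> vanish to high order at \<eta>, and near \<xi> they
  span what is required, because \<xi> - \<eta> and the factorials that occur are units modulo
  \<open>p\<close>; this is where \<open>p > k\<close> enters. The l^p form is chosen because sums
  of moments over classes are additive under refinement, and nothing is lost in the end: an interval
  of \<open>p ^ B\<close> integers has one integer per class. The prime depends on \<open>d\<close>
  alone, so rounding \<open>N\<close> up to a power of \<open>p\<close> costs a constant.\<close>

definition chi :: "nat \<Rightarrow> int \<Rightarrow> complex" where
  "chi q m = e (real_of_int m / real q)"

lemma e_add: "e (x + y) = e x * e y"
  by (simp add: e_def algebra_simps flip: exp_add)

lemma norm_e [simp]: "norm (e x) = 1"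
proof -
  have "e x = cis (2 * pi * x)"
    by (simp add: e_def cis_conv_exp mult_ac)
  then show ?thesis by simp
qed

lemma e_of_int [simp]: "e (of_int m) = 1"
proof -
  have "e (of_int m) = cis (2 * pi * of_int m)"
    by (simp add: e_def cis_conv_exp mult_ac)
  then show ?thesis
    by (simp add: cis_multiple_2pi)
qed

lemma chi_add: "chi q (a + b) = chi q a * chi q b"
  by (simp add: chi_def add_divide_distrib e_add)

lemma norm_chi [simp]: "norm (chi q m) = 1"
  by (simp add: chi_def)

lemma chi_eq_1: "int q dvd m \<Longrightarrow> chi q m = 1"
proof (cases "q = 0")
  case False
  assume "int q dvd m"
  then obtain r where "m = int q * r" by blast
  then have "chi q m = e (of_int r)" using False by (simp add: chi_def)
  then show ?thesis by simp
qed (simp add: chi_def e_def)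

lemma chi_cong: assumes "[a = b] (mod int q)" shows "chi q a = chi q b"
proof -
  have "int q dvd a - b" using assms by (simp add: cong_iff_dvd_diff)
  then have "chi q (b + (a - b)) = chi q b" by (simp only: chi_add chi_eq_1) simp
  then show ?thesis by simp
qed

lemma chi_mult_cancel: "r > 0 \<Longrightarrow> chi (r * q) (int r * m) = chi q m"
  by (simp add: chi_def)

lemma chi_neq_1: assumes "q > 0" "\<not> int q dvd m" shows "chi q m \<noteq> 1"
proof
  assume "chi q m = 1"
  then have "exp (2 * of_real pi * \<i> * of_real (real_of_int m / real q)) = 1"
    by (simp add: chi_def e_def)
  then obtain n :: int where n: "2 * pi * (real_of_int m / real q) = of_int (2 * n) * pi"
    unfolding exp_eq_1 by auto
  then have "(2 * pi) * (real_of_int m / real q) = (2 * pi) * of_int n" by simp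
  then have "real_of_int m / real q = of_int n" by (subst (asm) mult_cancel_left) simp
  then have "real_of_int m = real_of_int (int q * n)"
    using assms(1) by (simp add: field_simps)
  then have "m = int q * n" by (simp only: of_int_eq_iff)
  with assms(2) show False by simp
qed

text \<open>The frequency of degree 0 contributes only a unimodular factor. With it, frequency vectors correspond
  to polynomials, so adding a polynomial to the phase is a translation of the frequencies.\<close>

definition freqs :: "nat \<Rightarrow> nat \<Rightarrow> (nat \<Rightarrow> int) set" where
  "freqs k q = PiE {..k} (\<lambda>_. {0..<int q})"

definition expsum :: "nat \<Rightarrow> nat \<Rightarrow> (int \<Rightarrow> complex) \<Rightarrow> int set \<Rightarrow> (nat \<Rightarrow> int) \<Rightarrow> complex" where
  "expsum k q c A x = (\<Sum>n\<in>A. c n * chi q (\<Sum>j\<le>k. x j * n ^ j))"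

lemma finite_freqs [simp]: "finite (freqs k q)"
  by (simp add: freqs_def finite_PiE)

lemma card_freqs: "card (freqs k q) = q ^ Suc k"
  by (simp add: freqs_def card_PiE)

lemma expsum_empty [simp]: "expsum k q c {} x = 0"
  by (simp add: expsum_def)

lemma expsum_cong_freq:
  assumes "\<And>j. j \<le> k \<Longrightarrow> [x j = y j] (mod int q)"
  shows "expsum k q c A x = expsum k q c A y"
  unfolding expsum_def
  by (intro sum.cong refl arg_cong2[where f="(*)"] chi_cong cong_sum cong_mult)
     (use assms in auto)

lemma expsum_disjoint_UN:
  assumes "finite I" "\<And>i. i \<in> I \<Longrightarrow> finite (A i)" "disjoint_family_on A I"
  shows "expsum k q c (\<Union>i\<in>I. A i) x = (\<Sum>i\<in>I. expsum k q c (A i) x)"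
  unfolding expsum_def
  by (rule sum.UNION_disjoint) (use assms in \<open>auto simp: disjoint_family_on_def\<close>)

text \<open>The box represents the group of residue vectors modulo \<open>q\<close>, on which
  translation is a bijection. Reduction modulo \<open>q\<close> brings a translated vector back into
  the box, and by \<open>per\<close> the summand only sees residues.\<close>

lemma sum_freqs_shift:
  assumes "q > 0"
    and per: "\<And>x y. (\<And>j. j \<le> k \<Longrightarrow> [x j = y j] (mod int q)) \<Longrightarrow> \<Phi> x = \<Phi> y"
  shows "(\<Sum>x\<in>freqs k q. \<Phi> (\<lambda>j. x j + v j)) = (\<Sum>x\<in>freqs k q. \<Phi> x :: 'a :: comm_monoid_add)"
proof -
  define T where "T = (\<lambda>(v::nat \<Rightarrow> int) x. \<lambda>j\<in>{..k}. (x j + v j) mod int q)"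
  have T: "T v x \<in> freqs k q" for v x
    using \<open>q > 0\<close> by (auto simp: T_def freqs_def)
  have inv: "T (\<lambda>j. - v j) (T v x) = x" if "x \<in> freqs k q" for x and v :: "nat \<Rightarrow> int"
  proof
    fix j
    show "T (\<lambda>j. - v j) (T v x) j = x j"
    proof (cases "j \<le> k")
      case True
      then have "T (\<lambda>j. - v j) (T v x) j = ((x j + v j) mod int q - v j) mod int q"
        by (simp add: T_def)
      also have "\<dots> = x j mod int q"
        by (simp add: mod_diff_left_eq)
      also have "\<dots> = x j" using that True by (auto simp: freqs_def PiE_iff)
      finally show ?thesis .
    next
      case False
      then show ?thesis using that by (auto simp: T_def freqs_def PiE_def extensional_def)
    qed
  qed
  have "bij_betw (T v) (freqs k q) (freqs k q)"
    by (rule bij_betwI[where g="T (\<lambda>j. - v j)"])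
       (use T inv[of _ v] inv[of _ "\<lambda>j. - v j"] in auto)
  then have "(\<Sum>x\<in>freqs k q. \<Phi> x) = (\<Sum>x\<in>freqs k q. \<Phi> (T v x))"
    by (simp add: sum.reindex_bij_betw)
  also have "\<dots> = (\<Sum>x\<in>freqs k q. \<Phi> (\<lambda>j. x j + v j))"
    by (intro sum.cong refl per) (auto simp: T_def cong_def)
  finally show ?thesis by simp
qed

lemma poly_eq_sum_le:
  fixes g :: "'a :: comm_ring_1 poly"
  assumes "degree g \<le> k" shows "poly g n = (\<Sum>j\<le>k. coeff g j * n ^ j)"
proof -
  have "poly g n = (\<Sum>j\<le>degree g. coeff g j * n ^ j)"
    by (rule poly_altdef)
  also have "\<dots> = (\<Sum>j\<le>k. coeff g j * n ^ j)"
    by (rule sum.mono_neutral_left) (use assms in \<open>auto simp: coeff_eq_0\<close>)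
  finally show ?thesis .
qed

lemma expsum_shift:
  assumes "degree g \<le> k"
  shows "expsum k q c A (\<lambda>j. x j + coeff g j) = expsum k q (\<lambda>n. c n * chi q (poly g n)) A x"
  using assms
  by (simp add: expsum_def chi_add distrib_right sum.distrib poly_eq_sum_le mult.assoc)
     (simp add: mult.left_commute mult.commute)

text \<open>A phase that is constant modulo \<open>q\<close> on \<open>A\<close> factors out of the
  sum. This is how the second class of a bilinear expression survives a decoupling of the
  first.\<close>

lemma norm_expsum_shift_const:
  assumes "degree g \<le> k" "\<And>n. n \<in> A \<Longrightarrow> [poly g n = \<kappa>] (mod int q)"
  shows "norm (expsum k q c A (\<lambda>j. x j + coeff g j)) = norm (expsum k q c A x)"
proof -
  have "expsum k q (\<lambda>n. c n * chi q (poly g n)) A x = chi q \<kappa> * expsum k q c A x"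
    unfolding expsum_def sum_distrib_left
    by (intro sum.cong refl) (simp add: chi_cong[OF assms(2)])
  then show ?thesis using assms(1) by (simp add: expsum_shift norm_mult)
qed

section \<open>Inequalities for finite sums: Hoelder and the broad-narrow dichotomy\<close>

lemma Holder_sum:
  fixes f g :: "'a \<Rightarrow> real"
  assumes "finite I" "\<And>i. i \<in> I \<Longrightarrow> f i \<ge> 0" "\<And>i. i \<in> I \<Longrightarrow> g i \<ge> 0" "0 < \<theta>" "\<theta> < 1"
  shows "(\<Sum>i\<in>I. f i powr \<theta> * g i powr (1 - \<theta>)) \<le> (\<Sum>i\<in>I. f i) powr \<theta> * (\<Sum>i\<in>I. g i) powr (1 - \<theta>)"
proof (cases "sum f I = 0 \<or> sum g I = 0")
  case True
  then have "(\<forall>i\<in>I. f i = 0) \<or> (\<forall>i\<in>I. g i = 0)"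
    using assms by (simp add: sum_nonneg_eq_0_iff)
  then have "(\<Sum>i\<in>I. f i powr \<theta> * g i powr (1 - \<theta>)) = 0"
    by (intro sum.neutral) auto
  then show ?thesis by simp
next
  case False
  define F G where "F = sum f I" and "G = sum g I"
  have pos: "F > 0" "G > 0"
    using False assms by (auto simp: F_def G_def less_le intro: sum_nonneg)
  have young: "a powr \<theta> * b powr (1 - \<theta>) \<le> \<theta> * a + (1 - \<theta>) * b" if "a \<ge> 0" "b \<ge> 0" for a b :: real
    using Youngs_inequality_0[of \<theta> "1 - \<theta>" a b] that assms by (cases "a = 0 \<or> b = 0") auto
  have "(\<Sum>i\<in>I. (f i / F) powr \<theta> * (g i / G) powr (1 - \<theta>)) \<le> (\<Sum>i\<in>I. \<theta> * (f i / F) + (1 - \<theta>) * (g i / G))"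
    by (intro sum_mono young) (use assms pos in auto)
  also have "\<dots> = \<theta> * (\<Sum>i\<in>I. f i) / F + (1 - \<theta>) * (\<Sum>i\<in>I. g i) / G"
    by (simp add: sum.distrib sum_distrib_left sum_divide_distrib)
  also have "\<dots> = 1" using pos by (simp add: F_def[symmetric] G_def[symmetric])
  finally have "(\<Sum>i\<in>I. (f i / F) powr \<theta> * (g i / G) powr (1 - \<theta>)) \<le> 1" .
  moreover have "(\<Sum>i\<in>I. (f i / F) powr \<theta> * (g i / G) powr (1 - \<theta>)) =
      (\<Sum>i\<in>I. f i powr \<theta> * g i powr (1 - \<theta>)) / (F powr \<theta> * G powr (1 - \<theta>))"
    unfolding sum_divide_distrib
    by (intro sum.cong refl) (use assms pos in \<open>simp add: powr_divide\<close>)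
  ultimately show ?thesis using pos by (simp add: F_def G_def divide_le_eq)
qed

lemma sum_powr_concave:
  fixes f :: "'a \<Rightarrow> real"
  assumes "finite I" "\<And>i. i \<in> I \<Longrightarrow> f i \<ge> 0" "0 < \<theta>" "\<theta> < 1"
  shows "(\<Sum>i\<in>I. f i powr \<theta>) \<le> real (card I) powr (1 - \<theta>) * (\<Sum>i\<in>I. f i) powr \<theta>"
proof -
  have "(\<Sum>i\<in>I. f i powr \<theta>) = (\<Sum>i\<in>I. f i powr \<theta> * 1 powr (1 - \<theta>))" by simp
  also have "\<dots> \<le> (\<Sum>i\<in>I. f i) powr \<theta> * (\<Sum>i\<in>I. 1) powr (1 - \<theta>)"
    by (rule Holder_sum) (use assms in auto)
  finally show ?thesis by (simp add: mult.commute)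
qed

text \<open>The largest term controls the sum. The power of the cardinality is crude; the bound
  serves where a fixed power may be lost.\<close>

lemma norm_sum_power_le:
  fixes f :: "'a \<Rightarrow> complex"
  assumes "finite I" "r > 0"
  shows "norm (\<Sum>i\<in>I. f i) ^ r \<le> real (card I) ^ r * (\<Sum>i\<in>I. norm (f i) ^ r)"
proof (cases "I = {}")
  case False
  obtain i0 where i0: "i0 \<in> I" "\<And>i. i \<in> I \<Longrightarrow> norm (f i) \<le> norm (f i0)"
    by (rule obtains_MAX[OF assms(1) False, of "\<lambda>i. norm (f i)"]) (metis Max_ge assms(1) finite_imageI imageI)
  have "norm (\<Sum>i\<in>I. f i) \<le> (\<Sum>i\<in>I. norm (f i))" by (rule norm_sum)
  also have "\<dots> \<le> real (card I) * norm (f i0)"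
    using sum_bounded_above[of I "\<lambda>i. norm (f i)" "norm (f i0)"] i0(2) by simp
  finally have "norm (\<Sum>i\<in>I. f i) ^ r \<le> (real (card I) * norm (f i0)) ^ r"
    by (intro power_mono) auto
  also have "\<dots> = real (card I) ^ r * norm (f i0) ^ r" by (simp add: power_mult_distrib)
  also have "\<dots> \<le> real (card I) ^ r * (\<Sum>i\<in>I. norm (f i) ^ r)"
    using assms(1) i0(1) by (intro mult_left_mono member_le_sum) auto
  finally show ?thesis .
qed (use assms in \<open>simp add: zero_power\<close>)

lemma chi_minus: "chi q (- m) = cnj (chi q m)"
proof -
  have "chi q m * chi q (- m) = chi q m * cnj (chi q m)"
    by (simp add: chi_eq_1 complex_norm_square[symmetric] flip: chi_add)
  moreover have "chi q m \<noteq> 0" by (metis norm_chi norm_zero zero_neq_one)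
  ultimately show ?thesis by simp
qed

text \<open>Everything is compared with a largest term \<open>f i\<close>. If all others are at most
  \<open>norm (f i) / card I\<close>, they add at most one more copy of it: the narrow case, whose
  factor 2 is independent of the number of terms. Otherwise some \<open>f j\<close> is comparable to
  \<open>f i\<close> up to \<open>card I\<close>, and the exponent \<open>P\<close> may be
  distributed over the two at will.\<close>

lemma broad_narrow:
  fixes f :: "'a \<Rightarrow> complex"
  assumes "finite I" "0 < r" "r < P"
  shows "norm (\<Sum>i\<in>I. f i) ^ P \<le> 2 ^ P * (\<Sum>i\<in>I. norm (f i) ^ P) +
    real (card I) ^ (2 * P) * (\<Sum>i\<in>I. \<Sum>j\<in>I - {i}. norm (f i) ^ r * norm (f j) ^ (P - r))"
proof (cases "I = {}")
  case True
  then show ?thesis using assms by (simp add: zero_power)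
next
  case False
  define m where "m = card I"
  have m: "m > 0" using False assms(1) by (simp add: m_def card_gt_0_iff)
  obtain i where i: "i \<in> I" "\<And>j. j \<in> I \<Longrightarrow> norm (f j) \<le> norm (f i)"
    by (rule obtains_MAX[OF assms(1) False, of "\<lambda>i. norm (f i)"]) (metis Max_ge assms(1) finite_imageI imageI)
  have nn: "0 \<le> 2 ^ P * (\<Sum>i\<in>I. norm (f i) ^ P)"
    "0 \<le> real m ^ (2 * P) * (\<Sum>i\<in>I. \<Sum>j\<in>I - {i}. norm (f i) ^ r * norm (f j) ^ (P - r))"
    by (intro mult_nonneg_nonneg sum_nonneg; simp)+
  have le: "norm (\<Sum>i\<in>I. f i) \<le> (\<Sum>i\<in>I. norm (f i))" by (rule norm_sum)
  show ?thesis
  proof (cases "\<forall>j\<in>I - {i}. m * norm (f j) \<le> norm (f i)")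
    case True
    have "(\<Sum>j\<in>I. norm (f j)) = norm (f i) + (\<Sum>j\<in>I - {i}. norm (f j))"
      using i assms(1) by (simp add: sum.remove)
    also have "(\<Sum>j\<in>I - {i}. norm (f j)) \<le> real (card (I - {i})) * (norm (f i) / m)"
      by (rule sum_bounded_above) (use True m in \<open>simp add: field_simps\<close>)
    also have "\<dots> \<le> real m * (norm (f i) / m)"
      unfolding m_def using assms(1) by (intro mult_right_mono) (auto intro: card_mono)
    also have "\<dots> = norm (f i)" using m by simp
    finally have "norm (\<Sum>i\<in>I. f i) \<le> 2 * norm (f i)" using le by simp
    then have "norm (\<Sum>i\<in>I. f i) ^ P \<le> (2 * norm (f i)) ^ P" by (intro power_mono) auto
    also have "\<dots> = 2 ^ P * norm (f i) ^ P" by (simp add: power_mult_distrib)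
    also have "\<dots> \<le> 2 ^ P * (\<Sum>i\<in>I. norm (f i) ^ P)"
      using i assms(1) by (intro mult_left_mono member_le_sum) auto
    finally show ?thesis using nn(2) by (simp add: m_def)
  next
    case False
    then obtain j where j: "j \<in> I - {i}" "norm (f i) < m * norm (f j)" by force
    have "(\<Sum>j\<in>I. norm (f j)) \<le> real m * norm (f i)"
      using sum_bounded_above[of I "\<lambda>j. norm (f j)" "norm (f i)"] i by (simp add: m_def)
    with le have "norm (\<Sum>i\<in>I. f i) ^ P \<le> (real m * norm (f i)) ^ P" by (intro power_mono) auto
    also have "\<dots> = real m ^ P * (norm (f i) ^ r * norm (f i) ^ (P - r))"
      using assms by (simp add: power_mult_distrib flip: power_add)
    also have "\<dots> \<le> real m ^ P * (norm (f i) ^ r * (m * norm (f j)) ^ (P - r))"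
      using j by (intro mult_left_mono power_mono) auto
    also have "\<dots> = real m ^ P * real m ^ (P - r) * (norm (f i) ^ r * norm (f j) ^ (P - r))"
      by (simp add: power_mult_distrib)
    also have "\<dots> \<le> real m ^ (2 * P) * (norm (f i) ^ r * norm (f j) ^ (P - r))"
      unfolding power_add[symmetric] using m by (intro mult_right_mono power_increasing) auto
    also have "norm (f i) ^ r * norm (f j) ^ (P - r) \<le> (\<Sum>j\<in>I - {i}. norm (f i) ^ r * norm (f j) ^ (P - r))"
      using j assms(1) by (intro member_le_sum[where f="\<lambda>j. norm (f i) ^ r * norm (f j) ^ (P - r)"]) auto
    also have "\<dots> \<le> (\<Sum>i\<in>I. \<Sum>j\<in>I - {i}. norm (f i) ^ r * norm (f j) ^ (P - r))"
      using i assms(1) by (intro member_le_sum[where f="\<lambda>i. \<Sum>j\<in>I - {i}. norm (f i) ^ r * norm (f j) ^ (P - r)"]) (auto intro!: sum_nonneg)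
    finally show ?thesis using nn(1) by (simp add: m_def mult_left_mono)
  qed
qed

lemma power_powr_quotient:
  fixes u :: real
  assumes "u \<ge> 0" "m > 0" "n > 0"
  shows "(u ^ m) powr (real n / real m) = u ^ n"
proof (cases "u = 0")
  case False
  then show ?thesis using assms
    by (simp add: powr_powr flip: powr_realpow)
qed (use assms in \<open>simp add: zero_power\<close>)

section \<open>Shift polynomials\<close>

text \<open>The factor \<open>fact k\<close> clears the denominators of the formal antiderivative up
  to degree \<open>k\<close>, and it is a unit modulo every prime exceeding
  \<open>k\<close>.\<close>

definition antider :: "nat \<Rightarrow> int poly \<Rightarrow> int poly" where
  "antider k h = (\<Sum>j<k. monom (int (fact k div Suc j) * coeff h j) (Suc j))"

lemma coeff_antider:
  "coeff (antider k h) i = (if 0 < i \<and> i \<le> k then int (fact k div i) * coeff h (i - 1) else 0)"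
proof (cases i)
  case (Suc i')
  have "coeff (antider k h) i = (\<Sum>j<k. if j = i' then int (fact k div Suc j) * coeff h j else 0)"
    by (auto simp: antider_def coeff_sum coeff_monom Suc intro!: sum.cong)
  then show ?thesis by (simp add: Suc Suc_le_eq)
qed (simp add: antider_def coeff_sum)

lemma pderiv_antider:
  assumes "degree h < k" shows "pderiv (antider k h) = smult (fact k) h"
proof (rule poly_eqI)
  fix i
  show "coeff (pderiv (antider k h)) i = coeff (smult (fact k) h) i"
  proof (cases "i < k")
    case True
    then have "Suc i dvd fact k" by (intro dvd_fact) auto
    then have "Suc i * (fact k div Suc i) = (fact k :: nat)" by (rule dvd_mult_div_cancel)
    then have "int (Suc i) * int (fact k div Suc i) = fact k"
      by (metis of_nat_fact of_nat_mult)
    then show ?thesis using True by (simp add: coeff_pderiv coeff_antider flip: mult.assoc)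
  next
    case False
    then show ?thesis using assms by (simp add: coeff_pderiv coeff_antider coeff_eq_0)
  qed
qed

lemma degree_antider: "degree (antider k h) \<le> k"
  by (rule degree_le) (simp add: coeff_antider)

text \<open>The powers \<open>T ^ j\<close> with \<open>k - l < j \<le> k\<close> span, modulo constants and \<open>p ^ m\<close>, all polynomials in
  \<open>T - \<omega>\<close> truncated at degree \<open>l\<close>: the derivatives \<open>T ^ (k - l) * (T - \<omega>) ^ i\<close> are triangular.\<close>

lemma high_powers_leading:
  fixes k l i :: nat and \<omega> :: int
  assumes "1 \<le> i" "i \<le> l" "l \<le> k"
  obtains Q :: "int poly" and S :: "int poly" and c where
    "degree Q \<le> k" "\<And>j. j \<le> k - l \<Longrightarrow> coeff Q j = 0"
    "\<And>U. poly Q (\<omega> + U) = c + poly S U" "\<And>j. j < i \<Longrightarrow> coeff S j = 0"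
    "coeff S i = int (fact k div i) * \<omega> ^ (k - l)"
proof -
  \<comment> \<open>The factor \<open>T ^ (k - l)\<close> makes the antiderivative start at degree
    \<open>k - l + 1\<close>; the factor \<open>(T - \<omega>) ^ (i - 1)\<close> makes it vanish to
    order \<open>i\<close> at \<omega>, up to a constant. The polynomial \<open>h'\<close> is
    \<open>h\<close> written in \<open>U = T - \<omega>\<close>.\<close>
  define h where "h = monom 1 (k - l) * [:-\<omega>, 1:] ^ (i - 1)"
  define Q where "Q = antider k h"
  define h' where "h' = monom 1 (i - 1) * [:\<omega>, 1:] ^ (k - l)"
  define S where "S = antider k h'"
  have deg: "degree h < k" "degree h' < k"
    using assms by (auto simp: h_def h'_def degree_mult_eq degree_monom_eq degree_power_eq)
  have ch: "coeff h j = 0" if "j < k - l" for j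
    using that by (simp add: h_def coeff_monom_mult)
  have ch': "coeff h' j = 0" if "j < i - 1" for j
    using that by (simp add: h'_def coeff_monom_mult)
  have "coeff ([:\<omega>, 1:] ^ (k - l)) 0 = \<omega> ^ (k - l)"
    by (simp add: coeff_0_power)
  then have ci: "coeff h' (i - 1) = \<omega> ^ (k - l)"
    by (simp add: h'_def coeff_monom_mult)
  have pow: "pcompose (q ^ n) r = pcompose q r ^ n" for q r :: "int poly" and n
    by (induction n) (auto simp: pcompose_mult pcompose_1)
  have "pcompose h [:\<omega>, 1:] = h'"
    by (simp add: h_def h'_def pcompose_mult pow pcompose_pCons monom_altdef mult.commute)
  then have "pderiv (pcompose Q [:\<omega>, 1:] - S) = 0"
    using deg by (simp add: pderiv_diff pderiv_pcompose Q_def S_def pderiv_antider pcompose_smult pderiv_pCons)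
  then obtain c where c: "pcompose Q [:\<omega>, 1:] - S = [:c:]"
    using degree_eq_zeroE pderiv_eq_0_iff by blast
  have "poly Q (\<omega> + U) = c + poly S U" for U
    using arg_cong[OF c, of "\<lambda>q. poly q U"] by (simp add: poly_pcompose)
  then show ?thesis
    using assms ch ch' ci
    by (intro that[of Q c S]) (auto simp: Q_def S_def degree_antider coeff_antider)
qed

section \<open>Decoupling over residue classes modulo prime powers\<close>

text \<open>\<open>mu k n l\<close> is the saving, in units of the current scale \<open>b\<close>, of the \<open>l\<close>-th bilinear expression after \<open>n\<close>
  rounds of the iteration. The weights of the recursion preserve the sum over \<open>0 < l < k\<close>, so the boundary
  value at \<open>l = 0\<close> makes that sum grow linearly.\<close>

fun mu :: "nat \<Rightarrow> nat \<Rightarrow> nat \<Rightarrow> real" where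
  "mu k 0 l = (if l = 0 then 1 else 0)"
| "mu k (Suc n) l = (if l = 0 then 1 else
     mu k n (k - l) / real l + (real k - real l) / (real k - real l + 1) * mu k n (l - 1))"

lemma mu_0 [simp]: "mu k n 0 = 1"
  by (cases n) auto

text \<open>Substituting \<open>l = k - j\<close> and \<open>l = j + 1\<close> in the two terms of
  the recursion, the value at \<open>j > 0\<close> enters with weights 1 / (k - j) and (k - j - 1) /
  (k - j), which add up to 1; the boundary value at \<open>j = 0\<close> feeds in (k - 1) / k per
  round.\<close>

lemma mu_sum:
  assumes "k \<ge> 2"
  shows "(\<Sum>l\<in>{1..<k}. mu k n l) = real n * (real k - 1) / real k"
proof (induction n)
  case (Suc n)
  define m where "m = mu k n"
  have a: "(\<Sum>l\<in>{1..<k}. m (k - l) / real l) = (\<Sum>j\<in>{1..<k}. m j / (real k - real j))"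
    by (rule sum.reindex_bij_witness[of _ "\<lambda>j. k - j" "\<lambda>j. k - j"]) (auto simp: of_nat_diff)
  have "(\<Sum>l\<in>{1..<k}. (real k - real l) / (real k - real l + 1) * m (l - 1)) =
      (\<Sum>j\<in>{0..<k - 1}. (real k - real j - 1) / (real k - real j) * m j)"
    by (rule sum.reindex_bij_witness[of _ "\<lambda>j. j + 1" "\<lambda>j. j - 1"]) (auto simp: of_nat_diff algebra_simps)
  also have "\<dots> = (\<Sum>j\<in>{0..<k}. (real k - real j - 1) / (real k - real j) * m j)"
  proof (rule sum.mono_neutral_left)
    show "\<forall>i\<in>{0..<k} - {0..<k - 1}. (real k - real i - 1) / (real k - real i) * m i = 0"
    proof
      fix i assume "i \<in> {0..<k} - {0..<k - 1}"
      then have "i = k - 1" by auto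
      then show "(real k - real i - 1) / (real k - real i) * m i = 0" using assms by (simp add: of_nat_diff)
    qed
  qed auto
  also have "\<dots> = (real k - 1) / real k + (\<Sum>j\<in>{1..<k}. (real k - real j - 1) / (real k - real j) * m j)"
    using assms by (subst sum.atLeast_Suc_lessThan) (auto simp: m_def)
  finally have b: "(\<Sum>l\<in>{1..<k}. (real k - real l) / (real k - real l + 1) * m (l - 1)) =
      (real k - 1) / real k + (\<Sum>j\<in>{1..<k}. (real k - real j - 1) / (real k - real j) * m j)" .
  have "(\<Sum>l\<in>{1..<k}. mu k (Suc n) l) = (\<Sum>l\<in>{1..<k}. m (k - l) / real l + (real k - real l) / (real k - real l + 1) * m (l - 1))"
    by (intro sum.cong refl) (auto simp: m_def)
  also have "\<dots> = (real k - 1) / real k + (\<Sum>j\<in>{1..<k}. m j / (real k - real j) + (real k - real j - 1) / (real k - real j) * m j)"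
    unfolding sum.distrib a b by simp
  also have "(\<Sum>j\<in>{1..<k}. m j / (real k - real j) + (real k - real j - 1) / (real k - real j) * m j) = (\<Sum>j\<in>{1..<k}. m j)"
  proof (intro sum.cong refl)
    fix j assume "j \<in> {1..<k}"
    then have "real k - real j \<noteq> 0" by simp
    then have "m j / (real k - real j) + (real k - real j - 1) / (real k - real j) * m j =
        (real k - real j) * m j / (real k - real j)"
      by (simp add: add_divide_distrib[symmetric] algebra_simps)
    also have "\<dots> = m j" using \<open>real k - real j \<noteq> 0\<close> by simp
    finally show "m j / (real k - real j) + (real k - real j - 1) / (real k - real j) * m j = m j" .
  qed
  finally show ?case using Suc assms by (simp add: m_def field_simps)
qed (use assms in auto)

text \<open>\<open>p \<ge> 8\<close> guarantees \<open>2 ^ (k (k + 1)) \<le> p powr gain k\<close>, so the narrow part of the broad-narrow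
  splitting loses nothing.\<close>

locale prime_scale =
  fixes p :: nat
  assumes prime_p: "prime p" and p_ge: "p \<ge> 8"
begin

lemma p_pos [simp]: "p > 0" and p_pos' [simp]: "p \<noteq> 0" "Suc 0 \<le> p" "real p > 0" "real p \<noteq> 0" "int p > 0" "real p > 1" "real p \<ge> 1"
  using p_ge by auto

definition cls :: "nat \<Rightarrow> int \<Rightarrow> int set" where
  "cls a \<xi> = {n. [n = \<xi>] (mod int p ^ a)}"

definition moment :: "nat \<Rightarrow> nat \<Rightarrow> nat \<Rightarrow> (int \<Rightarrow> complex) \<Rightarrow> int set \<Rightarrow> real" where
  "moment k Q r c A = (\<Sum>x\<in>freqs k (p ^ Q). norm (expsum k (p ^ Q) c A x) ^ r)"

text \<open>With \<open>P = k * (k + 1)\<close>, this is the power of the number of classes that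
  Hoelder loses in passing from an l^2 sum over classes to an l^P sum.\<close>

definition gain :: "nat \<Rightarrow> real" where
  "gain k = real (k * (k + 1)) / 2 - 1"

text \<open>The modulus \<open>p ^ (k * B)\<close> is matched to classes modulo
  \<open>p ^ B\<close>: with it the inequality is stable under the affine change n = \<xi> + p^a z,
  which turns \<open>B\<close> into \<open>B - a\<close>. The goal is a factor \<open>K\<close> of
  size \<open>p powr (\<epsilon> * B)\<close>.\<close>

definition decouples :: "nat \<Rightarrow> nat \<Rightarrow> real \<Rightarrow> bool" where
  "decouples k B K \<longleftrightarrow> (\<forall>c A. finite A \<longrightarrow> moment k (k * B) (k * (k + 1)) c A \<le>
     K * p powr (B * gain k) * (\<Sum>J\<in>{0..<int p ^ B}. moment k (k * B) (k * (k + 1)) c (A \<inter> cls B J)))"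

lemma moment_nonneg [simp]: "moment k Q r c A \<ge> 0"
  by (simp add: moment_def sum_nonneg)

lemma decouples_mono: "decouples k B K \<Longrightarrow> K \<le> K' \<Longrightarrow> decouples k B K'"
  unfolding decouples_def
  by (meson mult_right_mono order_trans powr_ge_zero sum_nonneg moment_nonneg)

lemma cls_partition_disjoint:
  assumes "J \<in> {0..<int p ^ B}" "J' \<in> {0..<int p ^ B}" "J \<noteq> J'"
  shows "cls B J \<inter> cls B J' = {}"
proof (rule ccontr)
  assume "cls B J \<inter> cls B J' \<noteq> {}"
  then obtain n where "[n = J] (mod int p ^ B)" "[n = J'] (mod int p ^ B)"
    by (auto simp: cls_def)
  then have "[J = J'] (mod int p ^ B)" by (metis cong_sym cong_trans)
  then show False using assms by (auto dest: cong_less_imp_eq_int)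
qed

lemma cls_partition_UN: "A = (\<Union>J\<in>{0..<int p ^ B}. A \<inter> cls B J)"
proof -
  have "n \<in> cls B (n mod int p ^ B)" "n mod int p ^ B \<in> {0..<int p ^ B}" for n
    by (auto simp: cls_def cong_def)
  then show ?thesis by blast
qed

lemma expsum_partition:
  assumes "finite A"
  shows "expsum k q c A x = (\<Sum>J\<in>{0..<int p ^ B}. expsum k q c (A \<inter> cls B J) x)"
  by (subst cls_partition_UN[of A B], rule expsum_disjoint_UN)
     (use assms cls_partition_disjoint in \<open>fastforce simp: disjoint_family_on_def\<close>)+

lemma expsum_reindex:
  fixes l :: nat
  assumes A: "A \<subseteq> cls a \<xi>" and zdef: "z = (\<lambda>n. (n - \<xi>) div int p ^ a)"
  shows "inj_on z A" and "n \<in> A \<Longrightarrow> n = \<xi> + int p ^ a * z n"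
proof -
  have n: "n = \<xi> + int p ^ a * z n" if "n \<in> A" for n
  proof -
    have "int p ^ a dvd n - \<xi>" using A that by (auto simp: cls_def cong_iff_dvd_diff)
    then show ?thesis by (simp add: zdef)
  qed
  then show "inj_on z A" by (metis inj_onI)
  show "n \<in> A \<Longrightarrow> n = \<xi> + int p ^ a * z n" by (rule n)
qed

lemma mem_cls_sub:
  "\<xi> + int p ^ a * z \<in> cls (a + B) (\<xi> + int p ^ a * J) \<longleftrightarrow> z \<in> cls B J"
proof -
  have "\<xi> + int p ^ a * z - (\<xi> + int p ^ a * J) = int p ^ a * (z - J)"
    by (simp add: algebra_simps)
  then show ?thesis
    using p_pos by (simp add: cls_def cong_iff_dvd_diff power_add del: p_pos)
qed

text \<open>The frequency \<open>x\<close> is averaged over translations by the polynomials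
  \<open>\<Sum>i\<le>l. smult (w i) (g i)\<close>. By \<open>val\<close>, such a translation acts on
  \<open>A\<close>, apart from a constant phase, as the degree \<open>l\<close> frequency
  \<open>w\<close> modulo \<open>p ^ (l * B)\<close> in the variable
  \<open>(n - \<xi>) div int p ^ a\<close>, so decoupling in degree \<open>l\<close> applies for
  each fixed \<open>x\<close>. By \<open>inv\<close> the weight does not notice; hence all
  translates contribute the same sum over \<open>x\<close>, and the averaging can be undone.\<close>

lemma transfer:
  fixes A :: "int set"
  assumes decouples: "decouples l B K" and A: "finite A" "A \<subseteq> cls a \<xi>"
    and deg: "\<And>i. i \<le> l \<Longrightarrow> degree (g i) \<le> k"
    and lB: "l * B \<le> Q"
    and val: "\<And>i n. i \<le> l \<Longrightarrow> n \<in> A \<Longrightarrow>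
       [poly (g i) n = \<kappa> i + int p ^ (Q - l * B) * ((n - \<xi>) div int p ^ a) ^ i] (mod int p ^ Q)"
    and per: "\<And>x y. (\<And>j. j \<le> k \<Longrightarrow> [x j = y j] (mod int p ^ Q)) \<Longrightarrow> W x = W y"
    and inv: "\<And>w x. W (\<lambda>j. x j + coeff (\<Sum>i\<le>l. smult (w i) (g i)) j) = W x"
    and W: "\<And>x. W x \<ge> 0"
  shows "(\<Sum>x\<in>freqs k (p ^ Q). W x * norm (expsum k (p ^ Q) c A x) ^ (l * (l + 1))) \<le>
    K * p powr (B * gain l) * (\<Sum>J\<in>{0..<int p ^ B}. \<Sum>x\<in>freqs k (p ^ Q).
       W x * norm (expsum k (p ^ Q) c (A \<inter> cls (a + B) (\<xi> + int p ^ a * J)) x) ^ (l * (l + 1)))"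
proof -
  let ?X = "freqs k (p ^ Q)"
  let ?E = "expsum k (p ^ Q) c"
  let ?sh = "\<lambda>w x j. x j + coeff (\<Sum>i\<le>l. smult (w i) (g i)) j"
  define r where "r = l * (l + 1)"
  define z where "z = (\<lambda>n. (n - \<xi>) div int p ^ a)"
  \<comment> \<open>For fixed \<open>x\<close> the old phase is absorbed into the coefficients of a
    degree \<open>l\<close> sum in the rescaled variable.\<close>
  define C where "C = (\<lambda>x y. c (\<xi> + int p ^ a * y) * chi (p ^ Q) (\<Sum>j\<le>k. x j * (\<xi> + int p ^ a * y) ^ j))"
  have key: "(\<Sum>x\<in>?X. W x * moment l (l * B) r (C x) (z ` A')) =
      (p ^ (l * B)) ^ Suc l * (\<Sum>x\<in>?X. W x * norm (?E A' x) ^ r)"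
    if A': "A' \<subseteq> A" for A'
  proof -
    have inj: "inj_on z A'"
      using expsum_reindex(1)[OF A(2) z_def] A' by (meson inj_on_subset)
    have n: "\<xi> + int p ^ a * z n = n" if "n \<in> A'" for n
      using expsum_reindex(2)[OF A(2) z_def] A' that by (metis subsetD)
    have *: "norm (expsum l (p ^ (l * B)) (C x) (z ` A') w) =
        norm (?E A' (?sh w x))" for w x
    proof -
      have "degree (\<Sum>i\<le>l. smult (w i) (g i)) \<le> k"
        by (rule degree_sum_le) (use deg order_trans[OF degree_smult_le] in auto)
      note sh = expsum_shift[OF this]
      have eq: "chi (p ^ Q) (poly (\<Sum>i\<le>l. smult (w i) (g i)) n) =
          chi (p ^ Q) (\<Sum>i\<le>l. w i * \<kappa> i) * chi (p ^ (l * B)) (\<Sum>i\<le>l. w i * z n ^ i)"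
        if "n \<in> A'" for n
      proof -
        have "[(\<Sum>i\<le>l. w i * poly (g i) n) = (\<Sum>i\<le>l. w i * (\<kappa> i + int p ^ (Q - l * B) * z n ^ i))] (mod int p ^ Q)"
          by (intro cong_sum cong_mult cong_refl) (use val A' that in \<open>auto simp: z_def\<close>)
        also have "(\<Sum>i\<le>l. w i * (\<kappa> i + int p ^ (Q - l * B) * z n ^ i)) =
            (\<Sum>i\<le>l. w i * \<kappa> i) + int (p ^ (Q - l * B)) * (\<Sum>i\<le>l. w i * z n ^ i)"
          by (simp add: algebra_simps sum.distrib sum_distrib_left)
        finally have "chi (p ^ Q) (poly (\<Sum>i\<le>l. smult (w i) (g i)) n) =
            chi (p ^ Q) (\<Sum>i\<le>l. w i * \<kappa> i) * chi (p ^ Q) (int (p ^ (Q - l * B)) * (\<Sum>i\<le>l. w i * z n ^ i))"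
          by (simp add: poly_sum chi_cong flip: chi_add)
        \<comment> \<open>Cancelling \<open>p ^ (Q - l * B)\<close> lowers the modulus to the one
          that belongs to degree \<open>l\<close> and scale \<open>B\<close>.\<close>
        also have "chi (p ^ Q) (int (p ^ (Q - l * B)) * (\<Sum>i\<le>l. w i * z n ^ i)) =
            chi (p ^ (l * B)) (\<Sum>i\<le>l. w i * z n ^ i)"
        proof -
          have "p ^ Q = p ^ (Q - l * B) * p ^ (l * B)"
            using lB by (simp flip: power_add)
          then show ?thesis by (simp only: chi_mult_cancel[of "p ^ (Q - l * B)"] p_pos zero_less_power)
        qed
        finally show ?thesis .
      qed
      have Cz: "C x (z n) = c n * chi (p ^ Q) (\<Sum>j\<le>k. x j * n ^ j)" if "n \<in> A'" for n
        by (simp only: C_def n[OF that])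
      have "?E A' (?sh w x) =
         (\<Sum>n\<in>A'. chi (p ^ Q) (\<Sum>i\<le>l. w i * \<kappa> i) * (C x (z n) * chi (p ^ (l * B)) (\<Sum>i\<le>l. w i * z n ^ i)))"
        unfolding sh unfolding expsum_def
        by (intro sum.cong refl) (simp add: eq Cz)
      also have "\<dots> = chi (p ^ Q) (\<Sum>i\<le>l. w i * \<kappa> i) * expsum l (p ^ (l * B)) (C x) (z ` A') w"
        by (simp add: expsum_def sum_distrib_left sum.reindex[OF inj])
      finally show ?thesis by (simp add: norm_mult)
    qed
    have "(\<Sum>x\<in>?X. W x * moment l (l * B) r (C x) (z ` A')) =
       (\<Sum>w\<in>freqs l (p ^ (l * B)). \<Sum>x\<in>?X. W x *
          norm (?E A' (?sh w x)) ^ r)"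
      unfolding moment_def * sum_distrib_left by (rule sum.swap)
    also have "\<dots> = (\<Sum>w\<in>freqs l (p ^ (l * B)). \<Sum>x\<in>?X. W x * norm (?E A' x) ^ r)"
    proof (rule sum.cong[OF refl])
      fix w
      have "(\<Sum>x\<in>?X. W x *
          norm (?E A' (?sh w x)) ^ r) =
         (\<Sum>x\<in>?X. W (?sh w x) *
          norm (?E A' (?sh w x)) ^ r)"
        by (simp only: inv)
      also have "\<dots> = (\<Sum>x\<in>?X. W x * norm (?E A' x) ^ r)"
        by (rule sum_freqs_shift[where \<Phi>="\<lambda>x. W x * norm (?E A' x) ^ r"])
           (auto intro!: arg_cong2[where f="(*)"] per arg_cong[where f="\<lambda>t. norm t ^ r"] expsum_cong_freq)
      finally show "(\<Sum>x\<in>?X. W x *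
          norm (?E A' (?sh w x)) ^ r) =
         (\<Sum>x\<in>?X. W x * norm (?E A' x) ^ r)" .
    qed
    also have "\<dots> = (p ^ (l * B)) ^ Suc l * (\<Sum>x\<in>?X. W x * norm (?E A' x) ^ r)"
      by (simp add: card_freqs power_mult)
    finally show ?thesis .
  qed
  define D where "D = real ((p ^ (l * B)) ^ Suc l)"
  have D: "D > 0" by (simp add: D_def)
  have img: "z ` A \<inter> cls B J = z ` (A \<inter> cls (a + B) (\<xi> + int p ^ a * J))" for J
  proof -
    have "z n \<in> cls B J \<longleftrightarrow> n \<in> cls (a + B) (\<xi> + int p ^ a * J)" if "n \<in> A" for n
      using mem_cls_sub[of \<xi> a "z n" B J] expsum_reindex(2)[OF A(2) z_def that] by simp
    then show ?thesis by blast
  qed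
  have "D * (\<Sum>x\<in>?X. W x * norm (?E A x) ^ r) =
      (\<Sum>x\<in>?X. W x * moment l (l * B) r (C x) (z ` A))"
    by (simp only: key[OF order_refl] D_def)
  also have "\<dots> \<le> (\<Sum>x\<in>?X. W x * (K * p powr (B * gain l) *
      (\<Sum>J\<in>{0..<int p ^ B}. moment l (l * B) r (C x) (z ` A \<inter> cls B J))))"
    by (intro sum_mono mult_left_mono W decouples[unfolded decouples_def, rule_format, folded r_def] finite_imageI A(1))
  also have "\<dots> = (\<Sum>x\<in>?X. \<Sum>J\<in>{0..<int p ^ B}.
      K * p powr (B * gain l) * (W x * moment l (l * B) r (C x) (z ` A \<inter> cls B J)))"
    unfolding sum_distrib_left by (intro sum.cong refl) (simp only: mult_ac)
  also have "\<dots> = (\<Sum>J\<in>{0..<int p ^ B}. \<Sum>x\<in>?X.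
      K * p powr (B * gain l) * (W x * moment l (l * B) r (C x) (z ` A \<inter> cls B J)))"
    by (rule sum.swap)
  also have "\<dots> = (\<Sum>J\<in>{0..<int p ^ B}. D * (K * p powr (B * gain l) * (\<Sum>x\<in>?X.
       W x * norm (?E (A \<inter> cls (a + B) (\<xi> + int p ^ a * J)) x) ^ r)))"
    unfolding sum_distrib_left[symmetric] img key[OF Int_lower1] D_def
    by (rule mult.left_commute)
  also have "\<dots> = D * (K * p powr (B * gain l) * (\<Sum>J\<in>{0..<int p ^ B}. \<Sum>x\<in>?X.
       W x * norm (?E (A \<inter> cls (a + B) (\<xi> + int p ^ a * J)) x) ^ r))"
    by (simp only: sum_distrib_left)
  finally show ?thesis using D unfolding r_def by (simp only: mult_le_cancel_left_pos)
qed

section \<open>Bilinear estimates and decoupling\<close>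

text \<open>Downward induction on \<open>i\<close>. The leading coefficient at \<open>U ^ i\<close>
  is a unit modulo \<open>p ^ m\<close>, because \<open>k < p\<close> and \<open>p\<close> does not
  divide \<omega>; terms of degree \<open>i + 1\<close> to \<open>l\<close> are removed with the
  polynomials already found, and those above \<open>l\<close> vanish modulo \<open>p ^ m\<close> for
  the admissible \<open>U\<close>.\<close>

lemma high_powers_span:
  fixes k l :: nat and \<omega> :: int
  assumes "l \<le> k" "k < p" "\<not> int p dvd \<omega>" "1 \<le> i" "i \<le> l"
  shows "\<exists>Q c. degree Q \<le> k \<and> (\<forall>j\<le>k - l. coeff Q j = 0) \<and>
     (\<forall>U. int p ^ m dvd U ^ Suc l \<longrightarrow> [poly Q (\<omega> + U) = c + U ^ i] (mod int p ^ m))"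
  using assms(4,5)
proof (induction "l - i" arbitrary: i rule: less_induct)
  case less
  obtain Q S c where Q: "degree Q \<le> k" "\<And>j. j \<le> k - l \<Longrightarrow> coeff Q j = 0"
    and S: "\<And>U. poly Q (\<omega> + U) = c + poly S U" "\<And>j. j < i \<Longrightarrow> coeff S j = 0"
      "coeff S i = int (fact k div i) * \<omega> ^ (k - l)"
    using high_powers_leading[of i l k \<omega>] less.prems assms(1) by metis
  have "coprime (coeff S i) (int p ^ m)"
  proof -
    have "\<not> p dvd fact k" using assms(2) prime_p by (simp add: prime_dvd_fact_iff)
    moreover have "i dvd fact k" using less.prems assms by (intro dvd_fact) auto
    then have "fact k div i dvd (fact k :: nat)" by (metis dvd_div_mult_self dvd_triv_left)
    ultimately have "\<not> p dvd fact k div i" using dvd_trans by blast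
    then have "\<not> int p dvd int (fact k div i)" by (simp only: int_dvd_int_iff not_False_eq_True)
    moreover have "prime (int p)" using prime_p by simp
    ultimately have "\<not> int p dvd coeff S i"
      using assms(3) unfolding S(3) by (metis prime_dvd_mult_iff prime_dvd_power)
    then show ?thesis
      using \<open>prime (int p)\<close> by (metis coprime_commute coprime_power_left_iff prime_imp_coprime)
  qed
  then obtain v where v: "[coeff S i * v = 1] (mod int p ^ m)"
    using cong_solve_coprime_int by blast
  have "\<exists>Q' c'. \<forall>t\<in>{i<..l}. degree (Q' t) \<le> k \<and> (\<forall>j\<le>k - l. coeff (Q' t) j = 0) \<and>
     (\<forall>U. int p ^ m dvd U ^ Suc l \<longrightarrow> [poly (Q' t) (\<omega> + U) = c' t + U ^ t] (mod int p ^ m))"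
  proof -
    have "\<forall>t\<in>{i<..l}. \<exists>Q' c'. degree Q' \<le> k \<and> (\<forall>j\<le>k - l. coeff Q' j = 0) \<and>
     (\<forall>U. int p ^ m dvd U ^ Suc l \<longrightarrow> [poly Q' (\<omega> + U) = c' + U ^ t] (mod int p ^ m))"
      using less by auto
    then show ?thesis by metis
  qed
  then obtain Q' c' where Q': "\<And>t. t \<in> {i<..l} \<Longrightarrow> degree (Q' t) \<le> k"
     "\<And>t j. t \<in> {i<..l} \<Longrightarrow> j \<le> k - l \<Longrightarrow> coeff (Q' t) j = 0"
     "\<And>t U. t \<in> {i<..l} \<Longrightarrow> int p ^ m dvd U ^ Suc l \<Longrightarrow>
        [poly (Q' t) (\<omega> + U) = c' t + U ^ t] (mod int p ^ m)"
    by blast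
  define R where "R = smult v (Q - (\<Sum>t\<in>{i<..l}. smult (coeff S t) (Q' t)))"
  define d where "d = v * (c - (\<Sum>t\<in>{i<..l}. coeff S t * c' t))"
  have "degree R \<le> k"
    unfolding R_def
    by (intro order_trans[OF degree_smult_le] degree_diff_le degree_sum_le Q) (auto intro: Q')
  moreover have "\<forall>j\<le>k - l. coeff R j = 0"
    by (simp add: R_def coeff_sum Q Q')
  moreover have "[poly R (\<omega> + U) = d + U ^ i] (mod int p ^ m)" if U: "int p ^ m dvd U ^ Suc l" for U
  proof -
    have "[poly S U = coeff S i * U ^ i + (\<Sum>t\<in>{i<..l}. coeff S t * U ^ t)] (mod int p ^ m)"
    proof -
      define n where "n = max l (degree S)"
      have "poly S U = (\<Sum>t\<le>n. coeff S t * U ^ t)"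
        by (rule poly_eq_sum_le) (simp add: n_def)
      also have "{..n} = {..<i} \<union> {i..l} \<union> {l<..n}" using less.prems by (auto simp: n_def)
      also have "(\<Sum>t\<in>\<dots>. coeff S t * U ^ t) = (\<Sum>t\<in>{..<i}. coeff S t * U ^ t) +
          (\<Sum>t\<in>{i..l}. coeff S t * U ^ t) + (\<Sum>t\<in>{l<..n}. coeff S t * U ^ t)"
        using less.prems by (subst sum.union_disjoint; (subst sum.union_disjoint)?) auto
      also have "(\<Sum>t\<in>{..<i}. coeff S t * U ^ t) = 0" by (simp add: S)
      also have "(\<Sum>t\<in>{i..l}. coeff S t * U ^ t) = coeff S i * U ^ i + (\<Sum>t\<in>{i<..l}. coeff S t * U ^ t)"
        using less.prems by (simp add: sum.head)
      finally have "poly S U - (coeff S i * U ^ i + (\<Sum>t\<in>{i<..l}. coeff S t * U ^ t)) =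
         (\<Sum>t\<in>{l<..n}. coeff S t * U ^ t)" by simp
      also have "int p ^ m dvd \<dots>"
      proof (intro dvd_sum dvd_mult)
        fix t assume "t \<in> {l<..n}"
        then have "U ^ Suc l dvd U ^ t" by (intro le_imp_power_dvd) auto
        then show "int p ^ m dvd U ^ t" using U dvd_trans by blast
      qed
      finally show ?thesis by (simp add: cong_iff_dvd_diff)
    qed
    moreover have "[(\<Sum>t\<in>{i<..l}. coeff S t * poly (Q' t) (\<omega> + U)) =
        (\<Sum>t\<in>{i<..l}. coeff S t * (c' t + U ^ t))] (mod int p ^ m)"
      by (intro cong_sum cong_mult cong_refl Q' U)
    ultimately have "[v * (c + poly S U - (\<Sum>t\<in>{i<..l}. coeff S t * poly (Q' t) (\<omega> + U))) =
        v * (c + (coeff S i * U ^ i + (\<Sum>t\<in>{i<..l}. coeff S t * U ^ t)) -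
         (\<Sum>t\<in>{i<..l}. coeff S t * (c' t + U ^ t)))] (mod int p ^ m)"
      by (intro cong_mult cong_add cong_diff cong_refl)
    also have "v * (c + (coeff S i * U ^ i + (\<Sum>t\<in>{i<..l}. coeff S t * U ^ t)) -
         (\<Sum>t\<in>{i<..l}. coeff S t * (c' t + U ^ t))) = d + (coeff S i * v) * U ^ i"
      by (simp add: d_def algebra_simps sum.distrib)
    also have "[d + (coeff S i * v) * U ^ i = d + 1 * U ^ i] (mod int p ^ m)"
      by (intro cong_add cong_mult cong_refl v)
    finally show ?thesis by (simp add: R_def S poly_sum)
  qed
  ultimately show ?case by blast
qed

section \<open>Sums over the finest classes and affine rescaling\<close>

definition fsum :: "nat \<Rightarrow> nat \<Rightarrow> (int \<Rightarrow> complex) \<Rightarrow> int set \<Rightarrow> real" where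
  "fsum k B c A = (\<Sum>J\<in>{0..<int p ^ B}. moment k (k * B) (k * (k + 1)) c (A \<inter> cls B J))"

text \<open>Normalised so that decoupling at exponent loss \<open>K\<close> bounds the moment of a class modulo \<open>p ^ a\<close> by
  \<open>K\<close> times this sum.\<close>

definition scaled :: "nat \<Rightarrow> nat \<Rightarrow> nat \<Rightarrow> (int \<Rightarrow> complex) \<Rightarrow> int set \<Rightarrow> real" where
  "scaled k B a c A = p powr ((real B - real a) * gain k) * fsum k B c A"

lemma decouples_fsum: "decouples k B K \<longleftrightarrow> (\<forall>c A. finite A \<longrightarrow> moment k (k * B) (k * (k + 1)) c A \<le>
     K * p powr (B * gain k) * fsum k B c A)"
  by (simp add: decouples_def fsum_def)

lemma fsum_nonneg [simp]: "fsum k B c A \<ge> 0"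
  by (simp add: fsum_def sum_nonneg)

lemma scaled_nonneg [simp]: "scaled k B a c A \<ge> 0"
  by (simp add: scaled_def)

lemma moment_empty: "k \<ge> 1 \<Longrightarrow> moment k Q (k * (k + 1)) c {} = 0"
  by (simp add: moment_def zero_power)

lemma gain_nonneg: "k \<ge> 1 \<Longrightarrow> gain k \<ge> 0"
proof -
  assume "k \<ge> 1"
  then have "1 * 2 \<le> k * (k + 1)" by (intro mult_mono) auto
  then have "real 2 \<le> real (k * (k + 1))" by (subst of_nat_le_iff) simp
  then show ?thesis by (simp add: gain_def)
qed

lemma cls_subset_or_disjoint:
  assumes "a \<le> B" shows "cls B J \<subseteq> cls a \<zeta> \<or> cls B J \<inter> cls a \<zeta> = {}"
proof -
  have "n' \<in> cls a \<zeta>" if "n \<in> cls B J" "n \<in> cls a \<zeta>" "n' \<in> cls B J" for n n'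
  proof -
    have "[n' = n] (mod int p ^ B)" using that by (auto simp: cls_def intro: cong_trans cong_sym)
    moreover have "int p ^ a dvd int p ^ B" using assms by (rule le_imp_power_dvd)
    ultimately have "[n' = n] (mod int p ^ a)" by (rule cong_dvd_modulus)
    then show ?thesis using that(2) by (auto simp: cls_def intro: cong_trans)
  qed
  then show ?thesis by blast
qed

lemma cls_sub_disjoint:
  assumes "J \<in> {0..<int p ^ B}" "J' \<in> {0..<int p ^ B}" "J \<noteq> J'"
  shows "cls (a + B) (\<xi> + int p ^ a * J) \<inter> cls (a + B) (\<xi> + int p ^ a * J') = {}"
proof (rule ccontr)
  assume "\<not> ?thesis"
  then have "[\<xi> + int p ^ a * J = \<xi> + int p ^ a * J'] (mod int p ^ (a + B))"
    by (auto simp: cls_def) (metis cong_sym cong_trans)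
  then have "\<xi> + int p ^ a * J \<in> cls (a + B) (\<xi> + int p ^ a * J')" by (simp add: cls_def)
  then have "J \<in> cls B J'" by (simp only: mem_cls_sub)
  then have "[J = J'] (mod int p ^ B)" by (simp add: cls_def)
  then show False using assms by (auto dest: cong_less_imp_eq_int)
qed

text \<open>A class modulo \<open>p ^ B\<close> lies in at most one of the disjoint classes modulo
  \<open>p ^ (a + B')\<close> and does not meet the others, so each of its moments is counted at
  most once.\<close>

lemma fsum_subdivide:
  assumes "k \<ge> 1" "a + B' \<le> B"
  shows "(\<Sum>J'\<in>{0..<int p ^ B'}. fsum k B c (A \<inter> cls (a + B') (\<xi> + int p ^ a * J'))) \<le> fsum k B c A"
proof -
  let ?m = "moment k (k * B) (k * (k + 1)) c"
  let ?Z = "\<lambda>J'. cls (a + B') (\<xi> + int p ^ a * J')"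
  have "(\<Sum>J'\<in>{0..<int p ^ B'}. ?m (A \<inter> ?Z J' \<inter> cls B J)) \<le> ?m (A \<inter> cls B J)" for J
  proof (cases "\<exists>J0\<in>{0..<int p ^ B'}. cls B J \<subseteq> ?Z J0")
    case True
    then obtain J0 where J0: "J0 \<in> {0..<int p ^ B'}" "cls B J \<subseteq> ?Z J0" by blast
    have "(\<Sum>J'\<in>{0..<int p ^ B'}. ?m (A \<inter> ?Z J' \<inter> cls B J)) = (\<Sum>J'\<in>{J0}. ?m (A \<inter> ?Z J' \<inter> cls B J))"
    proof (rule sum.mono_neutral_right)
      show "\<forall>i\<in>{0..<int p ^ B'} - {J0}. ?m (A \<inter> ?Z i \<inter> cls B J) = 0"
      proof
        fix i assume "i \<in> {0..<int p ^ B'} - {J0}"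
        then have "?Z i \<inter> ?Z J0 = {}" using J0 by (intro cls_sub_disjoint) auto
        then have "A \<inter> ?Z i \<inter> cls B J = {}" using J0 by blast
        then show "?m (A \<inter> ?Z i \<inter> cls B J) = 0" by (simp only: moment_empty assms)
      qed
    qed (use J0 in auto)
    also have "A \<inter> ?Z J0 \<inter> cls B J = A \<inter> cls B J" using J0 by blast
    then have "(\<Sum>J'\<in>{J0}. ?m (A \<inter> ?Z J' \<inter> cls B J)) = ?m (A \<inter> cls B J)" by simp
    finally show ?thesis by simp
  next
    case False
    have "?m (A \<inter> ?Z i \<inter> cls B J) = 0" if "i \<in> {0..<int p ^ B'}" for i
    proof -
      have "cls B J \<inter> ?Z i = {}" using False that cls_subset_or_disjoint[OF assms(2)] by blast
      then have "A \<inter> ?Z i \<inter> cls B J = {}" by blast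
      then show ?thesis by (simp only: moment_empty assms)
    qed
    then show ?thesis by (simp add: sum.neutral)
  qed
  then show ?thesis unfolding fsum_def by (subst sum.swap) (intro sum_mono)
qed

lemma moment_le_tot:
  "moment k (k * B) (k * (k + 1)) c (A \<inter> cls B \<zeta>) \<le> fsum k B c (A \<inter> cls B \<zeta>)"
proof -
  let ?J = "\<zeta> mod int p ^ B"
  have "cls B ?J = cls B \<zeta>" by (simp add: cls_def cong_def)
  then have "A \<inter> cls B \<zeta> = A \<inter> cls B \<zeta> \<inter> cls B ?J" by blast
  then have "moment k (k * B) (k * (k + 1)) c (A \<inter> cls B \<zeta>) =
      moment k (k * B) (k * (k + 1)) c (A \<inter> cls B \<zeta> \<inter> cls B ?J)" by metis
  also have "\<dots> \<le> fsum k B c (A \<inter> cls B \<zeta>)"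
    unfolding fsum_def
    by (rule member_le_sum[where f="\<lambda>J. moment k (k * B) (k * (k + 1)) c (A \<inter> cls B \<zeta> \<inter> cls B J)"]) auto
  finally show ?thesis .
qed

lemma fsum_zero_imp:
  assumes "finite A" "fsum k B c A = 0" "x \<in> freqs k (p ^ (k * B))"
  shows "expsum k (p ^ (k * B)) c A x = 0"
proof -
  have "expsum k (p ^ (k * B)) c (A \<inter> cls B J) x = 0" if "J \<in> {0..<int p ^ B}" for J
  proof -
    have "moment k (k * B) (k * (k + 1)) c (A \<inter> cls B J) = 0"
      using assms(2) that unfolding fsum_def by (subst (asm) sum_nonneg_eq_0_iff) auto
    then have "norm (expsum k (p ^ (k * B)) c (A \<inter> cls B J) x) ^ (k * (k + 1)) = 0"
      using assms(3) unfolding moment_def by (subst (asm) sum_nonneg_eq_0_iff) auto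
    then show ?thesis by simp
  qed
  then show ?thesis by (simp add: expsum_partition[OF assms(1), where B=B])
qed

text \<open>Frequency translations by p^((k - i) a) (T - \<xi>)^i, with trivial weight: on the class
  of \<xi> modulo \<open>p ^ a\<close> this polynomial equals \<open>p ^ (k * a)\<close> times the
  \<open>i\<close>-th power of the rescaled variable, so a degree \<open>k\<close> phase modulo
  \<open>p ^ (k * (B - a))\<close> remains.\<close>

lemma decouples_rescale:
  assumes "decouples k (B - a) K" "k \<ge> 1" "K \<ge> 0" "a \<le> B" "finite A" "A \<subseteq> cls a \<xi>"
  shows "moment k (k * B) (k * (k + 1)) c A \<le> K * scaled k B a c A"
proof -
  let ?m = "moment k (k * B) (k * (k + 1)) c" and ?X = "freqs k (p ^ (k * B))"

  define g where "g = (\<lambda>i. smult (int p ^ ((k - i) * a)) ([:-\<xi>, 1:] ^ i))"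
  have "?m A = (\<Sum>x\<in>?X. 1 * norm (expsum k (p ^ (k * B)) c A x) ^ (k * (k + 1)))"
    by (simp add: moment_def)
  also have "\<dots> \<le> K * p powr ((B - a) * gain k) * (\<Sum>J\<in>{0..<int p ^ (B - a)}. \<Sum>x\<in>?X.
       1 * norm (expsum k (p ^ (k * B)) c (A \<inter> cls (a + (B - a)) (\<xi> + int p ^ a * J)) x) ^ (k * (k + 1)))"
  proof (rule transfer[OF assms(1,5,6), where W = "\<lambda>_. 1" and \<kappa> = "\<lambda>_. 0" and g = g])
    fix i n assume i: "i \<le> k" and n: "n \<in> A"
    have "int p ^ a dvd n - \<xi>" using assms(6) n by (auto simp: cls_def cong_iff_dvd_diff)
    then have *: "n - \<xi> = int p ^ a * ((n - \<xi>) div int p ^ a)" by simp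
    have "poly (g i) n = int p ^ ((k - i) * a) * (n - \<xi>) ^ i" by (simp add: g_def)
    also have "\<dots> = int p ^ ((k - i) * a) * (int p ^ a * ((n - \<xi>) div int p ^ a)) ^ i" using * by simp
    also have "\<dots> = int p ^ ((k - i) * a + a * i) * ((n - \<xi>) div int p ^ a) ^ i"
      by (simp add: power_mult_distrib power_add power_mult)
    also have "(k - i) * a + a * i = k * B - k * (B - a)"
      using i assms(4) by (simp add: algebra_simps diff_mult_distrib2)
    finally show "[poly (g i) n = 0 + int p ^ (k * B - k * (B - a)) * ((n - \<xi>) div int p ^ a) ^ i] (mod int p ^ (k * B))"
      by simp
  next
    fix i assume "i \<le> k"
    have "degree (g i) \<le> degree ([:-\<xi>, 1:] ^ i)" by (simp add: g_def degree_smult_le)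
    also have "\<dots> = i" by (simp add: degree_power_eq)
    finally show "degree (g i) \<le> k" using \<open>i \<le> k\<close> by simp
  qed auto
  also have "(\<Sum>J\<in>{0..<int p ^ (B - a)}. \<Sum>x\<in>?X.
       1 * norm (expsum k (p ^ (k * B)) c (A \<inter> cls (a + (B - a)) (\<xi> + int p ^ a * J)) x) ^ (k * (k + 1))) =
      (\<Sum>J\<in>{0..<int p ^ (B - a)}. ?m (A \<inter> cls (a + (B - a)) (\<xi> + int p ^ a * J)))"
    by (simp add: moment_def)
  also have "\<dots> \<le> (\<Sum>J\<in>{0..<int p ^ (B - a)}. fsum k B c (A \<inter> cls (a + (B - a)) (\<xi> + int p ^ a * J)))"
    using assms(4) moment_le_tot by (intro sum_mono) simp
  also have "\<dots> \<le> fsum k B c A"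
    using assms by (intro fsum_subdivide) auto
  finally show ?thesis
    using assms by (simp add: scaled_def of_nat_diff mult_left_mono mult.assoc)
qed

section \<open>Bilinear moments of two classes that differ modulo \<open>p\<close>\<close>

definition share :: "nat \<Rightarrow> nat \<Rightarrow> real" where
  "share k l = real (l * (l + 1)) / real (k * (k + 1))"

text \<open>The exponent \<open>l * (l + 1)\<close> is the critical one in degree \<open>l\<close>,
  so the first class can be decoupled in that degree while the total exponent stays critical for
  degree \<open>k\<close>.\<close>

definition mixed :: "nat \<Rightarrow> nat \<Rightarrow> nat \<Rightarrow> (int \<Rightarrow> complex) \<Rightarrow> int set \<Rightarrow> int set \<Rightarrow> real" where
  "mixed k l B c A A' = (\<Sum>x\<in>freqs k (p ^ (k * B)). norm (expsum k (p ^ (k * B)) c A x) ^ (l * (l + 1)) *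
     norm (expsum k (p ^ (k * B)) c A' x) ^ (k * (k + 1) - l * (l + 1)))"

text \<open>The positivity assumptions exclude the junk value \<open>0 powr 0 = 0\<close> at \<open>l = 0\<close>.\<close>

definition bilin :: "nat \<Rightarrow> nat \<Rightarrow> nat \<Rightarrow> nat \<Rightarrow> nat \<Rightarrow> real \<Rightarrow> bool" where
  "bilin k l B a b K \<longleftrightarrow> (\<forall>c A A' \<xi> \<eta>. finite A \<longrightarrow> finite A' \<longrightarrow> A \<subseteq> cls a \<xi> \<longrightarrow> A' \<subseteq> cls b \<eta> \<longrightarrow>
     \<not> int p dvd \<xi> - \<eta> \<longrightarrow> fsum k B c A > 0 \<longrightarrow> fsum k B c A' > 0 \<longrightarrow>
     mixed k l B c A A' \<le>
     K * (scaled k B a c A powr share k l * scaled k B b c A' powr (1 - share k l)))"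

lemma scaled_pos: "fsum k B c A > 0 \<Longrightarrow> scaled k B a c A > 0"
  by (simp add: scaled_def)

text \<open>For \<open>l = 0\<close> only the second class is present, and rescaling it leaves just
  \<open>B - b\<close> scales to decouple. This is the source of every saving, recorded by the value
  1 of \<open>mu\<close> at \<open>l = 0\<close>.\<close>

lemma bilin_zero:
  assumes "decouples k (B - b) K" "k \<ge> 1" "K \<ge> 0" "b \<le> B"
  shows "bilin k 0 B a b K"
  unfolding bilin_def
proof (intro allI impI)
  fix c A A' \<xi> \<eta>
  assume *: "finite A" "finite A'" "A \<subseteq> cls a \<xi>" "A' \<subseteq> cls b \<eta>" "fsum k B c A > 0" "fsum k B c A' > 0"
  have "scaled k B a c A powr 0 = 1" using scaled_pos[OF *(5), of a] by simp
  moreover have "scaled k B b c A' powr 1 = scaled k B b c A'" by simp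
  ultimately show "mixed k 0 B c A A' \<le>
     K * (scaled k B a c A powr share k 0 * scaled k B b c A' powr (1 - share k 0))"
    using decouples_rescale[OF assms *(2,4), of c] by (simp add: moment_def mixed_def share_def)
qed

lemma prod_less: "l < k \<Longrightarrow> l * (l + 1) < k * (k + 1)" for l k :: nat
  by (intro mult_strict_mono) auto

text \<open>Hoelder separates the classes and each is rescaled on its own. This starts the iteration
  without a saving, in accordance with the value 0 of \<open>mu k 0\<close> at
  \<open>l > 0\<close>.\<close>

lemma bilin_base:
  assumes decouples: "decouples k (B - a) K" "decouples k (B - b) K" and K: "K > 0"
    and l: "1 \<le> l" "l < k" and ab: "a \<le> B" "b \<le> B"
  shows "bilin k l B a b K"
  unfolding bilin_def
proof (intro allI impI)
  fix c A A' \<xi> \<eta>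
  assume *: "finite A" "finite A'" "A \<subseteq> cls a \<xi>" "A' \<subseteq> cls b \<eta>" "fsum k B c A > 0" "fsum k B c A' > 0"
  define P r where "P = k * (k + 1)" and "r = l * (l + 1)"
  have rP: "0 < r" "r < P" using l prod_less by (auto simp: P_def r_def)
  define \<theta> where "\<theta> = real r / real P"
  have \<theta>: "0 < \<theta>" "\<theta> < 1" using rP by (auto simp: \<theta>_def)
  have \<theta>': "1 - \<theta> = real (P - r) / real P" using rP by (simp add: \<theta>_def field_simps of_nat_diff)
  define f g where "f = (\<lambda>x. norm (expsum k (p ^ (k * B)) c A x))"
    and "g = (\<lambda>x. norm (expsum k (p ^ (k * B)) c A' x))"
  have "(\<Sum>x\<in>freqs k (p ^ (k * B)). f x ^ r * g x ^ (P - r)) =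
      (\<Sum>x\<in>freqs k (p ^ (k * B)). (f x ^ P) powr \<theta> * (g x ^ P) powr (1 - \<theta>))"
    unfolding \<theta>' unfolding \<theta>_def
    by (intro sum.cong refl, subst (1 2) power_powr_quotient) (use rP in \<open>auto simp: f_def g_def\<close>)
  also have "\<dots> \<le> (\<Sum>x\<in>freqs k (p ^ (k * B)). f x ^ P) powr \<theta> * (\<Sum>x\<in>freqs k (p ^ (k * B)). g x ^ P) powr (1 - \<theta>)"
    by (rule Holder_sum) (use \<theta> in \<open>auto simp: f_def g_def\<close>)
  also have "\<dots> \<le> (K * scaled k B a c A) powr \<theta> * (K * scaled k B b c A') powr (1 - \<theta>)"
    using decouples_rescale[OF decouples(1) _ _ ab(1) *(1,3), of c] decouples_rescale[OF decouples(2) _ _ ab(2) *(2,4), of c] \<theta> K l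
    by (intro mult_mono powr_mono2) (auto simp: moment_def f_def g_def P_def intro!: sum_nonneg)
  also have "\<dots> = (K powr \<theta> * K powr (1 - \<theta>)) * (scaled k B a c A powr \<theta> * scaled k B b c A' powr (1 - \<theta>))"
    using K by (simp add: powr_mult mult_ac)
  also have "K powr \<theta> * K powr (1 - \<theta>) = K" using K by (simp flip: powr_add)
  finally show "mixed k l B c A A' \<le>
     K * (scaled k B a c A powr share k l * scaled k B b c A' powr (1 - share k l))"
    unfolding f_def g_def \<theta>_def P_def r_def mixed_def share_def .
qed

text \<open>The weight \<alpha> is determined by asking that the exponents of the swapped expression
  of index \<open>k - l\<close> and of the expression of index \<open>l - 1\<close> average to those
  of index \<open>l\<close>, on both classes at once.\<close>

lemma Holder_exponents:
  fixes k l :: nat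
  assumes l: "1 \<le> l" "l < k"
  defines "\<alpha> \<equiv> 1 / (real k - real l + 1)"
  shows "real (k * (k + 1) - (k - l) * (k - l + 1)) * \<alpha> + real ((l - 1) * (l - 1 + 1)) * (1 - \<alpha>) = real (l * (l + 1))"
    and "real ((k - l) * (k - l + 1)) * \<alpha> + real (k * (k + 1) - (l - 1) * (l - 1 + 1)) * (1 - \<alpha>) = real (k * (k + 1) - l * (l + 1))"
proof -
  \<comment> \<open>Parametrising by \<open>m\<close> and \<open>i\<close> removes the truncated
    subtractions.\<close>
  obtain m where k: "k = l + Suc m" using l by (metis less_imp_Suc_add add_Suc_right)
  obtain i where i: "l = Suc i" using l by (cases l) auto
  have 1: "k * (k + 1) - (k - l) * (k - l + 1) = l * (2 * m + l + 3)" by (simp add: k algebra_simps)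
  have 2: "k * (k + 1) - (l - 1) * (l - 1 + 1) = (m + 2) * (2 * i + m + 3)"
    unfolding k i by (simp add: algebra_simps)
  have 3: "k * (k + 1) - l * (l + 1) = (m + 1) * (2 * i + m + 4)" unfolding k i by (simp add: algebra_simps)
  have a: "\<alpha> = 1 / (real m + 2)" by (simp add: \<alpha>_def k)
  have *: "A * (1 / X) + C * (1 - 1 / X) = D" if "X \<noteq> 0" "A + C * (X - 1) = D * X" for A C D X :: real
    using that by (simp add: field_simps)
  show "real (k * (k + 1) - (k - l) * (k - l + 1)) * \<alpha> + real ((l - 1) * (l - 1 + 1)) * (1 - \<alpha>) = real (l * (l + 1))"
    unfolding 1 a by (rule *) (simp_all add: i algebra_simps)
  show "real ((k - l) * (k - l + 1)) * \<alpha> + real (k * (k + 1) - (l - 1) * (l - 1 + 1)) * (1 - \<alpha>) = real (k * (k + 1) - l * (l + 1))"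
    unfolding 2 3 a by (rule *) (simp_all add: i k algebra_simps)
qed

lemma powr_combine:
  fixes u v :: real
  assumes "u > 0" "v > 0" "x1 * \<alpha> + x2 * (1 - \<alpha>) = x" "y1 * \<alpha> + y2 * (1 - \<alpha>) = y"
  shows "(v powr y1 * u powr x1) powr \<alpha> * (u powr x2 * v powr y2) powr (1 - \<alpha>) = u powr x * v powr y"
  using assms(1,2)
  by (simp add: powr_mult powr_powr mult_ac flip: assms(3,4) powr_add)

text \<open>Exchange of roles: the integrand of index \<open>l\<close> is a weighted geometric mean
  of one of index \<open>k - l\<close> with the classes swapped and one of index
  \<open>l - 1\<close>. In the swapped one the class modulo \<open>p ^ a\<close> comes second, so
  its scale \<open>a\<close> can produce a saving.\<close>

lemma bilin_Holder:
  assumes l: "1 \<le> l" "l < k"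
    and bil1: "bilin k (k - l) B b a K1" and bil2: "bilin k (l - 1) B a b K2" and K: "K1 > 0" "K2 > 0"
  defines "\<alpha> \<equiv> 1 / (real k - real l + 1)"
  shows "bilin k l B a b (K1 powr \<alpha> * K2 powr (1 - \<alpha>))"
  unfolding bilin_def
proof (intro allI impI)
  fix c A A' \<xi> \<eta>
  assume *: "finite A" "finite A'" "A \<subseteq> cls a \<xi>" "A' \<subseteq> cls b \<eta>" "\<not> int p dvd \<xi> - \<eta>"
    and pos: "fsum k B c A > 0" "fsum k B c A' > 0"
  define P r r1 r2 where "P = k * (k + 1)" and "r = l * (l + 1)" and "r1 = (k - l) * (k - l + 1)"
    and "r2 = (l - 1) * (l - 1 + 1)"
  have rP: "0 < r" "r < P" "0 < r1" "r1 < P" "r2 < P"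
    using l prod_less[of l k] prod_less[of "k - l" k] prod_less[of "l - 1" k] by (auto simp: P_def r_def r1_def r2_def)
  have \<alpha>: "0 < \<alpha>" "\<alpha> < 1" using l by (auto simp: \<alpha>_def)
  define f g where "f = (\<lambda>x. norm (expsum k (p ^ (k * B)) c A x))"
    and "g = (\<lambda>x. norm (expsum k (p ^ (k * B)) c A' x))"
  define s t where "s = scaled k B a c A" and "t = scaled k B b c A'"
  have st: "s > 0" "t > 0" using pos by (auto simp: s_def t_def scaled_pos)
  note ex = Holder_exponents[OF l, folded \<alpha>_def P_def r_def r1_def r2_def]
  \<comment> \<open>A vanishing factor is treated apart because \<open>r2 = 0\<close> for
    \<open>l = 1\<close>; both sides are then 0, since \<open>r\<close>, \<open>P - r\<close>,
    \<open>r1\<close> and \<open>P - r1\<close> are positive.\<close>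
  have pw: "u ^ r * v ^ (P - r) = (v ^ r1 * u ^ (P - r1)) powr \<alpha> * (u ^ r2 * v ^ (P - r2)) powr (1 - \<alpha>)"
    if "u \<ge> 0" "v \<ge> 0" for u v :: real
  proof (cases "u = 0 \<or> v = 0")
    case True
    then show ?thesis using rP by (auto simp: zero_power)
  next
    case False
    then have "u > 0" "v > 0" using that by auto
    then show ?thesis
      using powr_combine[of u v "real (P - r1)" \<alpha> "real r2" "real r" "real r1" "real (P - r2)" "real (P - r)"] ex
      by (simp add: powr_realpow)
  qed
  have "(\<Sum>x\<in>freqs k (p ^ (k * B)). f x ^ r * g x ^ (P - r)) =
      (\<Sum>x\<in>freqs k (p ^ (k * B)). (g x ^ r1 * f x ^ (P - r1)) powr \<alpha> * (f x ^ r2 * g x ^ (P - r2)) powr (1 - \<alpha>))"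
    by (intro sum.cong refl pw) (auto simp: f_def g_def)
  also have "\<dots> \<le> (\<Sum>x\<in>freqs k (p ^ (k * B)). g x ^ r1 * f x ^ (P - r1)) powr \<alpha> *
     (\<Sum>x\<in>freqs k (p ^ (k * B)). f x ^ r2 * g x ^ (P - r2)) powr (1 - \<alpha>)"
    by (rule Holder_sum) (use \<alpha> in \<open>auto simp: f_def g_def\<close>)
  also have "\<dots> \<le> (K1 * (t powr (real r1 / real P) * s powr (1 - real r1 / real P))) powr \<alpha> *
     (K2 * (s powr (real r2 / real P) * t powr (1 - real r2 / real P))) powr (1 - \<alpha>)"
  proof (intro mult_mono powr_mono2)
    show "(\<Sum>x\<in>freqs k (p ^ (k * B)). g x ^ r1 * f x ^ (P - r1)) \<le>
        K1 * (t powr (real r1 / real P) * s powr (1 - real r1 / real P))"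
      using bil1 * pos unfolding bilin_def mixed_def share_def f_def g_def s_def t_def P_def r1_def
      by (metis (no_types, lifting) dvd_diff_commute)
    show "(\<Sum>x\<in>freqs k (p ^ (k * B)). f x ^ r2 * g x ^ (P - r2)) \<le>
        K2 * (s powr (real r2 / real P) * t powr (1 - real r2 / real P))"
      using bil2 * pos unfolding bilin_def mixed_def share_def f_def g_def s_def t_def P_def r2_def by blast
  qed (use \<alpha> in \<open>auto simp: f_def g_def intro!: sum_nonneg\<close>)
  also have "\<dots> = (K1 powr \<alpha> * K2 powr (1 - \<alpha>)) *
     ((t powr (real r1 / real P) * s powr (1 - real r1 / real P)) powr \<alpha> *
      (s powr (real r2 / real P) * t powr (1 - real r2 / real P)) powr (1 - \<alpha>))"
    using K st by (simp add: powr_mult mult_ac)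
  also have "(t powr (real r1 / real P) * s powr (1 - real r1 / real P)) powr \<alpha> *
      (s powr (real r2 / real P) * t powr (1 - real r2 / real P)) powr (1 - \<alpha>) =
      s powr (real r / real P) * t powr (1 - real r / real P)"
  proof (rule powr_combine[OF st])
    have P: "real P > 0" using rP by simp
    show "(1 - real r1 / real P) * \<alpha> + real r2 / real P * (1 - \<alpha>) = real r / real P"
    proof -
      have "(1 - real r1 / real P) * \<alpha> + real r2 / real P * (1 - \<alpha>) =
          (real (P - r1) * \<alpha> + real r2 * (1 - \<alpha>)) / real P"
        using P rP by (simp add: field_simps of_nat_diff)
      then show ?thesis using ex by simp
    qed
    show "real r1 / real P * \<alpha> + (1 - real r2 / real P) * (1 - \<alpha>) = 1 - real r / real P"
    proof -
      have "real r1 / real P * \<alpha> + (1 - real r2 / real P) * (1 - \<alpha>) =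
          (real r1 * \<alpha> + real (P - r2) * (1 - \<alpha>)) / real P"
        using P rP by (simp add: field_simps of_nat_diff)
      also have "\<dots> = real (P - r) / real P" using ex by simp
      finally show ?thesis using P rP by (simp add: field_simps of_nat_diff)
    qed
  qed
  finally show "mixed k l B c A A' \<le>
     K1 powr \<alpha> * K2 powr (1 - \<alpha>) * (scaled k B a c A powr share k l * scaled k B b c A' powr (1 - share k l))"
    unfolding f_def g_def P_def r_def s_def t_def mixed_def share_def .
qed

text \<open>Refines the first class from \<open>p ^ a\<close> to \<open>p ^ (a + B')\<close> by
  decoupling in degree \<open>l\<close>, with the sum over the second class as weight. The size
  conditions guarantee the translations: modulo \<open>p ^ (l * (a + B'))\<close>, by
  \<open>m1\<close> the power \<open>(n - \<xi>) ^ Suc l\<close> vanishes on the first class, and by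
  \<open>m2\<close> all powers of \<open>n - \<eta>\<close> above \<open>k - l\<close> vanish on the
  second.\<close>

lemma bilin_lower:
  assumes kl: "1 \<le> l" "l < k" "k < p" and decouples: "decouples l B' K'" and K: "K' \<ge> 0" "K \<ge> 0"
    and a: "a \<ge> 1" and bilin: "bilin k l B (a + B') b K"
    and m1: "l * (a + B') \<le> Suc l * a" and m2: "l * (a + B') \<le> (k - l + 1) * b"
    and B: "a + B' \<le> B" "b \<le> B"
  shows "bilin k l B a b (K' * K)"
  unfolding bilin_def
proof (intro allI impI)
  fix c A A' \<xi> \<eta>
  assume A: "finite A" "finite A'" "A \<subseteq> cls a \<xi>" "A' \<subseteq> cls b \<eta>" "\<not> int p dvd \<xi> - \<eta>"
    and pos: "fsum k B c A > 0" "fsum k B c A' > 0"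
  define P r where "P = k * (k + 1)" and "r = l * (l + 1)"
  have rP: "0 < r" "r < P" using kl prod_less[of l k] by (auto simp: P_def r_def)
  define \<theta> where "\<theta> = real r / real P"
  have \<theta>: "0 < \<theta>" "\<theta> < 1" using rP by (auto simp: \<theta>_def)
  define m where "m = l * (a + B')"
  define Q where "Q = k * B"
  let ?e = "\<lambda>i. int p ^ (Q - m + (l - i) * a)"
  let ?J = "{0..<int p ^ B'}"

  let ?X = "freqs k (p ^ Q)" and ?E = "expsum k (p ^ Q) c"

  have mQ: "m \<le> Q"
  proof -
    have "m \<le> (k - l + 1) * b" using m2 by (simp add: m_def)
    also have "\<dots> \<le> k * B" using kl B by (intro mult_mono) auto
    finally show ?thesis by (simp add: Q_def)
  qed
  have "\<forall>i\<in>{1..l}. \<exists>R c. degree R \<le> k \<and> (\<forall>j\<le>k - l. coeff R j = 0) \<and>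
     (\<forall>U. int p ^ m dvd U ^ Suc l \<longrightarrow> [poly R ((\<xi> - \<eta>) + U) = c + U ^ i] (mod int p ^ m))"
    using high_powers_span[of l k "\<xi> - \<eta>" _ m] kl A(5) by auto
  then obtain R d where R: "\<And>i. i \<in> {1..l} \<Longrightarrow> degree (R i) \<le> k"
     "\<And>i j. i \<in> {1..l} \<Longrightarrow> j \<le> k - l \<Longrightarrow> coeff (R i) j = 0"
     "\<And>i U. i \<in> {1..l} \<Longrightarrow> int p ^ m dvd U ^ Suc l \<Longrightarrow> [poly (R i) ((\<xi> - \<eta>) + U) = d i + U ^ i] (mod int p ^ m)"
    by metis
  \<comment> \<open>For \<open>i > 0\<close>, the inner polynomial is
    \<open>d i + (n - \<xi>) ^ i\<close> on the first class and 0 on the second, modulo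
    \<open>p ^ m\<close>. The prefactor raises the modulus to \<open>p ^ Q\<close> and gives every
    power of the rescaled variable the common factor \<open>p ^ (Q - l * B')\<close>. Index 0 only
    adds a constant phase.\<close>
  define g where "g = (\<lambda>i. if i = 0 then [:int p ^ (Q - l * B'):]
     else smult (?e i) (pcompose (R i) [:-\<eta>, 1:]))"
  define \<kappa> where "\<kappa> = (\<lambda>i. if i = 0 then 0 else ?e i * d i)"
  define W where "W = (\<lambda>x. norm (?E A' x) ^ (P - r))"
  have deg: "degree (g i) \<le> k" if "i \<le> l" for i
  proof (cases "i = 0")
    case False
    have "degree (g i) \<le> degree (pcompose (R i) [:-\<eta>, 1:])" using False by (simp add: g_def degree_smult_le)
    also have "\<dots> = degree (R i)" by (simp add: degree_pcompose)
    also have "\<dots> \<le> k" using R(1)[of i] False that by simp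
    finally show ?thesis .
  qed (simp add: g_def)
  define N where "N = (\<lambda>J. A \<inter> cls (a + B') (\<xi> + int p ^ a * J))"
  let ?s = "\<lambda>J. scaled k B (a + B') c (N J)"
  have main: "(\<Sum>x\<in>?X. W x * norm (?E A x) ^ (l * (l + 1))) \<le>
    K' * p powr (B' * gain l) * (\<Sum>J\<in>?J. \<Sum>x\<in>?X.
       W x * norm (?E (N J) x) ^ (l * (l + 1)))"
    unfolding N_def
  proof (rule transfer[OF decouples A(1,3), where g = g and \<kappa> = \<kappa>])
    show "l * B' \<le> Q" using mQ by (simp add: m_def algebra_simps)
  next
    fix i n assume i: "i \<le> l" and n: "n \<in> A"
    define z where "z = (n - \<xi>) div int p ^ a"
    have "int p ^ a dvd n - \<xi>" using A(3) n by (auto simp: cls_def cong_iff_dvd_diff)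
    then have z: "n - \<xi> = int p ^ a * z" by (simp add: z_def)
    show "[poly (g i) n = \<kappa> i + int p ^ (Q - l * B') * ((n - \<xi>) div int p ^ a) ^ i] (mod int p ^ Q)"
    proof (cases "i = 0")
      case False
      have "int p ^ m dvd int p ^ (a * Suc l)"
        using m1 by (intro le_imp_power_dvd) (simp add: m_def algebra_simps)
      also have "\<dots> dvd (n - \<xi>) ^ Suc l"
        unfolding z power_mult power_mult_distrib by simp
      finally have "[poly (R i) ((\<xi> - \<eta>) + (n - \<xi>)) = d i + (n - \<xi>) ^ i] (mod int p ^ m)"
        using R(3)[of i "n - \<xi>"] False i by simp
      moreover have "(\<xi> - \<eta>) + (n - \<xi>) = n - \<eta>" by simp
      moreover have "(n - \<xi>) ^ i = int p ^ (a * i) * z ^ i"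
        by (simp add: z power_mult power_mult_distrib)
      ultimately have "[poly (R i) (n - \<eta>) = d i + int p ^ (a * i) * z ^ i] (mod int p ^ m)"
        by simp
      then have "int p ^ m dvd poly (R i) (n - \<eta>) - (d i + int p ^ (a * i) * z ^ i)"
        by (simp add: cong_iff_dvd_diff)
      then have "?e i * int p ^ m dvd
          ?e i * (poly (R i) (n - \<eta>) - (d i + int p ^ (a * i) * z ^ i))"
        by (intro mult_dvd_mono dvd_refl)
      moreover have "int p ^ Q dvd ?e i * int p ^ m"
        unfolding power_add[symmetric] using mQ by (intro le_imp_power_dvd) simp
      ultimately have "int p ^ Q dvd ?e i * (poly (R i) (n - \<eta>) - (d i + int p ^ (a * i) * z ^ i))"
        by (rule dvd_trans[rotated])
      moreover have "poly (g i) n = ?e i * poly (R i) (n - \<eta>)"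
        using False by (simp add: g_def poly_pcompose)
      moreover have "int p ^ (Q - l * B') = ?e i * int p ^ (a * i)"
      proof -
        have "(l - i) * a = l * a - a * i" by (simp add: diff_mult_distrib2 mult.commute)
        moreover have "a * i \<le> l * a" using i by (simp add: mult.commute)
        ultimately have "Q - m + (l - i) * a + a * i = Q - m + l * a" by linarith
        also have "\<dots> = Q - l * B'" using mQ by (simp add: m_def algebra_simps)
        finally show ?thesis by (simp flip: power_add)
      qed
      ultimately show ?thesis
        using False by (simp add: cong_iff_dvd_diff \<kappa>_def algebra_simps flip: z_def)
    qed (simp add: g_def \<kappa>_def)
  next
    fix x y :: "nat \<Rightarrow> int" assume "\<And>j. j \<le> k \<Longrightarrow> [x j = y j] (mod int p ^ Q)"
    then have "?E A' x = ?E A' y" by (intro expsum_cong_freq) simp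
    then show "W x = W y" by (simp add: W_def)
  next
    fix w x
    have zero: "[poly (g i) n = 0] (mod int p ^ Q)" if i: "i \<in> {1..l}" and n: "n \<in> A'" for i n
    proof -
      have nb: "int p ^ b dvd n - \<eta>" using A(4) n by (auto simp: cls_def cong_iff_dvd_diff)
      have "int p ^ m dvd poly (R i) (n - \<eta>)"
        unfolding poly_altdef
      proof (rule dvd_sum)
        fix j
        show "int p ^ m dvd coeff (R i) j * (n - \<eta>) ^ j"
        proof (cases "j \<le> k - l")
          case False
          have "(k - l + 1) * b \<le> j * b" using False by (intro mult_right_mono) auto
          then have "int p ^ m dvd int p ^ (b * j)"
            using m2 by (intro le_imp_power_dvd) (simp add: m_def mult.commute)
          also have "\<dots> dvd (n - \<eta>) ^ j" unfolding power_mult by (rule dvd_power_same[OF nb])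
          finally show ?thesis by simp
        qed (use R(2) i in simp)
      qed
      then have "?e i * int p ^ m dvd poly (g i) n"
        using i by (simp add: g_def poly_pcompose)
      moreover have "int p ^ Q dvd ?e i * int p ^ m"
        unfolding power_add[symmetric] using mQ by (intro le_imp_power_dvd) simp
      ultimately show ?thesis unfolding cong_0_iff by (rule dvd_trans[rotated])
    qed
    have "norm (?E A' (\<lambda>j. x j + coeff (\<Sum>i\<le>l. smult (w i) (g i)) j)) = norm (?E A' x)"
    proof (rule norm_expsum_shift_const[where \<kappa> = "w 0 * int p ^ (Q - l * B')"])
      show "degree (\<Sum>i\<le>l. smult (w i) (g i)) \<le> k"
        by (rule degree_sum_le) (use deg order_trans[OF degree_smult_le] in auto)
    next
      fix n assume n: "n \<in> A'"
      have "poly (\<Sum>i\<le>l. smult (w i) (g i)) n = w 0 * poly (g 0) n + (\<Sum>i\<in>{1..l}. w i * poly (g i) n)"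
        by (simp add: poly_sum atMost_atLeast0 sum.atLeast_Suc_atMost)
      also have "[\<dots> = w 0 * poly (g 0) n + (\<Sum>i\<in>{1..l}. w i * 0)] (mod int p ^ Q)"
        by (intro cong_add cong_sum cong_mult cong_refl zero n)
      finally show "[poly (\<Sum>i\<le>l. smult (w i) (g i)) n = w 0 * int p ^ (Q - l * B')] (mod int (p ^ Q))"
        by (simp add: g_def)
    qed
    then show "W (\<lambda>j. x j + coeff (\<Sum>i\<le>l. smult (w i) (g i)) j) = W x" by (simp add: W_def)
  qed (auto simp: W_def deg)
  define t where "t = scaled k B b c A' powr (1 - \<theta>)"
  have t: "t \<ge> 0" by (simp add: t_def)
  have each: "(\<Sum>x\<in>?X. W x * norm (?E (N J) x) ^ (l * (l + 1))) \<le>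
      K * (?s J powr \<theta> * t)" for J
  \<comment> \<open>The bilinear hypothesis speaks of positive sums only; if the sum is 0, the
    exponential sum vanishes at all frequencies of the box.\<close>
  proof (cases "fsum k B c (N J) = 0")
    case True
    then have "?E (N J) x = 0" if "x \<in> ?X" for x
      using fsum_zero_imp[of "N J"] A(1) that by (simp add: N_def Q_def)
    then have "(\<Sum>x\<in>?X. W x * norm (?E (N J) x) ^ (l * (l + 1))) = 0"
      using kl by (intro sum.neutral) (simp add: zero_power)
    also have "\<dots> \<le> K * (?s J powr \<theta> * t)" using K t by simp
    finally show ?thesis .
  next
    case False
    \<comment> \<open>The refined centre is still congruent to \<xi> modulo \<open>p\<close>, as
      \<open>a \<ge> 1\<close>.\<close>
    have nd: "\<not> int p dvd (\<xi> + int p ^ a * J) - \<eta>"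
    proof
      assume h: "int p dvd (\<xi> + int p ^ a * J) - \<eta>"
      have "int p dvd int p ^ a * J" using a by (intro dvd_mult2 dvd_power) auto
      with h have "int p dvd ((\<xi> + int p ^ a * J) - \<eta>) - int p ^ a * J" by (rule dvd_diff)
      then show False using A(5) by simp
    qed
    have "mixed k l B c (N J) A' \<le> K * (?s J powr share k l * scaled k B b c A' powr (1 - share k l))"
    proof (rule bilin[unfolded bilin_def, rule_format, OF _ A(2) _ A(4) nd _ pos(2)])
      show "finite (N J)" using A(1) by (simp add: N_def)
      show "N J \<subseteq> cls (a + B') (\<xi> + int p ^ a * J)" by (simp add: N_def)
      show "0 < fsum k B c (N J)" using False fsum_nonneg[of k B c "N J"] by linarith
    qed
    then show ?thesis
      by (simp add: W_def t_def \<theta>_def P_def r_def Q_def mixed_def share_def mult.commute)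
  qed
  \<comment> \<open>Concavity collects the \<open>p ^ B'\<close> subclasses at the cost of their
    number to the power 1 - \<theta>; in return their finer normalisation supplies
    \<open>p powr (- real B' * gain k)\<close> to the power \<theta>.\<close>
  have conc: "(\<Sum>J\<in>?J. ?s J powr \<theta>) \<le>
      (real p ^ B') powr (1 - \<theta>) * (p powr (- real B' * gain k) * scaled k B a c A) powr \<theta>"
  proof -
    have "(\<Sum>J\<in>?J. ?s J powr \<theta>) \<le>
        real (card ?J) powr (1 - \<theta>) * (\<Sum>J\<in>?J. ?s J) powr \<theta>"
      by (rule sum_powr_concave) (use \<theta> in auto)
    also have "real (card ?J) = real p ^ B'"
      by (simp add: nat_power_eq)
    finally have 1: "(\<Sum>J\<in>?J. ?s J powr \<theta>) \<le>
        (real p ^ B') powr (1 - \<theta>) * (\<Sum>J\<in>?J. ?s J) powr \<theta>" .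
    have 2: "(\<Sum>J\<in>?J. ?s J) \<le> p powr (- real B' * gain k) * scaled k B a c A"
    proof -
      have "(\<Sum>J\<in>?J. ?s J) =
          p powr ((real B - real (a + B')) * gain k) * (\<Sum>J\<in>?J. fsum k B c (N J))"
        by (simp add: scaled_def sum_distrib_left)
      also have "\<dots> \<le> p powr ((real B - real (a + B')) * gain k) * fsum k B c A"
        unfolding N_def using kl B by (intro mult_left_mono fsum_subdivide) auto
      also have "p powr ((real B - real (a + B')) * gain k) = p powr (- real B' * gain k) * p powr ((real B - real a) * gain k)"
        by (simp add: algebra_simps flip: powr_add)
      finally show ?thesis by (simp add: scaled_def mult.assoc)
    qed
    show ?thesis
      by (rule order_trans[OF 1], intro mult_left_mono powr_mono2 2) (use \<theta> in \<open>auto intro: sum_nonneg\<close>)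
  qed
  have "(\<Sum>x\<in>?X. W x * norm (?E A x) ^ (l * (l + 1))) \<le>
     K' * p powr (B' * gain l) * (\<Sum>J\<in>?J. K * (?s J powr \<theta> * t))"
    by (rule order_trans[OF main], intro mult_left_mono sum_mono each) (use K in auto)
  also have "\<dots> = K' * p powr (B' * gain l) * (K * t * (\<Sum>J\<in>?J. ?s J powr \<theta>))"
    by (simp add: sum_distrib_left mult_ac)
  also have "\<dots> \<le> K' * p powr (B' * gain l) * (K * t *
      ((real p ^ B') powr (1 - \<theta>) * (p powr (- real B' * gain k) * scaled k B a c A) powr \<theta>))"
    using conc K t by (intro mult_left_mono) auto
  also have "\<dots> = K' * K * (scaled k B a c A powr \<theta> * t) *
     (p powr (B' * gain l) * (real p ^ B') powr (1 - \<theta>) * (p powr (- real B' * gain k)) powr \<theta>)"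
    by (simp add: powr_mult mult_ac)
  also have "p powr (B' * gain l) * (real p ^ B') powr (1 - \<theta>) * (p powr (- real B' * gain k)) powr \<theta> =
      p powr (B' * (gain l + 1 - \<theta> - gain k * \<theta>))"
  proof -
    have "(real p ^ B') powr (1 - \<theta>) = p powr (B' * (1 - \<theta>))"
      by (subst powr_realpow[symmetric]) (simp_all add: powr_powr)
    then show ?thesis by (simp add: powr_powr algebra_simps flip: powr_add)
  qed
  \<comment> \<open>The left side is \<open>r / 2 - \<theta> * P / 2\<close>: all powers of
    \<open>p\<close> cancel because \<theta> is the ratio of the two critical exponents.\<close>
  also have "gain l + 1 - \<theta> - gain k * \<theta> = 0"
  proof -
    have g: "gain k = real P / 2 - 1" "gain l = real r / 2 - 1" by (simp_all add: gain_def P_def r_def)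
    show ?thesis unfolding g \<theta>_def using rP by (simp add: field_simps)
  qed
  finally show "mixed k l B c A A' \<le>
     K' * K * (scaled k B a c A powr share k l * scaled k B b c A' powr (1 - share k l))"
    by (simp add: W_def t_def \<theta>_def P_def r_def Q_def mixed_def share_def mult.commute)
qed

section \<open>Initial decoupling bounds and the passage between linear and bilinear
  estimates\<close>

lemma decouples_0: "decouples k 0 1"
  by (simp add: decouples_def cls_def)

lemma decouples_trivial:
  assumes "k \<ge> 1" shows "decouples k B (p powr (real (k * (k + 1)) * B))"
  unfolding decouples_fsum
proof (intro allI impI)
  fix c and A :: "int set" assume A: "finite A"
  define P where "P = k * (k + 1)"
  have P: "P > 0" using assms by (simp add: P_def)
  have "moment k (k * B) P c A \<le> (\<Sum>x\<in>freqs k (p ^ (k * B)). real (card {0..<int p ^ B}) ^ P *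
     (\<Sum>J\<in>{0..<int p ^ B}. norm (expsum k (p ^ (k * B)) c (A \<inter> cls B J) x) ^ P))"
    unfolding moment_def expsum_partition[OF A, where B=B]
    by (intro sum_mono norm_sum_power_le) (use P in auto)
  also have "\<dots> = (real p ^ B) ^ P * fsum k B c A"
    unfolding sum_distrib_left[symmetric] moment_def fsum_def P_def[symmetric]
    by (subst sum.swap) (simp add: nat_power_eq)
  also have "(real p ^ B) ^ P = p powr (real P * B)"
    by (simp add: powr_realpow[symmetric] powr_powr mult.commute)
  also have "\<dots> * fsum k B c A \<le> p powr (real P * B) * p powr (B * gain k) * fsum k B c A"
    using ge_one_powr_ge_zero[of "real p" "B * gain k"] gain_nonneg[OF assms] by (intro mult_right_mono) auto
  finally show "moment k (k * B) (k * (k + 1)) c A \<le> p powr (real (k * (k + 1)) * B) * p powr (B * gain k) * fsum k B c A"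
    by (simp add: P_def)
qed

text \<open>Orthogonality: translating the degree 1 frequency by 1 multiplies the sum over the class
  of \<open>J\<close> by \<open>chi (p ^ B) J\<close>. The inner product of two distinct classes is
  therefore unchanged by multiplication with a number other than 1, so it is 0. Since
  \<open>gain 1 = 0\<close>, nothing is lost.\<close>

lemma decouples_1: "decouples 1 B 1"
  unfolding decouples_fsum
proof (intro allI impI)
  let ?X = "freqs 1 (p ^ B)"
  fix c and A :: "int set" assume A: "finite A"
  let ?R = "{0..<int p ^ B}"
  define F where "F = (\<lambda>J. expsum 1 (p ^ B) c (A \<inter> cls B J))"
  have orth: "(\<Sum>x\<in>?X. F J x * cnj (F J' x)) = 0" if J: "J \<in> ?R" "J' \<in> ?R" "J \<noteq> J'" for J J'
  proof -
    have sh: "F J (\<lambda>j. x j + coeff [:0, 1:] j) = chi (p ^ B) J * F J x" for J x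
    proof -
      have "F J (\<lambda>j. x j + coeff [:0, 1:] j) = expsum 1 (p ^ B) (\<lambda>n. c n * chi (p ^ B) (poly [:0, 1:] n)) (A \<inter> cls B J) x"
        unfolding F_def by (rule expsum_shift) simp
      also have "\<dots> = chi (p ^ B) J * F J x"
        unfolding F_def expsum_def sum_distrib_left
        by (intro sum.cong refl) (auto simp: cls_def chi_cong)
      finally show ?thesis .
    qed
    define T where "T = (\<Sum>x\<in>?X. F J x * cnj (F J' x))"
    have "T = (\<Sum>x\<in>?X. F J (\<lambda>j. x j + coeff [:0, 1:] j) * cnj (F J' (\<lambda>j. x j + coeff [:0, 1:] j)))"
      unfolding T_def
      by (rule sum_freqs_shift[where \<Phi>="\<lambda>x. F J x * cnj (F J' x)", symmetric])
         (auto simp: F_def intro!: arg_cong2[where f="(*)"] arg_cong[where f=cnj] expsum_cong_freq)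
    also have "\<dots> = chi (p ^ B) J * chi (p ^ B) (- J') * T"
      unfolding sh T_def sum_distrib_left by (simp add: chi_minus mult_ac)
    finally have "T = chi (p ^ B) (J - J') * T" by (simp flip: chi_add)
    moreover have "chi (p ^ B) (J - J') \<noteq> 1"
    proof (rule chi_neq_1)
      show "\<not> int (p ^ B) dvd J - J'"
        using J by (auto simp flip: cong_iff_dvd_diff dest: cong_less_imp_eq_int)
    qed simp
    ultimately have "T = 0" by (metis mult_cancel_right1)
    then show ?thesis by (simp add: T_def)
  qed
  have "of_real (moment 1 B 2 c A) = (\<Sum>x\<in>?X. (\<Sum>J\<in>?R. F J x) * cnj (\<Sum>J\<in>?R. F J x))"
    unfolding moment_def F_def expsum_partition[OF A, where B=B, symmetric]
    by (simp only: of_real_sum complex_norm_square)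
  also have "\<dots> = (\<Sum>x\<in>?X. \<Sum>J\<in>?R. \<Sum>J'\<in>?R. F J x * cnj (F J' x))"
    by (simp add: sum_product)
  also have "\<dots> = (\<Sum>J\<in>?R. \<Sum>J'\<in>?R. \<Sum>x\<in>?X. F J x * cnj (F J' x))"
    by (subst sum.swap, intro sum.cong refl, rule sum.swap)
  also have "\<dots> = (\<Sum>J\<in>?R. \<Sum>J'\<in>?R. if J' = J then (\<Sum>x\<in>?X. F J x * cnj (F J x)) else 0)"
    by (intro sum.cong refl) (auto simp: orth[unfolded One_nat_def])
  also have "\<dots> = of_real (fsum 1 B c A)"
    unfolding fsum_def moment_def F_def by (simp add: complex_norm_square[symmetric] power2_eq_square)
  finally have "moment 1 B 2 c A = fsum 1 B c A" by (simp only: of_real_eq_iff)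
  then show "moment 1 (1 * B) (1 * (1 + 1)) c A \<le> 1 * p powr (B * gain 1) * fsum 1 B c A"
    by (simp add: gain_def numeral_2_eq_2)
qed

lemma fsum_sub:
  assumes "k \<ge> 1" "b \<le> B" "J \<in> {0..<int p ^ b}"
  shows "fsum k B c (A \<inter> cls b J) \<le> fsum k B c A"
proof -
  have "fsum k B c (A \<inter> cls b J) \<le> (\<Sum>J\<in>{0..<int p ^ b}. fsum k B c (A \<inter> cls b J))"
    using assms by (intro member_le_sum[where f="\<lambda>J. fsum k B c (A \<inter> cls b J)"]) auto
  also have "\<dots> \<le> fsum k B c A" using fsum_subdivide[of k 0 b B c A 0] assms by simp
  finally show ?thesis .
qed

lemma fsum_empty: "k \<ge> 1 \<Longrightarrow> fsum k B c {} = 0"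
  unfolding fsum_def by (simp only: Int_empty_left moment_empty sum.neutral_const)

lemma bilin_mono: "bilin k l B a b K \<Longrightarrow> K \<le> K' \<Longrightarrow> bilin k l B a b K'"
  unfolding bilin_def
  by (smt (verit, ccfv_threshold) mult_nonneg_nonneg mult_right_mono powr_ge_zero)

text \<open>Frees the bilinear bound from its positivity conditions: if one of the sums over finest
  classes is 0, the exponential sum vanishes and the mixed moment with it. Transversality is asked
  of nonempty sets only, because splitting a set into classes produces empty ones.\<close>

lemma mixed_le:
  assumes bilin: "bilin k l B a b K" and K: "K \<ge> 0" and l: "1 \<le> l" "l < k"
    and A: "finite A" "finite A'" "A \<subseteq> cls a \<xi>" "A' \<subseteq> cls b \<eta>" "A \<noteq> {} \<Longrightarrow> A' \<noteq> {} \<Longrightarrow> \<not> int p dvd \<xi> - \<eta>"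
    and le: "scaled k B a c A \<le> s" "scaled k B b c A' \<le> t"
  shows "mixed k l B c A A' \<le>
     K * (s powr share k l * t powr (1 - share k l))"
proof (cases "fsum k B c A = 0 \<or> fsum k B c A' = 0")
  case True
  have "l * (l + 1) > 0" "k * (k + 1) - l * (l + 1) > 0" using l prod_less[of l k] by auto
  then have "mixed k l B c A A' = 0"
    unfolding mixed_def using True A(1,2) by (intro sum.neutral ballI) (auto simp: fsum_zero_imp zero_power simp del: power_eq_0_iff)
  then show ?thesis using K by simp
next
  case False
  then have pos: "fsum k B c A > 0" "fsum k B c A' > 0"
    using fsum_nonneg[of k B c A] fsum_nonneg[of k B c A'] by linarith+
  then have "\<not> int p dvd \<xi> - \<eta>" using A(5) fsum_empty[of k B c] l by force
  then have "mixed k l B c A A' \<le>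
     K * (scaled k B a c A powr share k l * scaled k B b c A' powr (1 - share k l))"
    using bilin A(1-4) pos unfolding bilin_def by blast
  also have "\<dots> \<le> K * (s powr share k l * t powr (1 - share k l))"
  proof -
    have "real (l * (l + 1)) \<le> real (k * (k + 1))"
      using prod_less[OF l(2)] by (subst of_nat_le_iff) simp
    then have "share k l \<le> 1"
      unfolding share_def by (rule divide_le_eq_1[THEN iffD2, OF disjI1, OF conjI, rotated]) (use l in \<open>simp only: of_nat_0_less_iff, simp\<close>)
    moreover have "share k l \<ge> 0" by (simp add: share_def)
    ultimately show ?thesis
      using K le by (intro mult_left_mono mult_mono powr_mono2) auto
  qed
  finally show ?thesis .
qed

text \<open>Broad-narrow splitting over the classes modulo \<open>p\<close>. The narrow part is
  rescaled and decoupled at scale \<open>B\<close>; going from \<open>B\<close> to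
  \<open>Suc B\<close> supplies the factor \<open>p powr gain k\<close> that absorbs
  \<open>2 ^ P\<close>. The broad part consists of transversal pairs and costs a fixed power of
  \<open>p\<close>.\<close>

lemma decouples_step:
  assumes decouples: "decouples k B K1" and bilin: "bilin k l (Suc B) 1 1 K2" and K: "K1 \<ge> 0" "K2 \<ge> 0"
    and l: "1 \<le> l" "l < k"
  shows "decouples k (Suc B) (K1 + real p ^ (2 * (k * (k + 1)) + 2) * K2)"
  unfolding decouples_fsum
proof (intro allI impI)
  fix c and A :: "int set" assume A: "finite A"
  define P r where "P = k * (k + 1)" and "r = l * (l + 1)"
  have rP: "0 < r" "r < P" using l prod_less[of l k] by (auto simp: P_def r_def)
  define I where "I = {0..<int p}"
  have cI: "card I = p" by (simp add: I_def)
  define F where "F = (\<lambda>J. expsum k (p ^ (k * Suc B)) c (A \<inter> cls 1 J))"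
  define M where "M = (\<lambda>J J'. \<Sum>x\<in>freqs k (p ^ (k * Suc B)). norm (F J x) ^ r * norm (F J' x) ^ (P - r))"
  let ?M = "\<Sum>J\<in>I. \<Sum>J'\<in>I - {J}. M J J'"
  let ?S = "\<Sum>J\<in>I. moment k (k * Suc B) P c (A \<inter> cls 1 J)"
  define t where "t = p powr (B * gain k) * fsum k (Suc B) c A"
  have t: "t \<ge> 0" by (simp add: t_def)
  have k: "k \<ge> 2" "k \<ge> 1" using l by auto
  have P6: "P \<ge> 6" using mult_mono[of 2 k 3 "k + 1"] k by (simp add: P_def)
  have "moment k (k * Suc B) P c A \<le> (\<Sum>x\<in>freqs k (p ^ (k * Suc B)). 2 ^ P * (\<Sum>J\<in>I. norm (F J x) ^ P) +
      real (card I) ^ (2 * P) * (\<Sum>J\<in>I. \<Sum>J'\<in>I - {J}. norm (F J x) ^ r * norm (F J' x) ^ (P - r)))"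
    unfolding moment_def F_def expsum_partition[OF A, where B=1] power_one_right I_def
    by (intro sum_mono broad_narrow) (use rP in auto)
  also have "\<dots> = 2 ^ P * ?S + real p ^ (2 * P) * ?M"
  proof -
    have "(\<Sum>x\<in>freqs k (p ^ (k * Suc B)). \<Sum>J\<in>I. norm (F J x) ^ P) = ?S"
      by (subst sum.swap) (simp add: moment_def F_def)
    moreover have "(\<Sum>x\<in>freqs k (p ^ (k * Suc B)). \<Sum>J\<in>I. \<Sum>J'\<in>I - {J}. norm (F J x) ^ r * norm (F J' x) ^ (P - r)) =
        ?M"
      unfolding M_def by (subst sum.swap, intro sum.cong refl, rule sum.swap)
    ultimately show ?thesis by (simp only: sum.distrib sum_distrib_left[symmetric] cI)
  qed
  also have "?S \<le> K1 * t"
  proof -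
    have "?S \<le> (\<Sum>J\<in>I. K1 * scaled k (Suc B) 1 c (A \<inter> cls 1 J))"
      unfolding P_def
      by (intro sum_mono decouples_rescale) (use decouples K k A in auto)
    also have "\<dots> = K1 * (p powr (B * gain k) * (\<Sum>J\<in>I. fsum k (Suc B) c (A \<inter> cls 1 J)))"
      by (simp add: scaled_def sum_distrib_left)
    also have "(\<Sum>J\<in>I. fsum k (Suc B) c (A \<inter> cls 1 J)) \<le> fsum k (Suc B) c A"
      using fsum_subdivide[of k 0 1 "Suc B" c A 0] k by (simp add: I_def)
    finally show ?thesis using K by (simp add: t_def mult_left_mono)
  qed
  also have "?M \<le> (\<Sum>J\<in>I. \<Sum>J'\<in>I - {J}. K2 * t)"
  proof (intro sum_mono)
    fix J J' assume J: "J \<in> I" "J' \<in> I - {J}"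
    have st: "scaled k (Suc B) 1 c (A \<inter> cls 1 J) \<le> t" if "J \<in> I" for J
      using fsum_sub[of k 1 "Suc B" J c A] that k by (simp add: scaled_def t_def I_def mult_left_mono)
    have nd: "\<not> int p dvd J - J'"
      using J unfolding I_def by (auto simp flip: cong_iff_dvd_diff dest: cong_less_imp_eq_int)
    have "M J J' \<le> K2 * (t powr share k l * t powr (1 - share k l))"
      unfolding M_def F_def P_def r_def mixed_def[symmetric]
      by (rule mixed_le[OF bilin K(2) l _ _ _ _ nd st st]) (use A J in auto)
    also have "\<dots> = K2 * t" using t by (cases "t = 0") (simp_all flip: powr_add)
    finally show "M J J' \<le> K2 * t" .
  qed
  also have "\<dots> \<le> real p * (real p * (K2 * t))"
  proof -
    have "(\<Sum>J'\<in>I - {J}. K2 * t) \<le> real p * (K2 * t)" for J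
      using card_mono[of I "I - {J}"] K t unfolding sum_constant
      by (intro mult_right_mono) (auto simp: cI I_def)
    then have "(\<Sum>J\<in>I. \<Sum>J'\<in>I - {J}. K2 * t) \<le> (\<Sum>J\<in>I. real p * (K2 * t))" by (rule sum_mono)
    then show ?thesis by (simp add: cI)
  qed
  finally have "moment k (k * Suc B) P c A \<le> 2 ^ P * (K1 * t) + real p ^ (2 * P) * (real p * (real p * (K2 * t)))"
    by (simp add: mult_left_mono)
  also have "2 ^ P * (K1 * t) \<le> p powr (gain k) * (K1 * t)"
  proof (rule mult_right_mono)
    \<comment> \<open>From \<open>P \<ge> 6\<close> one gets \<open>P \<le> 3 * gain k\<close>;
      hence the requirement that \<open>p\<close> be at least 8 = 2^3.\<close>
    have "(2::real) ^ P = 2 powr (real P)" by (simp add: powr_realpow)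
    also have "\<dots> \<le> 2 powr (3 * gain k)"
    proof (rule powr_mono)
      have "gain k = real P / 2 - 1" by (simp only: gain_def P_def)
      then show "real P \<le> 3 * gain k" using P6 by simp
    qed simp
    also have "\<dots> = (2 powr 3) powr (gain k)" by (simp only: powr_powr)
    also have "\<dots> \<le> p powr (gain k)" using p_ge gain_nonneg[OF k(2)] by (intro powr_mono2) auto
    finally show "(2::real) ^ P \<le> p powr (gain k)" .
  qed (use K t in simp)
  also have "real p ^ (2 * P) * (real p * (real p * (K2 * t))) \<le> p powr (gain k) * (real p ^ (2 * P + 2) * K2 * t)"
  proof -
    have "1 * (real p ^ (2 * P + 2) * K2 * t) \<le> p powr (gain k) * (real p ^ (2 * P + 2) * K2 * t)"
      using ge_one_powr_ge_zero[of "real p" "gain k"] gain_nonneg[OF k(2)] K t by (intro mult_right_mono) auto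
    then show ?thesis by (simp add: power_add power2_eq_square mult_ac)
  qed
  finally have "moment k (k * Suc B) P c A \<le> p powr (gain k) * (K1 * t) + p powr (gain k) * (real p ^ (2 * P + 2) * K2 * t)"
    by simp
  also have "\<dots> = (K1 + real p ^ (2 * P + 2) * K2) * (p powr (gain k) * p powr (B * gain k)) * fsum k (Suc B) c A"
    by (simp add: t_def algebra_simps)
  also have "p powr (gain k) * p powr (B * gain k) = p powr (Suc B * gain k)"
    by (simp add: algebra_simps flip: powr_add)
  finally show "moment k (k * Suc B) (k * (k + 1)) c A \<le> (K1 + real p ^ (2 * (k * (k + 1)) + 2) * K2) *
     p powr (Suc B * gain k) * fsum k (Suc B) c A" by (simp only: P_def)
qed

text \<open>Both sets are split crudely, which costs \<open>P + 2\<close> powers of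
  \<open>p ^ b\<close> with \<open>P = k * (k + 1)\<close>. The saving of the iteration is also
  proportional to \<open>b\<close>, with a factor that more rounds make large enough to win.\<close>

lemma bilin_unsplit:
  assumes bilin: "bilin k l B a b K" and K: "K \<ge> 0" and l: "1 \<le> l" "l < k"
    and ab: "1 \<le> a" "a \<le> b" "b \<le> B"
  shows "bilin k l B 1 1 (p powr real (b * (k * (k + 1) + 2)) * K)"
  unfolding bilin_def
proof (intro allI impI)
  fix c A A' \<xi> \<eta>
  assume A: "finite A" "finite A'" "A \<subseteq> cls 1 \<xi>" "A' \<subseteq> cls 1 \<eta>" "\<not> int p dvd \<xi> - \<eta>"
  define P r where "P = k * (k + 1)" and "r = l * (l + 1)"
  have rP: "0 < r" "r < P" using l prod_less[of l k] by (auto simp: P_def r_def)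
  define I I' where "I = {0..<int p ^ a}" and "I' = {0..<int p ^ b}"
  define X where "X = freqs k (p ^ (k * B))"
  define E where "E = (\<lambda>A x. norm (expsum k (p ^ (k * B)) c A x))"
  let ?T = "\<lambda>J J' x. E (A \<inter> cls a J) x ^ r * E (A' \<inter> cls b J') x ^ (P - r)"
  let ?c = "(real p ^ a) ^ r * (real p ^ b) ^ (P - r)"
  let ?U = "\<lambda>x. \<Sum>J\<in>I. E (A \<inter> cls a J) x ^ r"
  let ?V = "\<lambda>x. \<Sum>J\<in>I'. E (A' \<inter> cls b J) x ^ (P - r)"
  have k: "k \<ge> 1" using l by simp
  have cards: "real (card I) = real p ^ a" "real (card I') = real p ^ b"
    by (simp_all add: I_def I'_def nat_power_eq)
  define R where "R = scaled k B 1 c A powr share k l * scaled k B 1 c A' powr (1 - share k l)"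
  have R: "R \<ge> 0" by (simp add: R_def)
  have E1: "E A x ^ r \<le> (real p ^ a) ^ r * ?U x" for x
    unfolding E_def cards[symmetric] expsum_partition[OF A(1), where B=a] I_def
    by (rule norm_sum_power_le) (use rP in auto)
  have E2: "E A' x ^ (P - r) \<le> (real p ^ b) ^ (P - r) * ?V x" for x
    unfolding E_def cards[symmetric] expsum_partition[OF A(2), where B=b] I'_def
    by (rule norm_sum_power_le) (use rP in auto)
  have st: "scaled k B d c (A \<inter> cls d J) \<le> scaled k B 1 c A" if "1 \<le> d" "d \<le> B" "J \<in> {0..<int p ^ d}" for d J A
    unfolding scaled_def
  proof (rule mult_mono)
    show "fsum k B c (A \<inter> cls d J) \<le> fsum k B c A" using fsum_sub[OF k that(2,3)] .
    show "p powr ((real B - real d) * gain k) \<le> p powr ((real B - real 1) * gain k)"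
      using that gain_nonneg[OF k] by (intro powr_mono mult_right_mono) auto
  qed auto
  have "(\<Sum>x\<in>X. E A x ^ r * E A' x ^ (P - r)) \<le> (\<Sum>x\<in>X. ((real p ^ a) ^ r * ?U x) *
      ((real p ^ b) ^ (P - r) * ?V x))"
    by (intro sum_mono mult_mono E1 E2) (auto simp: E_def intro!: mult_nonneg_nonneg sum_nonneg)
  also have "\<dots> = (\<Sum>x\<in>X. \<Sum>J\<in>I. \<Sum>J'\<in>I'. ?c *
      (?T J J' x))"
  proof (intro sum.cong refl)
    fix x
    have "((real p ^ a) ^ r * ?U x) * ((real p ^ b) ^ (P - r) * ?V x) =
       ?c * (?U x * ?V x)"
      by (simp only: mult_ac)
    also have "\<dots> = (\<Sum>J\<in>I. \<Sum>J'\<in>I'. ?c *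
      (?T J J' x))"
      unfolding sum_product by (simp only: sum_distrib_left)
    finally show "((real p ^ a) ^ r * ?U x) * ((real p ^ b) ^ (P - r) * ?V x) =
       (\<Sum>J\<in>I. \<Sum>J'\<in>I'. ?c *
      (?T J J' x))" .
  qed
  also have "\<dots> = (\<Sum>J\<in>I. \<Sum>J'\<in>I'. \<Sum>x\<in>X. ?c *
      (?T J J' x))"
    by (subst sum.swap, intro sum.cong refl, rule sum.swap)
  also have "\<dots> = ?c *
     (\<Sum>J\<in>I. \<Sum>J'\<in>I'. \<Sum>x\<in>X. ?T J J' x)"
    by (simp only: sum_distrib_left)
  also have "\<dots> \<le> ?c * (\<Sum>J\<in>I. \<Sum>J'\<in>I'. K * R)"
  proof (intro mult_left_mono sum_mono)
    fix J J' assume J: "J \<in> I" "J' \<in> I'"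
    show "(\<Sum>x\<in>X. ?T J J' x) \<le> K * R"
      unfolding X_def E_def P_def r_def R_def mixed_def[symmetric]
    proof (rule mixed_le[OF bilin K l, where \<xi> = J and \<eta> = J'])
      assume "A \<inter> cls a J \<noteq> {}" "A' \<inter> cls b J' \<noteq> {}"
      then obtain n n' where n: "n \<in> A" "n \<in> cls a J" "n' \<in> A'" "n' \<in> cls b J'" by blast
      have "int p ^ 1 dvd int p ^ a" "int p ^ 1 dvd int p ^ b" using ab by (auto intro!: le_imp_power_dvd simp del: power_one_right)
      then have "[J = n] (mod int p)" "[n' = J'] (mod int p)"
        using n by (auto simp: cls_def intro: cong_sym cong_dvd_modulus)
      moreover have "[n = \<xi>] (mod int p)" "[\<eta> = n'] (mod int p)"
        using n A(3,4) by (auto simp: cls_def cong_sym)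
      ultimately have "[J - J' = \<xi> - \<eta>] (mod int p)"
        by (meson cong_diff cong_sym cong_trans)
      then show "\<not> int p dvd J - J'" using A(5) by (simp add: cong_dvd_iff)
    qed (use A ab J st[of a J A] st[of b J' A'] in \<open>auto simp: I_def I'_def\<close>)
  qed auto
  also have "\<dots> = ((real p ^ a) ^ r * (real p ^ b) ^ (P - r) * (real p ^ a * real p ^ b)) * (K * R)"
    by (simp add: cards)
  also have "\<dots> \<le> p powr real (b * (P + 2)) * (K * R)"
  proof (rule mult_right_mono)
    have "(real p ^ a) ^ r * (real p ^ b) ^ (P - r) * (real p ^ a * real p ^ b) \<le>
        (real p ^ b) ^ r * (real p ^ b) ^ (P - r) * (real p ^ b * real p ^ b)"
      using ab by (intro mult_mono power_mono power_increasing) auto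
    also have "\<dots> = (real p ^ b) ^ (P + 2)"
      using rP by (simp add: power2_eq_square power_add flip: power_add)
    also have "\<dots> = p powr real (b * (P + 2))"
      by (simp only: powr_realpow p_pos' power_mult)
    finally show "(real p ^ a) ^ r * (real p ^ b) ^ (P - r) * (real p ^ a * real p ^ b) \<le> p powr real (b * (P + 2))" .
  qed (use K R in simp)
  finally show "mixed k l B c A A' \<le>
     p powr real (b * (k * (k + 1) + 2)) * K * (scaled k B 1 c A powr share k l * scaled k B 1 c A' powr (1 - share k l))"
    unfolding X_def E_def P_def r_def R_def mixed_def by (simp add: mult.assoc)
qed

text \<open>A single refinement by \<open>B'\<close> needs \<open>l * B' \<le> a\<close>. Steps of
  fixed length \<open>s\<close> with \<open>l * s \<le> a\<close> remain admissible as
  \<open>a\<close> grows, and the condition on the second class is inherited from the end point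
  \<open>a'\<close>. The losses multiply to \<open>C ^ j\<close> and one power of
  \<open>p\<close>.\<close>

lemma bilin_lower_iterate:
  assumes kl: "1 \<le> l" "l < k" "k < p" and low: "\<And>B. decouples l B (C * p powr (\<epsilon> * B))" and C: "C \<ge> 1"
    and K: "K \<ge> 0" and bilin: "bilin k l B a' b K" and s: "b \<le> B" "a' \<le> B" "l * a' \<le> (k - l + 1) * b"
  shows "a \<le> a' \<Longrightarrow> a' \<le> a + j * s \<Longrightarrow> l * s \<le> a \<Longrightarrow> 1 \<le> a \<Longrightarrow>
     bilin k l B a b (C ^ j * p powr (\<epsilon> * (real a' - real a)) * K)"
proof (induction j arbitrary: a)
  case 0
  then have "a = a'" by simp
  then show ?case using bilin by simp
next
  case (Suc j)
  define a2 where "a2 = min a' (a + s)"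
  have a2: "a \<le> a2" "a2 \<le> a'" "a2 \<le> a + s" using Suc.prems by (auto simp: a2_def)
  have "bilin k l B a2 b (C ^ j * p powr (\<epsilon> * (real a' - real a2)) * K)"
    using Suc.prems a2 by (intro Suc.IH) (auto simp: a2_def)
  then have "bilin k l B a b (C * p powr (\<epsilon> * (a2 - a)) * (C ^ j * p powr (\<epsilon> * (real a' - real a2)) * K))"
  proof (intro bilin_lower[OF kl low, where a = a])
    show "l * (a + (a2 - a)) \<le> Suc l * a"
      using mult_le_mono2[OF a2(3), of l] Suc.prems(3) a2(1) by (simp add: algebra_simps)
    show "l * (a + (a2 - a)) \<le> (k - l + 1) * b"
      using order_trans[OF mult_le_mono2[OF a2(2), of l] s(3)] a2(1) by simp
  qed (use a2 Suc.prems C K s in auto)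
  moreover have "C * p powr (\<epsilon> * (a2 - a)) * (C ^ j * p powr (\<epsilon> * (real a' - real a2)) * K) =
      C ^ Suc j * (p powr (\<epsilon> * (a2 - a)) * p powr (\<epsilon> * (real a' - real a2))) * K"
    by (simp add: mult_ac)
  moreover have "p powr (\<epsilon> * (a2 - a)) * p powr (\<epsilon> * (real a' - real a2)) = p powr (\<epsilon> * (real a' - real a))"
    using a2 by (simp add: of_nat_diff algebra_simps flip: powr_add)
  ultimately show ?case by simp
qed

text \<open>One round refines the first class up to \<open>a'\<close> with l a' = (k - l + 1) b, the
  largest scale that refinement allows, and exchanges roles there. The swapped expression has second
  scale \<open>a'\<close>, with \<alpha> a' = b / l; the other one keeps \<open>b\<close>, with
  weight 1 - \<alpha> = (k - l) / (k - l + 1). These are the weights in \<open>mu\<close>.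
  Divisibility of \<open>b\<close> keeps the scales integral, and
  \<open>k ^ (n + 1) * b \<le> B\<close> keeps them below \<open>B\<close>, as a round enlarges them
  at most by the factor \<open>k\<close>.\<close>

lemma bilin_iterate:
  assumes k: "k \<ge> 2" "k < p" and lam: "\<nu> \<ge> 0" "\<And>B. decouples k B (C0 * p powr (\<nu> * B))" "C0 \<ge> 1"
    and low: "\<And>l B. l \<in> {1..<k} \<Longrightarrow> decouples l B (C * p powr (\<epsilon> * B))" "C \<ge> 1" and eps: "\<epsilon> > 0"
  shows "\<exists>Cn\<ge>C0. \<forall>B b a l. 1 \<le> l \<longrightarrow> l < k \<longrightarrow> b > 0 \<longrightarrow> ((fact k)\<^sup>2) ^ n dvd b \<longrightarrow> k ^ (n + 1) * b \<le> B \<longrightarrow>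
    b \<le> k * a \<longrightarrow> l * a \<le> (k - l + 1) * b \<longrightarrow>
    bilin k l B a b (Cn * p powr ((\<nu> + n * \<epsilon>) * B - \<nu> * mu k n l * b))"
proof (induction n)
  case 0
  show ?case
  proof (intro exI[of _ C0] conjI allI impI)
    fix B b a l :: nat
    assume h: "1 \<le> l" "l < k" "b > 0" "k ^ (0 + 1) * b \<le> B" "b \<le> k * a" "l * a \<le> (k - l + 1) * b"
    have "a \<le> l * a" using h by simp
    also have "\<dots> \<le> (k - l + 1) * b" by (rule h)
    also have "\<dots> \<le> k * b" using h by (intro mult_right_mono) auto
    finally have aB: "a \<le> B" using h by simp
    have "b \<le> k * b" using k by simp
    also have "k * b \<le> B" using h by simp
    finally have bB: "b \<le> B" .
    have "decouples k (B - d) (C0 * p powr (\<nu> * B))" for d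
      by (rule decouples_mono[OF lam(2)]) (use lam in \<open>auto intro!: mult_left_mono powr_mono\<close>)
    then have "bilin k l B a b (C0 * p powr (\<nu> * B))"
      using h aB bB lam by (intro bilin_base) auto
    then show "bilin k l B a b (C0 * p powr ((\<nu> + real 0 * \<epsilon>) * B - \<nu> * mu k 0 l * b))"
      using h by simp
  qed simp
next
  case (Suc n)
  then obtain Cn where Cn: "Cn \<ge> C0" and IH: "\<And>B b a l. 1 \<le> l \<Longrightarrow> l < k \<Longrightarrow> b > 0 \<Longrightarrow> ((fact k)\<^sup>2) ^ n dvd b \<Longrightarrow>
     k ^ (n + 1) * b \<le> B \<Longrightarrow> b \<le> k * a \<Longrightarrow> l * a \<le> (k - l + 1) * b \<Longrightarrow>
     bilin k l B a b (Cn * p powr ((\<nu> + n * \<epsilon>) * B - \<nu> * mu k n l * b))" by blast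
  have Cn1: "Cn \<ge> 1" using Cn lam by simp
  show ?case
  proof (intro exI[of _ "C ^ (k ^ 3) * Cn"] conjI allI impI)
    have "1 * Cn \<le> C ^ (k ^ 3) * Cn" using low(2) Cn1 by (intro mult_right_mono one_le_power) auto
    then show "C0 \<le> C ^ (k ^ 3) * Cn" using Cn by simp
  next
    fix B b a l :: nat
    assume l: "1 \<le> l" "l < k" and b: "b > 0" "((fact k)\<^sup>2) ^ Suc n dvd b" "k ^ (Suc n + 1) * b \<le> B"
      and a: "b \<le> k * a" "l * a \<le> (k - l + 1) * b"
    define F where "F = (fact k :: nat)"
    have lF: "l dvd F" "k dvd F" using l by (auto simp: F_def intro: dvd_fact)
    obtain u where u: "b = F\<^sup>2 ^ Suc n * u" using b(2) by (auto simp: F_def)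
    obtain v w where v: "F = l * v" and w: "F = k * w" using lF by blast
    \<comment> \<open>Of the two factors \<open>fact k\<close> available per round, one is divided
      by \<open>l\<close> to give \<open>b1\<close>; dividing the other by \<open>k\<close> yields
      the step length \<open>s\<close>. The remaining power of \<open>F\<close> still divides
      \<open>a'\<close>, as the next use of the hypothesis demands.\<close>
    define b1 where "b1 = v * F * F\<^sup>2 ^ n * u"
    have b1: "b = l * b1" by (simp add: b1_def u v power2_eq_square mult_ac)
    have "b = (k * l) * (v * w * F\<^sup>2 ^ n * u)"
      unfolding u power_Suc power2_eq_square by (subst v, subst w) (simp add: mult_ac)
    then obtain s where s: "b = k * l * s" by blast
    define a' where "a' = (k - l + 1) * b1"
    have b1pos: "b1 > 0" using b(1) b1 by (cases "b1 = 0") auto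
    have a'eq: "l * a' = (k - l + 1) * b"
      unfolding a'_def by (subst b1) (rule mult.left_commute)
    have Fa': "F\<^sup>2 ^ n dvd a'" by (simp add: a'_def b1_def)
    have Fb: "F\<^sup>2 ^ n dvd b" unfolding u by simp
    have a'le: "a' \<le> k * b"
    proof -
      have "a' \<le> l * a'" using l by simp
      also have "\<dots> \<le> k * b" unfolding a'eq using l by (intro mult_right_mono) auto
      finally show ?thesis .
    qed
    have ba': "b \<le> k * a'"
    proof -
      have "b \<le> (k - l + 1) * b" by simp
      also have "\<dots> \<le> k * a'" unfolding a'eq[symmetric] using l by simp
      finally show ?thesis .
    qed
    have kn: "k ^ (n + 1) * d \<le> B" if "d \<le> k * b" for d
    proof -
      have "k ^ (n + 1) * d \<le> k ^ (n + 1) * (k * b)" using that by (rule mult_le_mono2)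
      also have "\<dots> = k ^ (Suc n + 1) * b" by simp
      finally show ?thesis using b(3) by linarith
    qed
    have small: "d \<le> B" if "d \<le> k * b" for d
    proof -
      have "1 * d \<le> k ^ (n + 1) * d" using k by (intro mult_right_mono one_le_power) auto
      then show ?thesis using kn[OF that] by linarith
    qed
    have bkb: "b \<le> k * b" using k by simp
    have bB: "b \<le> B" and a'B: "a' \<le> B" using small[OF bkb] small[OF a'le] by auto
    define \<alpha> where "\<alpha> = 1 / (real k - real l + 1)"
    define E where "E = (\<lambda>l b. (\<nu> + real n * \<epsilon>) * real B - \<nu> * mu k n l * real b)"
    let ?R = "Cn * p powr ((\<nu> + n * \<epsilon>) * B - \<nu> * mu k (Suc n) l * b)"
    have k1: "bilin k (k - l) B b a' (Cn * p powr E (k - l) a')"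
      unfolding E_def
    proof (rule IH)
      show "(k - l) * b \<le> (k - (k - l) + 1) * a'"
      proof -
        have "(k - l) * b \<le> l * a'" unfolding a'eq by (intro mult_right_mono) auto
        also have "\<dots> \<le> (k - (k - l) + 1) * a'" using l by (intro mult_right_mono) auto
        finally show ?thesis .
      qed
      show "((fact k)\<^sup>2) ^ n dvd a'" using Fa' by (simp add: F_def)
      show "a' > 0" using b1pos by (simp add: a'_def)
    qed (use l a'le kn[OF a'le] in auto)
    have k2: "bilin k (l - 1) B a' b (Cn * p powr E (l - 1) b)"
    \<comment> \<open>The lower neighbour of \<open>l = 1\<close> is the boundary case, outside the
      induction hypothesis; its saving is \<nu> b.\<close>
    proof (cases "l = 1")
      case True
      have "bilin k 0 B a' b (C0 * p powr (\<nu> * real (B - b)))"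
        using lam k bB by (intro bilin_zero[OF lam(2)]) auto
      moreover have "C0 * p powr (\<nu> * real (B - b)) \<le> Cn * p powr E 0 b"
        using Cn lam bB eps by (intro mult_mono powr_mono) (auto simp: E_def of_nat_diff algebra_simps)
      ultimately show ?thesis using True by (auto intro: bilin_mono)
    next
      case False
      show ?thesis unfolding E_def
      proof (rule IH)
        have "(l - 1) * a' \<le> l * a'" by (intro mult_right_mono) auto
        also have "\<dots> = (k - l + 1) * b" by (rule a'eq)
        also have "\<dots> \<le> (k - (l - 1) + 1) * b" using l by (intro mult_right_mono) auto
        finally show "(l - 1) * a' \<le> (k - (l - 1) + 1) * b" .
        show "((fact k)\<^sup>2) ^ n dvd b" using Fb by (simp add: F_def)
      qed (use False l b ba' kn[OF bkb] in auto)
    qed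
    have "bilin k l B a' b ((Cn * p powr E (k - l) a') powr \<alpha> * (Cn * p powr E (l - 1) b) powr (1 - \<alpha>))"
      unfolding \<alpha>_def by (rule bilin_Holder[OF l k1 k2]) (use Cn1 in auto)
    also have "(Cn * p powr E (k - l) a') powr \<alpha> * (Cn * p powr E (l - 1) b) powr (1 - \<alpha>) =
        (Cn powr \<alpha> * Cn powr (1 - \<alpha>)) * (p powr (E (k - l) a' * \<alpha>) * p powr (E (l - 1) b * (1 - \<alpha>)))"
      using Cn1 by (simp add: powr_mult powr_powr mult_ac)
    also have "Cn powr \<alpha> * Cn powr (1 - \<alpha>) = Cn" using Cn1 by (simp flip: powr_add)
    also have "p powr (E (k - l) a' * \<alpha>) * p powr (E (l - 1) b * (1 - \<alpha>)) =
        p powr ((\<nu> + n * \<epsilon>) * B - \<nu> * mu k (Suc n) l * b)"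
    proof -
      have X: "real k - real l + 1 \<noteq> 0" using l by simp
      have a1: "real a' * \<alpha> = real b / real l"
      proof -
        have "real l * real a' = (real k - real l + 1) * real b"
        proof -
          have "real l * real a' = real b + (real k - real l) * real b"
            using arg_cong[OF a'eq, of real] l by (simp add: of_nat_diff)
          then show ?thesis by (simp add: algebra_simps)
        qed
        then show ?thesis using X l by (simp add: \<alpha>_def field_simps)
      qed
      have a2: "1 - \<alpha> = (real k - real l) / (real k - real l + 1)" using X by (simp add: \<alpha>_def field_simps)
      have "E (k - l) a' * \<alpha> + E (l - 1) b * (1 - \<alpha>) =
         (\<nu> + n * \<epsilon>) * B - \<nu> * (mu k n (k - l) * (real a' * \<alpha>) + mu k n (l - 1) * real b * (1 - \<alpha>))"
        by (simp add: E_def algebra_simps)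
      also have "\<dots> = (\<nu> + n * \<epsilon>) * B - \<nu> * mu k (Suc n) l * b"
        unfolding a1 a2 using l by (simp add: algebra_simps)
      finally show ?thesis by (simp flip: powr_add)
    qed
    finally have bil': "bilin k l B a' b ?R" .
    have aa': "a \<le> a'"
      using a(2) l unfolding a'eq[symmetric] by simp
    have ls: "l * s \<le> a" using a(1) k unfolding s by simp
    have apos: "a \<ge> 1" using a(1) b(1) by (cases a) auto
    \<comment> \<open>The gap is at most \<open>k * b\<close>, which is \<open>k\<^sup>2 * l\<close>
      steps of length \<open>s\<close>: a number independent of the scale, so \<open>C\<close>
      enters with a bounded power.\<close>
    have cover: "a' \<le> a + (k\<^sup>2 * l) * s"
      using a'le unfolding s by (simp add: power2_eq_square mult_ac)
    have bilin_final: "bilin k l B a b (C ^ (k\<^sup>2 * l) * p powr (\<epsilon> * (real a' - real a)) * ?R)"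
      by (rule bilin_lower_iterate[OF l k(2) low(1) low(2) _ bil' bB a'B _ aa' cover ls apos])
         (use l Cn1 a'eq in auto)
    have le_final: "C ^ (k\<^sup>2 * l) * p powr (\<epsilon> * (real a' - real a)) * ?R \<le>
        C ^ (k ^ 3) * p powr (\<epsilon> * B) * ?R"
    proof -
      have "k\<^sup>2 * l \<le> k ^ 3" using l by (simp add: power2_eq_square power3_eq_cube)
      then have e1: "C ^ (k\<^sup>2 * l) \<le> C ^ (k ^ 3)" using low(2) by (rule power_increasing)
      have "\<epsilon> * (real a' - real a) \<le> \<epsilon> * B" using eps a'B by (intro mult_left_mono) auto
      then have e2: "p powr (\<epsilon> * (real a' - real a)) \<le> p powr (\<epsilon> * B)" by (rule powr_mono) simp
      show ?thesis
        by (rule mult_right_mono[OF mult_mono[OF e1 e2]]) (use low(2) Cn1 in auto)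
    qed
    have eq_final: "C ^ (k ^ 3) * p powr (\<epsilon> * B) * ?R =
        C ^ (k ^ 3) * Cn * p powr ((\<nu> + real (Suc n) * \<epsilon>) * B - \<nu> * mu k (Suc n) l * b)"
      by (simp add: algebra_simps flip: powr_add)
    show "bilin k l B a b (C ^ (k ^ 3) * Cn * p powr ((\<nu> + real (Suc n) * \<epsilon>) * B - \<nu> * mu k (Suc n) l * b))"
      using bilin_mono[OF bilin_final le_final] unfolding eq_final .
  qed
qed

section \<open>Bootstrapping the decoupling exponent\<close>

definition growth :: "nat \<Rightarrow> real \<Rightarrow> bool" where
  "growth k \<nu> \<longleftrightarrow> (\<exists>C\<ge>1. \<forall>B. decouples k B (C * p powr (\<nu> * B)))"

lemma growth_mono:
  assumes "growth k \<nu>" "\<nu> \<le> \<nu>'" shows "growth k \<nu>'"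
proof -
  obtain C where C: "C \<ge> 1" "\<And>B. decouples k B (C * p powr (\<nu> * B))" using assms by (auto simp: growth_def)
  have "decouples k B (C * p powr (\<nu>' * B))" for B
    by (rule decouples_mono[OF C(2)]) (use C assms in \<open>auto intro!: mult_left_mono powr_mono mult_right_mono\<close>)
  then show ?thesis using C(1) by (auto simp: growth_def)
qed

lemma growth_trivial: "k \<ge> 1 \<Longrightarrow> growth k (real (k * (k + 1)))"
  unfolding growth_def using decouples_trivial[of k] by (intro exI[of _ 1]) simp

text \<open>A bilinear bound that is better than \<open>p powr (\<nu>' * B)\<close> improves the decoupling exponent to \<open>\<nu>'\<close>,
  since the narrow part of the broad-narrow splitting costs a factor less than 1 per scale.\<close>

lemma growth_from_bil:
  assumes l: "1 \<le> l" "l < k" and bilin: "\<And>B. B \<ge> 1 \<Longrightarrow> bilin k l B 1 1 (C * p powr (\<nu> * B))"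
    and C: "C \<ge> 0" and nu: "\<nu> \<ge> 0" "\<nu> < \<nu>'"
  shows "growth k \<nu>'"
proof -
  define M where "M = real p ^ (2 * (k * (k + 1)) + 2) * C"
  have M: "M \<ge> 0" using C by (simp add: M_def)
  have d: "decouples k B (1 + M * B * p powr (\<nu> * B))" for B
  proof (induction B)
    case 0
    show ?case using decouples_0[of k] by simp
  next
    case (Suc B)
    have "decouples k (Suc B) ((1 + M * B * p powr (\<nu> * B)) + real p ^ (2 * (k * (k + 1)) + 2) * (C * p powr (\<nu> * Suc B)))"
      using Suc M C by (intro decouples_step[OF _ bilin _ _ l]) auto
    moreover have "(1 + M * B * p powr (\<nu> * B)) + real p ^ (2 * (k * (k + 1)) + 2) * (C * p powr (\<nu> * Suc B)) \<le>
        1 + M * Suc B * p powr (\<nu> * Suc B)"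
    proof -
      have "M * B * p powr (\<nu> * B) \<le> M * B * p powr (\<nu> * Suc B)"
        using M nu by (intro mult_left_mono powr_mono) auto
      then show ?thesis by (simp add: M_def algebra_simps)
    qed
    ultimately show ?case by (rule decouples_mono)
  qed
  \<comment> \<open>Adding up the scales has produced a factor \<open>B\<close>; the gap \<nu>' -
    \<nu> absorbs it through \<open>\<delta> * B \<le> exp (\<delta> * B)\<close>.\<close>
  define \<delta> where "\<delta> = (\<nu>' - \<nu>) * ln p"
  have \<delta>: "\<delta> > 0" unfolding \<delta>_def
    by (rule mult_pos_pos) (use nu p_ge in \<open>auto intro: ln_gt_zero\<close>)
  have "decouples k B ((1 + M / \<delta>) * p powr (\<nu>' * B))" for B
  proof (rule decouples_mono[OF d])
    have "\<delta> * B \<le> exp (\<delta> * B)" using exp_ge_add_one_self[of "\<delta> * B"] by linarith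
    also have "exp (\<delta> * B) = p powr ((\<nu>' - \<nu>) * B)" by (simp add: powr_def \<delta>_def mult_ac)
    finally have "B \<le> p powr ((\<nu>' - \<nu>) * B) / \<delta>" using \<delta> by (simp add: field_simps)
    then have "M * B * p powr (\<nu> * B) \<le> M * (p powr ((\<nu>' - \<nu>) * B) / \<delta>) * p powr (\<nu> * B)"
      using M by (intro mult_left_mono mult_right_mono) auto
    also have "\<dots> = M / \<delta> * (p powr ((\<nu>' - \<nu>) * B) * p powr (\<nu> * B))" by simp
    also have "p powr ((\<nu>' - \<nu>) * B) * p powr (\<nu> * B) = p powr (\<nu>' * B)"
      by (simp add: algebra_simps flip: powr_add)
    finally show "1 + M * B * p powr (\<nu> * B) \<le> (1 + M / \<delta>) * p powr (\<nu>' * B)"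
      using ge_one_powr_ge_zero[of "real p" "\<nu>' * B"] nu by (simp add: algebra_simps)
  qed
  then show ?thesis
    using M \<delta> unfolding growth_def by (intro exI[of _ "1 + M / \<delta>"]) auto
qed

text \<open>The improvement \<kappa> depends on \<nu>0 but not on \<nu>, so that it survives the
  passage to an infimum. If \<open>n\<close> is so large that \<nu>0 n / k \<ge> P + 3, the saving
  beats the cost \<open>P + 2\<close> of returning to classes modulo \<open>p\<close> and leaves a
  factor p^(-b) with \<open>b\<close> about \<kappa> B.\<close>

lemma growth_improve:
  assumes k: "k \<ge> 2" "k < p" and low: "\<And>l \<epsilon>. l \<in> {1..<k} \<Longrightarrow> \<epsilon> > 0 \<Longrightarrow> growth l \<epsilon>"
    and nu0: "\<nu>0 > 0"
  shows "\<exists>\<kappa>>0. \<forall>\<nu>\<ge>\<nu>0. growth k \<nu> \<longrightarrow> (\<forall>\<epsilon>>0. growth k (max 0 (\<nu> - \<kappa>) + \<epsilon>))"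
proof -
  define P where "P = k * (k + 1)"
  obtain n0 :: nat where n0: "n0 \<ge> (real P + 3) * k / \<nu>0" using real_arch_simple by blast
  define n where "n = Suc n0"
  have n: "\<nu>0 * (real n / real k) \<ge> real P + 3"
  proof -
    have "(real P + 3) * k / \<nu>0 \<le> real n" using n0 by (simp add: n_def)
    then show ?thesis using nu0 k by (simp add: field_simps)
  qed
  \<comment> \<open>The \<open>k - 1\<close> values have average exactly
    \<open>n / k\<close>.\<close>
  have "\<exists>l\<in>{1..<k}. mu k n l \<ge> real n / real k"
  proof (rule ccontr)
    assume "\<not> ?thesis"
    then have "(\<Sum>l\<in>{1..<k}. mu k n l) < (\<Sum>l\<in>{1..<k}. real n / real k)"
      using k by (intro sum_strict_mono) (auto simp: not_le)
    also have "\<dots> = real n * (real k - 1) / real k" using k by (simp add: of_nat_diff)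
    finally show False using mu_sum[OF k(1), of n] by simp
  qed
  then obtain l where l: "1 \<le> l" "l < k" and mu: "mu k n l \<ge> real n / real k" by auto
  define \<kappa> where "\<kappa> = 1 / real (k ^ (n + 1))"
  have \<kappa>: "\<kappa> > 0" using k by (simp add: \<kappa>_def)
  show ?thesis
  proof (intro exI[of _ \<kappa>] conjI allI impI \<kappa>)
    fix \<nu> \<epsilon> :: real assume nu: "\<nu> \<ge> \<nu>0" and gr: "growth k \<nu>" and \<epsilon>: "\<epsilon> > 0"
    obtain C0 where C0: "C0 \<ge> 1" "\<And>B. decouples k B (C0 * p powr (\<nu> * B))" using gr by (auto simp: growth_def)
    define \<epsilon>' where "\<epsilon>' = \<epsilon> / (2 * n)"
    have \<epsilon>': "\<epsilon>' > 0" using \<epsilon> by (simp add: \<epsilon>'_def n_def)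
    have "\<forall>l\<in>{1..<k}. \<exists>C\<ge>1. \<forall>B. decouples l B (C * p powr (\<epsilon>' * B))"
      using low[OF _ \<epsilon>'] by (auto simp: growth_def)
    then obtain Cf where Cf: "\<And>l. l \<in> {1..<k} \<Longrightarrow> Cf l \<ge> 1" "\<And>l B. l \<in> {1..<k} \<Longrightarrow> decouples l B (Cf l * p powr (\<epsilon>' * B))"
      by metis
    define C where "C = (\<Sum>l\<in>{1..<k}. Cf l)"
    have Cl: "Cf l \<le> C" if "l \<in> {1..<k}" for l
      unfolding C_def using Cf(1) that by (intro member_le_sum) (auto intro: order_trans[OF zero_le_one])
    have C1: "C \<ge> 1" using Cl[of 1] Cf(1)[of 1] k by simp
    have lowC: "decouples l B (C * p powr (\<epsilon>' * B))" if "l \<in> {1..<k}" for l B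
      by (rule decouples_mono[OF Cf(2)[OF that]]) (use Cl[OF that] in \<open>auto intro: mult_right_mono\<close>)
    have nu_pos: "\<nu> > 0" using nu nu0 by simp
    obtain Cn where Cn: "Cn \<ge> C0" and it: "\<And>B b a l. 1 \<le> l \<Longrightarrow> l < k \<Longrightarrow> b > 0 \<Longrightarrow> ((fact k)\<^sup>2) ^ n dvd b \<Longrightarrow>
       k ^ (n + 1) * b \<le> B \<Longrightarrow> b \<le> k * a \<Longrightarrow> l * a \<le> (k - l + 1) * b \<Longrightarrow>
       bilin k l B a b (Cn * p powr ((\<nu> + n * \<epsilon>') * B - \<nu> * mu k n l * b))"
      using bilin_iterate[OF k less_imp_le[OF nu_pos] C0(2,1) lowC C1 \<epsilon>', of n] by blast
    \<comment> \<open>The scale \<open>b\<close> will be the largest multiple of \<open>F\<close>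
      with \<open>k ^ (n + 1) * b \<le> B\<close>. For \<open>B < G\<close> no positive one exists;
      these finitely many scales go into the constant.\<close>
    define F where "F = ((fact k :: nat)\<^sup>2) ^ n"
    have F: "F > 0" by (simp add: F_def)
    define G where "G = k ^ (n + 1) * F"
    have G: "G > 0" using F k by (simp add: G_def)
    define \<nu>1 where "\<nu>1 = max 0 (\<nu> + n * \<epsilon>' - \<kappa>)"
    define C' where "C' = Cn * p powr F + C0 * p powr (\<nu> * G)"
    have C'0: "C' \<ge> 0" using Cn C0 by (simp add: C'_def)
    have "bilin k l B 1 1 (C' * p powr (\<nu>1 * B))" if B: "B \<ge> 1" for B
    proof (cases "B < G")
      case True
      have "decouples k (B - 1) (C0 * p powr (\<nu> * G))"
        by (rule decouples_mono[OF C0(2)]) (use True C0 nu_pos in \<open>auto intro!: mult_left_mono powr_mono\<close>)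
      then have "bilin k l B 1 1 (C0 * p powr (\<nu> * G))"
        using C0 l B by (intro bilin_base) auto
      moreover have "C0 * p powr (\<nu> * G) \<le> C' * p powr (\<nu>1 * B)"
      proof -
        have "1 \<le> p powr (\<nu>1 * B)" by (intro ge_one_powr_ge_zero) (auto simp: \<nu>1_def)
        then have "C' * 1 \<le> C' * p powr (\<nu>1 * B)" by (intro mult_left_mono C'0)
        moreover have "C0 * p powr (\<nu> * G) \<le> C'" using Cn C0 by (simp add: C'_def)
        ultimately show ?thesis by simp
      qed
      ultimately show ?thesis by (rule bilin_mono)
    next
      case False
      define t where "t = B div G"
      define b where "b = F * t"
      have t: "t > 0" "t * G \<le> B" "B < (t + 1) * G"
        using False G dividend_less_div_times[OF G, of B]
        by (auto simp: t_def div_greater_zero_iff algebra_simps)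
      have bpos: "b > 0" using t F by (simp add: b_def)
      have kb: "k dvd b"
      proof -
        have "k dvd fact k" using k by (intro dvd_fact) auto
        then have "k dvd F" by (simp add: F_def n_def power2_eq_square)
        then show ?thesis by (simp add: b_def)
      qed
      \<comment> \<open>The coarsest first scale that the iteration accepts,
        \<open>b \<le> k * a\<close> being an equality.\<close>
      define a where "a = b div k"
      have a: "b = k * a" using kb by (simp add: a_def)
      have a1: "a \<ge> 1" using a bpos by (cases a) auto
      have ab: "a \<le> b" using a k by simp
      have kB: "k ^ (n + 1) * b \<le> B" using t(2) by (simp add: b_def G_def mult_ac)
      have "1 * b \<le> k ^ (n + 1) * b" using k by (intro mult_right_mono one_le_power) auto
      with kB have bB: "b \<le> B" by linarith
      define K where "K = Cn * p powr ((\<nu> + n * \<epsilon>') * B - \<nu> * mu k n l * b)"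
      have "bilin k l B a b K" unfolding K_def
      proof (rule it[OF l bpos _ kB])
        show "((fact k)\<^sup>2) ^ n dvd b" by (simp add: b_def F_def)
        have "l * a \<le> k * a" using l by simp
        also have "\<dots> \<le> (k - l + 1) * b" using a by simp
        finally show "l * a \<le> (k - l + 1) * b" .
      qed (use a in simp)
      then have "bilin k l B 1 1 (p powr real (b * (k * (k + 1) + 2)) * K)"
        using Cn C0 a1 ab bB l by (intro bilin_unsplit) (auto simp: K_def)
      moreover have "p powr real (b * (k * (k + 1) + 2)) * K \<le> C' * p powr (\<nu>1 * B)"
      proof -
        have "p powr real (b * (k * (k + 1) + 2)) * K =
            Cn * p powr (b * (real P + 2) + (\<nu> + n * \<epsilon>') * B - \<nu> * mu k n l * b)"
          by (simp add: K_def P_def algebra_simps flip: powr_add)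
        also have "\<dots> \<le> Cn * p powr (F + \<nu>1 * B)"
        proof (intro mult_left_mono powr_mono)
          have "real P + 3 \<le> \<nu> * mu k n l"
          proof -
            have "\<nu>0 * (real n / real k) \<le> \<nu> * mu k n l" using nu nu0 mu by (intro mult_mono) auto
            with n show ?thesis by linarith
          qed
          then have "b * (real P + 3) \<le> b * (\<nu> * mu k n l)" by (intro mult_left_mono) auto
          moreover have "\<kappa> * B - F \<le> b"
          proof -
            have "real B \<le> (t + 1) * G" using t(3) by (metis less_imp_le of_nat_le_iff)
            then have "\<kappa> * B \<le> \<kappa> * ((t + 1) * G)" using \<kappa> by (intro mult_left_mono) auto
            also have "\<dots> = (t + 1) * F"
            proof -
              define X where "X = real (k ^ (n + 1))"
              have X: "\<kappa> * X = 1" "real G = X * real F" using k by (simp_all add: X_def \<kappa>_def G_def)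
              have "\<kappa> * ((t + 1) * G) = (\<kappa> * X) * ((t + 1) * F)" by (simp add: X(2) algebra_simps)
              then show ?thesis by (simp add: X(1))
            qed
            finally show ?thesis by (simp add: b_def algebra_simps)
          qed
          moreover have "(\<nu> + n * \<epsilon>' - \<kappa>) * B \<le> \<nu>1 * B" by (intro mult_right_mono) (auto simp: \<nu>1_def)
          ultimately show "b * (real P + 2) + (\<nu> + n * \<epsilon>') * B - \<nu> * mu k n l * b \<le> F + \<nu>1 * B"
            by (simp add: algebra_simps)
        qed (use Cn C0 in auto)
        also have "\<dots> = (Cn * p powr F) * p powr (\<nu>1 * B)" by (simp add: powr_add)
        also have "\<dots> \<le> C' * p powr (\<nu>1 * B)" using C0 by (intro mult_right_mono) (auto simp: C'_def)
        finally show ?thesis .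
      qed
      ultimately show ?thesis by (rule bilin_mono)
    qed
    then show "growth k (max 0 (\<nu> - \<kappa>) + \<epsilon>)"
    proof (rule growth_from_bil[OF l _ C'0])
      have "real n \<noteq> 0" by (simp add: n_def)
      then have "n * \<epsilon>' = \<epsilon> / 2" by (simp add: \<epsilon>'_def)
      then show "\<nu>1 < max 0 (\<nu> - \<kappa>) + \<epsilon>" using \<epsilon> by (auto simp: \<nu>1_def max_def)
    qed (simp_all add: \<nu>1_def)
  qed
qed

text \<open>Induction on the degree, showing that the infimum \<nu>0 of the admissible exponents is
  0. The infimum need not be attained, so one takes an exponent within \<kappa> / 2 of it, which the
  improvement would move below \<nu>0.\<close>

theorem decoupling:
  assumes "1 \<le> k" "k < p" "\<epsilon> > 0" shows "growth k \<epsilon>"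
  using assms
proof (induction k arbitrary: \<epsilon> rule: less_induct)
  case (less k)
  show ?case
  proof (cases "k = 1")
    case True
    have "decouples 1 B (1 * p powr (\<epsilon> * B))" for B
      using ge_one_powr_ge_zero[of "real p" "\<epsilon> * B"] less.prems by (intro decouples_mono[OF decouples_1]) auto
    then show ?thesis unfolding growth_def True by blast
  next
    case False
    define S where "S = {\<nu>. 0 \<le> \<nu> \<and> growth k \<nu>}"
    define \<nu>0 where "\<nu>0 = Inf S"
    have "0 \<le> real (k * (k + 1)) \<and> growth k (real (k * (k + 1)))"
      by (intro conjI growth_trivial of_nat_0_le_iff) (use less.prems in simp)
    then have ne: "S \<noteq> {}" unfolding S_def by blast
    have bdd: "bdd_below S" by (rule bdd_belowI[of _ 0]) (simp add: S_def)
    have ge0: "\<nu>0 \<ge> 0" unfolding \<nu>0_def by (rule cInf_greatest[OF ne]) (simp add: S_def)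
    have "\<nu>0 = 0"
    proof (rule ccontr)
      assume "\<nu>0 \<noteq> 0"
      then have pos: "\<nu>0 > 0" using ge0 by simp
      have "\<exists>\<kappa>>0. \<forall>\<nu>\<ge>\<nu>0. growth k \<nu> \<longrightarrow> (\<forall>\<epsilon>>0. growth k (max 0 (\<nu> - \<kappa>) + \<epsilon>))"
        by (rule growth_improve) (use less False pos in auto)
      then obtain \<kappa> where \<kappa>: "\<kappa> > 0" "\<And>\<nu> \<epsilon>. \<nu> \<ge> \<nu>0 \<Longrightarrow> growth k \<nu> \<Longrightarrow> \<epsilon> > 0 \<Longrightarrow> growth k (max 0 (\<nu> - \<kappa>) + \<epsilon>)"
        by blast
      obtain \<nu> where \<nu>: "\<nu> \<in> S" "\<nu> < \<nu>0 + \<kappa> / 2"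
        using cInf_lessD[OF ne, of "\<nu>0 + \<kappa> / 2"] \<kappa>(1) by (auto simp: \<nu>0_def)
      have \<nu>ge: "\<nu> \<ge> \<nu>0" unfolding \<nu>0_def by (rule cInf_lower[OF \<nu>(1) bdd])
      \<comment> \<open>Both branches of the maximum must end below \<nu>0: the bound \<kappa> / 4
        serves \<nu> > \<kappa>, the bound \<nu>0 / 2 serves \<nu> \<le> \<kappa>.\<close>
      define \<epsilon>' where "\<epsilon>' = min (\<kappa> / 4) (\<nu>0 / 2)"
      have \<epsilon>': "\<epsilon>' > 0" "\<epsilon>' \<le> \<kappa> / 4" "\<epsilon>' \<le> \<nu>0 / 2" using \<kappa>(1) pos by (auto simp: \<epsilon>'_def)
      have "max 0 (\<nu> - \<kappa>) + \<epsilon>' \<in> S" using \<kappa>(2)[OF \<nu>ge _ \<epsilon>'(1)] \<nu>(1) \<epsilon>'(1) by (auto simp: S_def)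
      then have "\<nu>0 \<le> max 0 (\<nu> - \<kappa>) + \<epsilon>'" unfolding \<nu>0_def by (rule cInf_lower[OF _ bdd])
      then show False using \<nu>(2) \<epsilon>' \<kappa>(1) pos by (auto simp: max_def split: if_splits)
    qed
    then obtain \<nu> where "\<nu> \<in> S" "\<nu> < \<epsilon>"
      using cInf_lessD[OF ne, of \<epsilon>] less.prems by (auto simp: \<nu>0_def)
    then show ?thesis using growth_mono[of k \<nu> \<epsilon>] by (simp add: S_def)
  qed
qed

text \<open>The set \<open>A\<close> meets each class modulo \<open>p ^ B\<close> at most once, so
  the sums over the finest pieces are at most \<open>M\<close>; adding the \<open>p ^ B\<close>
  classes turns \<open>gain k\<close> into half the critical exponent. The last factor counts the
  frequencies, since moments are not normalised.\<close>

theorem vinogradov_mean_value: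
  assumes "1 \<le> k" "k < p" "\<epsilon> > 0"
  shows "\<exists>C\<ge>1. \<forall>B A (c :: int \<Rightarrow> complex) M. M \<ge> 0 \<longrightarrow> A \<subseteq> {1..int p ^ B} \<longrightarrow> (\<forall>n\<in>A. norm (c n) \<le> M) \<longrightarrow>
    moment k (k * B) (k * (k + 1)) c A \<le>
      C * p powr (B * (real (k * (k + 1)) / 2 + \<epsilon>)) * M ^ (k * (k + 1)) * real (p ^ (k * B)) ^ (k + 1)"
proof -
  obtain C where C: "C \<ge> 1" "\<And>B. decouples k B (C * p powr (\<epsilon> * B))"
    using decoupling[OF assms] by (auto simp: growth_def)
  define P where "P = k * (k + 1)"
  show ?thesis
  proof (intro exI[of _ C] conjI C allI impI)
    fix B A and c :: "int \<Rightarrow> complex" and M :: real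
    assume M: "M \<ge> 0" and A: "A \<subseteq> {1..int p ^ B}" and c: "\<forall>n\<in>A. norm (c n) \<le> M"
    have fin: "finite A" using A finite_subset by blast
    define D where "D = real (p ^ (k * B)) ^ (k + 1)"
    have D: "real (card (freqs k (p ^ (k * B)))) = D" by (simp add: D_def card_freqs)
    have one: "norm (expsum k (p ^ (k * B)) c (A \<inter> cls B J) x) \<le> M" for J x
    proof (cases "A \<inter> cls B J = {}")
      case False
      then obtain n where n: "n \<in> A" "n \<in> cls B J" by blast
      have "n' = n" if "n' \<in> A \<inter> cls B J" for n'
      proof -
        have "[n' = n] (mod int p ^ B)" using n that by (auto simp: cls_def intro: cong_trans cong_sym)
        then have "[n' - 1 = n - 1] (mod int p ^ B)" by (rule cong_diff) simp
        moreover have "n - 1 \<ge> 0" "n' - 1 \<ge> 0" "n - 1 < int p ^ B" "n' - 1 < int p ^ B"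
          using A n that by auto
        ultimately have "n' - 1 = n - 1" by (intro cong_less_imp_eq_int)
        then show ?thesis by simp
      qed
      then have "A \<inter> cls B J = {n}" using n by blast
      then show ?thesis using c n by (simp add: expsum_def norm_mult)
    qed (simp add: M)
    have "moment k (k * B) P c (A \<inter> cls B J) \<le> D * M ^ P" for J
      unfolding moment_def D[symmetric]
      by (rule sum_bounded_above) (auto intro: power_mono one)
    then have "fsum k B c A \<le> (\<Sum>J\<in>{0..<int p ^ B}. D * M ^ P)"
      unfolding fsum_def P_def[symmetric] by (intro sum_mono)
    also have "\<dots> = real p ^ B * (D * M ^ P)" by (simp add: nat_power_eq)
    finally have t: "fsum k B c A \<le> real p ^ B * (D * M ^ P)" .
    have "moment k (k * B) P c A \<le> C * p powr (\<epsilon> * B) * p powr (B * gain k) * fsum k B c A"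
      unfolding P_def by (rule C(2)[unfolded decouples_fsum, rule_format, OF fin])
    also have "\<dots> \<le> C * p powr (\<epsilon> * B) * p powr (B * gain k) * (real p ^ B * (D * M ^ P))"
      using C(1) t by (intro mult_left_mono) auto
    also have "\<dots> = C * (p powr (\<epsilon> * B) * p powr (B * gain k) * p powr B) * M ^ P * D"
      by (simp add: powr_realpow)
    also have "p powr (\<epsilon> * B) * p powr (B * gain k) * p powr B = p powr (B * (real P / 2 + \<epsilon>))"
      by (simp add: gain_def P_def algebra_simps flip: powr_add)
    finally show "moment k (k * B) (k * (k + 1)) c A \<le>
      C * p powr (B * (real (k * (k + 1)) / 2 + \<epsilon>)) * M ^ (k * (k + 1)) * real (p ^ (k * B)) ^ (k + 1)"
      by (simp only: P_def D_def)
  qed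
qed

end

section \<open>Perturbation of the frequencies\<close>

text \<open>Cauchy's inequalities on the circle of radius 2 give the decay 2^(-m), while the series
  is evaluated in the unit disc. The constant bounds the exponential on that circle uniformly in
  \<open>h\<close>.\<close>

lemma exp_polynomial_series:
  fixes d :: nat
  shows "\<exists>C>0. \<forall>h. (\<forall>j\<le>d. \<bar>h j\<bar> \<le> 2) \<longrightarrow>
    (\<exists>c::nat \<Rightarrow> complex. (\<forall>m. norm (c m) \<le> C / 2 ^ m) \<and>
      (\<forall>u::real. \<bar>u\<bar> \<le> 1 \<longrightarrow> (\<lambda>m. c m * of_real u ^ m) sums e (\<Sum>j\<le>d. h j * u ^ j)))"
proof (rule exI, intro conjI allI impI)
  define C where "C = exp (2 * pi * (\<Sum>j\<le>d. 2 * 2 ^ j))"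
  show "C > 0" by (simp add: C_def)
  fix h :: "nat \<Rightarrow> real" assume h: "\<forall>j\<le>d. \<bar>h j\<bar> \<le> 2"
  define f where "f = (\<lambda>z::complex. exp (2 * of_real pi * \<i> * (\<Sum>j\<le>d. of_real (h j) * z ^ j)))"
  have hol: "f holomorphic_on S" for S unfolding f_def by (intro holomorphic_intros)
  have bound: "norm (f z) \<le> C" if "norm z = 2" for z
  proof -
    have "norm (\<Sum>j\<le>d. of_real (h j) * z ^ j) \<le> (\<Sum>j\<le>d. 2 * 2 ^ j)"
      by (rule sum_norm_le) (use h that in \<open>auto simp: norm_mult norm_power intro!: mult_right_mono\<close>)
    then have "norm (2 * of_real pi * \<i> * (\<Sum>j\<le>d. of_real (h j) * z ^ j)) \<le> 2 * pi * (\<Sum>j\<le>d. 2 * 2 ^ j)"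
      by (simp add: norm_mult)
    then show ?thesis unfolding f_def C_def
      by (intro order_trans[OF norm_exp]) simp
  qed
  define c where "c = (\<lambda>m. (deriv ^^ m) f 0 / fact m)"
  have "norm (c m) \<le> C / 2 ^ m" for m
  proof -
    have "norm ((deriv ^^ m) f 0) \<le> fact m * C / 2 ^ m"
      by (rule Cauchy_inequality[OF hol]) (use bound holomorphic_on_imp_continuous_on[OF hol] in auto)
    then show ?thesis by (simp add: c_def norm_divide field_simps)
  qed
  moreover have "(\<lambda>m. c m * of_real u ^ m) sums e (\<Sum>j\<le>d. h j * u ^ j)" if "\<bar>u\<bar> \<le> 1" for u
  proof -
    have "(\<lambda>m. (deriv ^^ m) f 0 / fact m * (of_real u - 0) ^ m) sums f (of_real u)"
      by (rule holomorphic_power_series[where r = 2, OF hol]) (use that in auto)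
    moreover have "f (of_real u) = e (\<Sum>j\<le>d. h j * u ^ j)" by (simp add: f_def e_def)
    ultimately show ?thesis by (simp add: c_def)
  qed
  ultimately show "\<exists>c::nat \<Rightarrow> complex. (\<forall>m. norm (c m) \<le> C / 2 ^ m) \<and>
      (\<forall>u::real. \<bar>u\<bar> \<le> 1 \<longrightarrow> (\<lambda>m. c m * of_real u ^ m) sums e (\<Sum>j\<le>d. h j * u ^ j))"
    by blast
qed

text \<open>Hoelder with the weights 2^(-m), whose total is at most 2, so that the constant is free
  of \<open>K\<close>.\<close>

lemma sum_halves_power_le:
  fixes x :: "nat \<Rightarrow> real"
  assumes "\<And>m. x m \<ge> 0" "r \<ge> 2"
  shows "(\<Sum>m<K. x m / 2 ^ m) ^ r \<le> 2 ^ r * (\<Sum>m<K. x m ^ r / 2 ^ m)"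
proof -
  let ?S = "\<Sum>m<K. x m ^ r / 2 ^ m"
  define \<theta> where "\<theta> = real 1 / real r"
  have \<theta>: "0 < \<theta>" "\<theta> < 1" using assms(2) by (auto simp: \<theta>_def)
  have g: "(\<Sum>m<K. 1 / 2 ^ m :: real) \<le> 2"
  proof -
    have "(\<Sum>m<K. 1 / 2 ^ m :: real) = (\<Sum>m<K. (1 / 2) ^ m)" by (simp add: power_one_over)
    also have "\<dots> \<le> 2" by (subst sum_gp_strict) auto
    finally show ?thesis .
  qed
  have "(\<Sum>m<K. x m / 2 ^ m) = (\<Sum>m<K. (x m ^ r / 2 ^ m) powr \<theta> * (1 / 2 ^ m) powr (1 - \<theta>))"
  proof (intro sum.cong refl)
    fix m
    have "(x m ^ r / 2 ^ m) powr \<theta> * (1 / 2 ^ m) powr (1 - \<theta>) =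
        (x m ^ r) powr \<theta> * ((1 / 2 ^ m) powr \<theta> * (1 / 2 ^ m) powr (1 - \<theta>))"
      using assms(1)[of m] powr_mult[of "x m ^ r" "1 / 2 ^ m" \<theta>] by simp
    also have "(x m ^ r) powr \<theta> = x m ^ 1"
      unfolding \<theta>_def by (rule power_powr_quotient) (use assms in auto)
    also have "(1 / 2 ^ m) powr \<theta> * (1 / 2 ^ m) powr (1 - \<theta>) = (1 / 2 ^ m :: real)"
      by (simp flip: powr_add)
    finally show "x m / 2 ^ m = (x m ^ r / 2 ^ m) powr \<theta> * (1 / 2 ^ m) powr (1 - \<theta>)" by simp
  qed
  also have "\<dots> \<le> ?S powr \<theta> * (\<Sum>m<K. 1 / 2 ^ m) powr (1 - \<theta>)"
    by (rule Holder_sum) (use assms \<theta> in auto)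
  also have "\<dots> \<le> ?S powr \<theta> * 2"
  proof (rule mult_left_mono)
    have "(\<Sum>m<K. 1 / 2 ^ m :: real) powr (1 - \<theta>) \<le> 2 powr (1 - \<theta>)"
      using g \<theta> by (intro powr_mono2) (auto intro: sum_nonneg)
    also have "\<dots> \<le> 2 powr 1" using \<theta> by (intro powr_mono) auto
    finally show "(\<Sum>m<K. 1 / 2 ^ m :: real) powr (1 - \<theta>) \<le> 2" by simp
  qed simp
  finally have "(\<Sum>m<K. x m / 2 ^ m) ^ r \<le> (?S powr \<theta> * 2) ^ r"
    by (rule power_mono[OF _ sum_nonneg]) (simp_all add: assms(1))
  also have "\<dots> = (?S powr \<theta>) ^ r * 2 ^ r" by (simp add: power_mult_distrib)
  also have "(?S powr \<theta>) ^ r = ?S"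
  proof (cases "?S = 0")
    case False
    then have "?S > 0"
      using sum_nonneg[of "{..<K}" "\<lambda>m. x m ^ r / 2 ^ m"] assms(1) by (metis divide_nonneg_nonneg less_le zero_le_numeral zero_le_power)
    moreover have "(S powr \<theta>) ^ r = S" if "S > 0" for S :: real
      using that assms(2) by (subst powr_realpow[symmetric]) (simp_all add: \<theta>_def powr_powr)
    ultimately show ?thesis by blast
  qed (use assms(2) in \<open>simp add: zero_power\<close>)
  finally show ?thesis by (simp only: mult.commute)
qed

text \<open>Replacing the frequencies by nearby grid points costs only a rapidly convergent series of sums
  whose coefficients carry the weights \<open>(n / X) ^ m\<close>.\<close>

lemma expsum_perturb:
  fixes d :: nat
  shows "\<exists>C>0. \<forall>N X K (a :: nat \<Rightarrow> complex) (\<theta> :: nat \<Rightarrow> real) \<phi> M h.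
    X > 0 \<longrightarrow> real N \<le> X \<longrightarrow> (\<forall>n\<in>{1..N}. norm (a n) \<le> M) \<longrightarrow> (\<forall>j\<le>d. \<bar>h j\<bar> \<le> 2) \<longrightarrow>
    (\<forall>n\<in>{1..N}. \<phi> n = \<theta> n + (\<Sum>j\<le>d. h j * (real n / X) ^ j)) \<longrightarrow>
    norm (\<Sum>n=1..N. a n * e (\<phi> n)) \<le>
      C * (\<Sum>m<K. norm (\<Sum>n=1..N. a n * of_real ((real n / X) ^ m) * e (\<theta> n)) / 2 ^ m) + 2 * C * N * M / 2 ^ K"
proof -
  obtain C where C: "C > 0" and series: "\<forall>h. (\<forall>j\<le>d. \<bar>h j\<bar> \<le> 2) \<longrightarrow>
    (\<exists>c::nat \<Rightarrow> complex. (\<forall>m. norm (c m) \<le> C / 2 ^ m) \<and>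
      (\<forall>u::real. \<bar>u\<bar> \<le> 1 \<longrightarrow> (\<lambda>m. c m * of_real u ^ m) sums e (\<Sum>j\<le>d. h j * u ^ j)))"
    using exp_polynomial_series[of d] by (elim exE conjE)
  show ?thesis
  proof (intro exI[of _ C] conjI allI impI C)
    fix N K :: nat and X M :: real and a :: "nat \<Rightarrow> complex" and \<theta> \<phi> :: "nat \<Rightarrow> real" and h :: "nat \<Rightarrow> real"
    assume X: "X > 0" "real N \<le> X" and "\<forall>n\<in>{1..N}. norm (a n) \<le> M" "\<forall>j\<le>d. \<bar>h j\<bar> \<le> 2"
      "\<forall>n\<in>{1..N}. \<phi> n = \<theta> n + (\<Sum>j\<le>d. h j * (real n / X) ^ j)"
    then have a: "\<And>n. n \<in> {1..N} \<Longrightarrow> norm (a n) \<le> M" and h: "\<And>j. j \<le> d \<Longrightarrow> \<bar>h j\<bar> \<le> 2"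
      and \<phi>: "\<And>n. n \<in> {1..N} \<Longrightarrow> \<phi> n = \<theta> n + (\<Sum>j\<le>d. h j * (real n / X) ^ j)"
      by blast+
    obtain c where c': "\<forall>m. norm (c m) \<le> C / 2 ^ m"
      "\<forall>u::real. \<bar>u\<bar> \<le> 1 \<longrightarrow> (\<lambda>m. c m * of_real u ^ m) sums e (\<Sum>j\<le>d. h j * u ^ j)"
      using series[THEN spec, THEN mp, of h] h by blast
    have c: "norm (c m) \<le> C / 2 ^ m" "\<bar>u\<bar> \<le> 1 \<Longrightarrow> (\<lambda>m. c m * of_real u ^ m) sums e (\<Sum>j\<le>d. h j * u ^ j)"
      for m and u :: real using c' by blast+
    define G where "G = (\<lambda>m. \<Sum>n=1..N. a n * of_real ((real n / X) ^ m) * e (\<theta> n))"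
    have u: "\<bar>real n / X\<bar> \<le> 1" if "n \<in> {1..N}" for n using X that by simp
    have "(\<lambda>m. \<Sum>n=1..N. a n * e (\<theta> n) * (c m * of_real (real n / X) ^ m)) sums
        (\<Sum>n=1..N. a n * e (\<theta> n) * e (\<Sum>j\<le>d. h j * (real n / X) ^ j))"
      by (intro sums_sum sums_mult c(2) u)
    also have "(\<Sum>n=1..N. a n * e (\<theta> n) * e (\<Sum>j\<le>d. h j * (real n / X) ^ j)) = (\<Sum>n=1..N. a n * e (\<phi> n))"
      by (intro sum.cong refl) (simp add: \<phi> e_add)
    also have "(\<lambda>m. \<Sum>n=1..N. a n * e (\<theta> n) * (c m * of_real (real n / X) ^ m)) = (\<lambda>m. c m * G m)"
      by (simp add: G_def sum_distrib_left mult_ac)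
    finally have s: "(\<lambda>m. c m * G m) sums (\<Sum>n=1..N. a n * e (\<phi> n))" .
    have G: "norm (G m) \<le> N * M" for m
    proof -
      have "norm (G m) \<le> (\<Sum>n=1..N. M)"
        unfolding G_def
      proof (rule sum_norm_le)
        fix n assume n: "n \<in> {1..N}"
        have "norm (a n) * (real n / X) ^ m \<le> M * 1"
          using a[OF n] u[OF n] X order_trans[OF norm_ge_zero a[OF n]] by (intro mult_mono power_le_one) auto
        then show "norm (a n * of_real ((real n / X) ^ m) * e (\<theta> n)) \<le> M"
          using X by (simp add: norm_mult norm_divide norm_power)
      qed
      then show ?thesis by simp
    qed
    \<comment> \<open>Cutting at \<open>K\<close> leaves a finite sum; the tail is geometric because
      all \<open>G m\<close> share the bound \<open>N * M\<close>.\<close>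
    have tail: "(\<lambda>m. c (m + K) * G (m + K)) sums ((\<Sum>n=1..N. a n * e (\<phi> n)) - (\<Sum>m<K. c m * G m))"
      using s by (rule sums_split_initial_segment)
    have gs: "(\<lambda>m. (C / 2 ^ K * (N * M)) * (1 / 2) ^ m) sums ((C / 2 ^ K * (N * M)) * (1 / (1 - 1 / 2)))"
      by (intro sums_mult geometric_sums) simp
    have "norm ((\<Sum>n=1..N. a n * e (\<phi> n)) - (\<Sum>m<K. c m * G m)) \<le> (C / 2 ^ K * (N * M)) * (1 / (1 - 1 / 2))"
      unfolding sums_unique[OF tail] sums_unique[OF gs]
    proof (rule norm_suminf_le[OF _ sums_summable[OF gs]])
      fix m
      have "norm (c (m + K) * G (m + K)) \<le> C / 2 ^ (m + K) * (N * M)"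
        unfolding norm_mult by (intro mult_mono c G) (use C in auto)
      then show "norm (c (m + K) * G (m + K)) \<le> C / 2 ^ K * (N * M) * (1 / 2) ^ m"
        by (simp add: power_add power_one_over mult_ac)
    qed
    moreover have "norm (\<Sum>m<K. c m * G m) \<le> C * (\<Sum>m<K. norm (G m) / 2 ^ m)"
      unfolding sum_distrib_left
    proof (rule sum_norm_le)
      fix m
      show "norm (c m * G m) \<le> C * (norm (G m) / 2 ^ m)"
        using mult_right_mono[OF c(1)[of m] norm_ge_zero[of "G m"]] by (simp add: norm_mult)
    qed
    moreover have "norm (\<Sum>n=1..N. a n * e (\<phi> n)) \<le> norm ((\<Sum>n=1..N. a n * e (\<phi> n)) - (\<Sum>m<K. c m * G m)) + norm (\<Sum>m<K. c m * G m)"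
      by (metis diff_add_cancel norm_triangle_ineq)
    ultimately show "norm (\<Sum>n=1..N. a n * e (\<phi> n)) \<le>
      C * (\<Sum>m<K. norm (\<Sum>n=1..N. a n * of_real ((real n / X) ^ m) * e (\<theta> n)) / 2 ^ m) + 2 * C * N * M / 2 ^ K"
      by (simp add: G_def mult_ac)
  qed
qed

section \<open>Discretisation of the curve\<close>

text \<open>In the main case \<open>y > 1\<close> and \<open>y > x\<close>, the increment of the
  \<open>j\<close>-th power times \<open>y ^ (d - j) \<ge> 1\<close> is at most the increment of the
  \<open>d\<close>-th power. Thus control of the top power controls all lower ones.\<close>

lemma power_increment_le:
  fixes x y :: real
  assumes "0 \<le> x" "0 \<le> y" "y ^ d \<le> x ^ d + 1" "1 \<le> j" "j \<le> d"
  shows "y ^ j \<le> x ^ j + 1"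
proof (cases "y \<le> 1 \<or> y \<le> x")
  case True
  then show ?thesis
  proof
    assume "y \<le> 1"
    then have "y ^ j \<le> 1" using assms by (simp add: power_le_one)
    moreover have "x ^ j \<ge> 0" using assms by simp
    ultimately show ?thesis by simp
  next
    assume "y \<le> x"
    then have "y ^ j \<le> x ^ j" using assms by (intro power_mono)
    then show ?thesis by simp
  qed
next
  case False
  have d: "d = (d - j) + j" using assms by simp
  have "1 * (y ^ j - x ^ j) \<le> y ^ (d - j) * (y ^ j - x ^ j)"
    using False assms by (intro mult_right_mono one_le_power) (auto intro: power_mono)
  also have "\<dots> = y ^ (d - j) * y ^ j - y ^ (d - j) * x ^ j"
    by (rule right_diff_distrib)
  finally have "y ^ j - x ^ j \<le> y ^ (d - j) * y ^ j - y ^ (d - j) * x ^ j" by simp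
  moreover have "y ^ (d - j) * x ^ j \<ge> x ^ (d - j) * x ^ j"
    using False assms by (intro mult_right_mono power_mono) auto
  moreover have "x ^ (d - j) * x ^ j = x ^ d" "y ^ (d - j) * y ^ j = y ^ d"
    using d by (metis power_add)+
  ultimately show ?thesis using assms(3) by linarith
qed

definition node :: "nat \<Rightarrow> nat \<Rightarrow> nat \<Rightarrow> real" where
  "node d X v = root d (real v / real X ^ d)"

text \<open>In units of \<open>1 / X ^ d\<close>. The top coordinate is \<open>v\<close> itself, so
  boxes of different nodes cannot meet; this is why nodes have equally spaced \<open>d\<close>-th
  powers. For \<open>0 < j < d\<close> the coordinate starts at the \<open>j\<close>-th power of the
  node, rounded down to a multiple of X^(-j), and runs through one such step. Coordinate 0 carries a
  constant phase and runs through everything.\<close>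

definition grid_point :: "nat \<Rightarrow> nat \<Rightarrow> nat \<Rightarrow> (nat \<Rightarrow> int) \<Rightarrow> nat \<Rightarrow> int" where
  "grid_point d X v z = (\<lambda>j\<in>{..d}. if j = d then int v
     else (if j = 0 then 0 else \<lfloor>(node d X v * real X) ^ j\<rfloor>) * int X ^ (d - j) + z j)"

definition offsets :: "nat \<Rightarrow> nat \<Rightarrow> (nat \<Rightarrow> int) set" where
  "offsets d X = PiE {..<d} (\<lambda>j. {0..<int X ^ (d - j)})"

lemma finite_offsets [simp]: "finite (offsets d X)"
  by (simp add: offsets_def finite_PiE)

lemma card_offsets: "card (offsets d X) = X ^ (d * (d + 1) div 2)"
proof -
  have "card (offsets d X) = (\<Prod>j<d. X ^ (d - j))"
    by (simp add: offsets_def card_PiE nat_power_eq)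
  also have "\<dots> = X ^ (\<Sum>j<d. d - j)" by (simp add: power_sum)
  also have "(\<Sum>j<d. d - j) = (\<Sum>j\<in>{1..d}. j)"
    by (rule sum.reindex_bij_witness[of _ "\<lambda>j. d - j" "\<lambda>j. d - j"]) auto
  also have "\<dots> = d * (d + 1) div 2" by (induction d) auto
  finally show ?thesis .
qed

lemma node_pow:
  assumes "d \<ge> 1" "X > 0"
  shows "node d X v \<ge> 0" "(node d X v * real X) ^ d = real v"
  using assms by (simp_all add: node_def power_mult_distrib)

lemma floor_node_less:
  assumes "d \<ge> 1" "X > 0" "v < X ^ d" "1 \<le> j"
  shows "0 \<le> \<lfloor>(node d X v * real X) ^ j\<rfloor>" "\<lfloor>(node d X v * real X) ^ j\<rfloor> < int X ^ j"
proof -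
  define u where "u = node d X v * real X"
  have u: "u \<ge> 0" "u ^ d = real v" using node_pow[OF assms(1,2)] by (simp_all add: u_def)
  have "u ^ d < real X ^ d" using u(2) assms(3) by (simp flip: of_nat_power)
  then have "u < real X" by (rule power_less_imp_less_base) simp
  then have "u ^ j < real X ^ j" using u assms by (intro power_strict_mono) auto
  then show "\<lfloor>(node d X v * real X) ^ j\<rfloor> < int X ^ j"
    unfolding u_def[symmetric] by (simp add: floor_less_iff)
  show "0 \<le> \<lfloor>(node d X v * real X) ^ j\<rfloor>" using u(1) unfolding u_def by simp
qed

lemma grid_point_freqs:
  assumes "d \<ge> 1" "X > 0" "v < X ^ d" "z \<in> offsets d X"
  shows "grid_point d X v z \<in> freqs d (X ^ d)"
proof -
  have "grid_point d X v z j \<in> {0..<int (X ^ d)}" if j: "j \<le> d" for j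
  proof (cases "j = d")
    case True
    then show ?thesis using assms by (simp add: grid_point_def flip: of_nat_power)
  next
    case False
    define c where "c = (if j = 0 then 0 else \<lfloor>(node d X v * real X) ^ j\<rfloor>)"
    have c: "0 \<le> c" "c < int X ^ j" using floor_node_less[OF assms(1-3), of j] by (auto simp: c_def)
    have z: "0 \<le> z j" "z j < int X ^ (d - j)" using assms(4) False j by (auto simp: offsets_def PiE_iff)
    have "(c + 1) * int X ^ (d - j) \<le> int X ^ j * int X ^ (d - j)" using c by (intro mult_right_mono) auto
    also have "\<dots> = int X ^ d" using j by (simp flip: power_add)
    finally have "c * int X ^ (d - j) + z j < int X ^ d" using z by (simp add: distrib_right)
    moreover have "0 \<le> c * int X ^ (d - j) + z j" using c z by simp
    moreover have "grid_point d X v z j = c * int X ^ (d - j) + z j" using False j by (simp add: grid_point_def c_def)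
    ultimately show ?thesis by simp
  qed
  then show ?thesis by (auto simp: freqs_def PiE_iff grid_point_def extensional_def)
qed

lemma inj_grid_point:
  "inj_on (\<lambda>(v, z). grid_point d X v z) (UNIV \<times> offsets d X)"
proof (rule inj_onI, clarify)
  fix v z v' z' assume z: "z \<in> offsets d X" "z' \<in> offsets d X" and eq: "grid_point d X v z = grid_point d X v' z'"
  have v: "v = v'" using fun_cong[OF eq, of d] by (simp add: grid_point_def)
  have "z j = z' j" for j
  proof (cases "j < d")
    case True
    then show ?thesis using fun_cong[OF eq, of j] v by (simp add: grid_point_def)
  next
    case False
    then show ?thesis using z by (auto simp: offsets_def PiE_iff extensional_def)
  qed
  with v show "v = v' \<and> z = z'" by auto
qed

text \<open>For \<open>j > 0\<close>, one unit of the bound comes from moving \<open>t\<close>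
  within its piece and one from rounding together with the position in the box.\<close>

lemma grid_point_close:
  assumes "d \<ge> 1" "X > 0" "v < X ^ d" "z \<in> offsets d X" and t: "node d X v \<le> t" "t \<le> node d X (Suc v)"
    and j: "j \<le> d"
  shows "\<bar>real X ^ j * ((if j = 0 then 0 else t ^ j) - grid_point d X v z j / real X ^ d)\<bar> \<le> 2"
proof -
  have X: "real X > 0" "real X ^ j > 0" "real X ^ d > 0" using assms by auto
  define u where "u = node d X v * real X"
  have u: "u \<ge> 0" "u ^ d = real v" using node_pow[OF assms(1,2)] by (simp_all add: u_def)
  have t0: "t \<ge> 0" using t node_pow(1)[OF assms(1,2)] order_trans by blast
  have zj: "0 \<le> real_of_int (z j)" "real_of_int (z j) \<le> real X ^ (d - j)" if "j < d"
  proof -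
    have "0 \<le> z j" "z j < int X ^ (d - j)" using assms(4) that by (auto simp: offsets_def PiE_iff)
    then show "0 \<le> real_of_int (z j)" "real_of_int (z j) \<le> real X ^ (d - j)"
      by (simp, metis less_imp_le of_int_le_iff of_int_of_nat_eq of_int_power)
  qed
  have dj: "real X ^ d = real X ^ j * real X ^ (d - j)" using j by (simp flip: power_add)
  show ?thesis
  proof (cases "j = 0")
    case True
    then have "grid_point d X v z j = z j" using assms(1) by (simp add: grid_point_def)
    then show ?thesis using zj assms(1) True X by (simp add: field_simps)
  next
    case False
    have tX: "u ^ j \<le> (t * real X) ^ j" "(t * real X) ^ j \<le> u ^ j + 1"
    proof -
      have "u \<le> t * real X" using t X by (simp add: u_def)
      then show "u ^ j \<le> (t * real X) ^ j" using u by (intro power_mono) auto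
      have "(t * real X) ^ d \<le> (node d X (Suc v) * real X) ^ d"
        using t t0 X by (intro power_mono mult_right_mono) auto
      also have "\<dots> = u ^ d + 1" using node_pow(2)[OF assms(1,2), of "Suc v"] u by simp
      finally show "(t * real X) ^ j \<le> u ^ j + 1"
        using u t0 X False j by (intro power_increment_le[of u "t * real X" d j]) auto
    qed
    have g: "\<bar>u ^ j - real X ^ j * (grid_point d X v z j / real X ^ d)\<bar> \<le> 1"
    proof (cases "j = d")
      case True
      then have "grid_point d X v z j = int v" by (simp add: grid_point_def)
      then show ?thesis using True u X by simp
    next
      case jd: False
      then have "grid_point d X v z j = \<lfloor>u ^ j\<rfloor> * int X ^ (d - j) + z j"
        using False j by (simp add: grid_point_def u_def)
      then have "real X ^ j * (grid_point d X v z j / real X ^ d) = of_int \<lfloor>u ^ j\<rfloor> + z j / real X ^ (d - j)"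
        using X unfolding dj by (simp add: field_simps)
      moreover have "0 \<le> z j / real X ^ (d - j)" "z j / real X ^ (d - j) \<le> 1"
        using zj jd j X by (auto simp: divide_le_eq)
      ultimately show ?thesis by linarith
    qed
    have "real X ^ j * ((if j = 0 then 0 else t ^ j) - grid_point d X v z j / real X ^ d) =
        ((t * real X) ^ j - u ^ j) + (u ^ j - real X ^ j * (grid_point d X v z j / real X ^ d))"
      using False by (simp add: power_mult_distrib algebra_simps)
    then show ?thesis using tX g by linarith
  qed
qed

text \<open>Clipping the nodes at \<open>\<delta>\<close> gives a partition of \<open>{\<delta>..1}\<close> whose steps are short because
  the \<open>d\<close>-th powers of the nodes are equally spaced.\<close>

definition clipped_node :: "nat \<Rightarrow> nat \<Rightarrow> real \<Rightarrow> nat \<Rightarrow> real" where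
  "clipped_node d X \<delta> v = max \<delta> (node d X v)"

text \<open>Strictness in the last fact excludes pieces to the left of \<delta>: clipping collapses
  them to the point \<delta>, which need not lie between their nodes.\<close>

lemma clipped_node_props:
  assumes "d \<ge> 1" "X > 0" "0 < \<delta>" "\<delta> < 1"
  shows "clipped_node d X \<delta> 0 = \<delta>" "clipped_node d X \<delta> (X ^ d) = 1"
    "clipped_node d X \<delta> v \<le> clipped_node d X \<delta> (Suc v)"
    "clipped_node d X \<delta> (Suc v) - clipped_node d X \<delta> v \<le> \<delta> powr (1 - real d) / real X ^ d"
    "\<lbrakk>clipped_node d X \<delta> v < clipped_node d X \<delta> (Suc v); clipped_node d X \<delta> v \<le> t; t \<le> clipped_node d X \<delta> (Suc v)\<rbrakk>
       \<Longrightarrow> node d X v \<le> t \<and> t \<le> node d X (Suc v)"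
proof -
  have X: "real X ^ d > 0" using assms by simp
  show "clipped_node d X \<delta> 0 = \<delta>" "clipped_node d X \<delta> (X ^ d) = 1"
    using assms X by (simp_all add: clipped_node_def node_def)
  have mono: "node d X v \<le> node d X (Suc v)"
    using assms X by (simp add: node_def divide_right_mono)
  then show le: "clipped_node d X \<delta> v \<le> clipped_node d X \<delta> (Suc v)"
    by (auto simp: clipped_node_def)
  show "\<lbrakk>clipped_node d X \<delta> v < clipped_node d X \<delta> (Suc v); clipped_node d X \<delta> v \<le> t; t \<le> clipped_node d X \<delta> (Suc v)\<rbrakk>
       \<Longrightarrow> node d X v \<le> t \<and> t \<le> node d X (Suc v)"
    by (auto simp: clipped_node_def max_def split: if_splits)
  define x y where "x = clipped_node d X \<delta> v" and "y = clipped_node d X \<delta> (Suc v)"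
  have xy: "\<delta> \<le> x" "x \<le> y" using le by (auto simp: x_def y_def clipped_node_def)
  have "y ^ d \<le> x ^ d + 1 / real X ^ d"
  proof -
    have n: "node d X (Suc v) ^ d = node d X v ^ d + 1 / real X ^ d"
      using assms X by (simp add: node_def add_divide_distrib)
    have nx: "node d X v ^ d \<le> x ^ d"
      using node_pow(1)[OF assms(1,2)] by (intro power_mono) (auto simp: x_def clipped_node_def)
    have "\<delta> ^ d \<le> x ^ d" using xy assms by (intro power_mono) auto
    moreover have "0 \<le> 1 / real X ^ d" using X by simp
    moreover have "y ^ d = \<delta> ^ d \<or> y ^ d = node d X (Suc v) ^ d" by (auto simp: y_def clipped_node_def max_def)
    ultimately show ?thesis using n nx by linarith
  qed
  \<comment> \<open>To the right of \<delta> the \<open>d\<close>-th power expands distances at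
    least by \<delta>^(d - 1); this is the origin of the power of \<delta> in the theorem.\<close>
  moreover have "\<delta> ^ (d - 1) * (y - x) \<le> y ^ d - x ^ d"
  proof -
    have d: "d = Suc (d - 1)" using assms by simp
    have "\<delta> ^ (d - 1) * (y - x) \<le> y ^ (d - 1) * (y - x)"
      using xy assms by (intro mult_right_mono power_mono) auto
    also have "\<dots> = y ^ (d - 1) * y - y ^ (d - 1) * x" by (rule right_diff_distrib)
    finally have "\<delta> ^ (d - 1) * (y - x) \<le> y ^ (d - 1) * y - y ^ (d - 1) * x" .
    moreover have "y ^ (d - 1) * x \<ge> x ^ (d - 1) * x" using xy assms by (intro mult_right_mono power_mono) auto
    moreover have "x ^ (d - 1) * x = x ^ d" "y ^ (d - 1) * y = y ^ d"
      using d by (metis power_Suc2)+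
    ultimately show ?thesis by linarith
  qed
  ultimately have "\<delta> ^ (d - 1) * (y - x) \<le> 1 / real X ^ d" by linarith
  then have "y - x \<le> (1 / \<delta> ^ (d - 1)) / real X ^ d"
    using assms X by (simp add: field_simps)
  also have "1 / \<delta> ^ (d - 1) = \<delta> powr (1 - real d)"
  proof -
    have "\<delta> ^ (d - 1) = \<delta> powr (real d - 1)"
      using powr_realpow[of \<delta> "d - 1"] assms by (simp add: of_nat_diff)
    then show ?thesis using powr_minus_divide[of \<delta> "real d - 1"] by simp
  qed
  finally show "clipped_node d X \<delta> (Suc v) - clipped_node d X \<delta> v \<le> \<delta> powr (1 - real d) / real X ^ d"
    by (simp add: x_def y_def)
qed

lemma integral_partition:
  fixes f :: "real \<Rightarrow> real" and \<tau> :: "nat \<Rightarrow> real"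
  assumes "\<And>v. v < n \<Longrightarrow> \<tau> v \<le> \<tau> (Suc v)" "f integrable_on {\<tau> 0..\<tau> n}"
  shows "integral {\<tau> 0..\<tau> n} f = (\<Sum>v<n. integral {\<tau> v..\<tau> (Suc v)} f)"
  using assms
proof (induction n)
  case (Suc n)
  have le: "\<tau> 0 \<le> \<tau> n" using Suc.prems(1)
    by (intro lift_Suc_mono_le[of "\<lambda>v. \<tau> (min v (Suc n))" 0 n, simplified]) (auto simp: min_def le_Suc_eq)
  have "f integrable_on {\<tau> 0..\<tau> n}"
    by (rule integrable_subinterval_real[OF Suc.prems(2)]) (use Suc.prems(1)[of n] in auto)
  then have "integral {\<tau> 0..\<tau> n} f = (\<Sum>v<n. integral {\<tau> v..\<tau> (Suc v)} f)"
    using Suc by simp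
  moreover have "integral {\<tau> 0..\<tau> (Suc n)} f = integral {\<tau> 0..\<tau> n} f + integral {\<tau> n..\<tau> (Suc n)} f"
    using Suc.prems le by (intro Henstock_Kurzweil_Integration.integral_combine[symmetric]) auto
  ultimately show ?case by simp
qed simp

lemma continuous_e: "continuous_on S f \<Longrightarrow> continuous_on S (\<lambda>t. e (f t))"
  unfolding e_def by (rule continuous_intros | assumption)+

lemma continuous_curve_sum: "continuous_on S (\<lambda>t. curve_sum d a N t)"
  unfolding curve_sum_def
  by (rule continuous_on_sum, rule continuous_on_mult, rule continuous_on_const, rule continuous_e,
      rule continuous_on_sum, rule continuous_on_mult, rule continuous_on_power, rule continuous_on_id,
      rule continuous_on_const)

text \<open>The phase at \<open>t\<close> and the phase at a grid point of its box differ by a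
  polynomial in \<open>n / X\<close> with coefficients at most 2, so the perturbation series
  compares the sums with a constant depending on \<open>d\<close> alone.\<close>

lemma curve_sum_grid:
  fixes d :: nat
  assumes "d \<ge> 1"
  shows "\<exists>C>0. \<forall>X N K (a :: nat \<Rightarrow> complex) M v z t. X > 0 \<longrightarrow> N \<le> X \<longrightarrow> (\<forall>n\<in>{1..N}. norm (a n) \<le> M) \<longrightarrow> v < X ^ d \<longrightarrow>
    z \<in> offsets d X \<longrightarrow> node d X v \<le> t \<longrightarrow> t \<le> node d X (Suc v) \<longrightarrow>
    norm (curve_sum d a N t) \<le>
      C * (\<Sum>m<K. norm (expsum d (X ^ d) (\<lambda>n. a (nat n) * of_real ((real_of_int n / real X) ^ m)) (int ` {1..N}) (grid_point d X v z)) / 2 ^ m)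
        + 2 * C * N * M / 2 ^ K"
proof -
  obtain C where C: "C > 0" and perturb: "\<forall>N X K (a :: nat \<Rightarrow> complex) (\<theta> :: nat \<Rightarrow> real) \<phi> M h.
    X > 0 \<longrightarrow> real N \<le> X \<longrightarrow> (\<forall>n\<in>{1..N}. norm (a n) \<le> M) \<longrightarrow> (\<forall>j\<le>d. \<bar>h j\<bar> \<le> 2) \<longrightarrow>
    (\<forall>n\<in>{1..N}. \<phi> n = \<theta> n + (\<Sum>j\<le>d. h j * (real n / X) ^ j)) \<longrightarrow>
    norm (\<Sum>n=1..N. a n * e (\<phi> n)) \<le>
      C * (\<Sum>m<K. norm (\<Sum>n=1..N. a n * of_real ((real n / X) ^ m) * e (\<theta> n)) / 2 ^ m) + 2 * C * N * M / 2 ^ K"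
    using expsum_perturb[of d] by (elim exE conjE)
  show ?thesis
  proof (intro exI[of _ C] conjI allI impI C)
    fix X N K :: nat and a :: "nat \<Rightarrow> complex" and M :: real and v z t
    assume X: "X > 0" "N \<le> X" and a: "\<forall>n\<in>{1..N}. norm (a n) \<le> M" and v: "v < X ^ d" "z \<in> offsets d X"
      and t: "node d X v \<le> t" "t \<le> node d X (Suc v)"
    define y where "y = grid_point d X v z"
    define \<theta> where "\<theta> = (\<lambda>n. (\<Sum>j\<le>d. real_of_int (y j) * real n ^ j) / real X ^ d)"
    define h where "h = (\<lambda>j. real X ^ j * ((if j = 0 then 0 else t ^ j) - y j / real X ^ d))"
    define \<phi> where "\<phi> = (\<lambda>n. \<Sum>j=1..d. t ^ j * real n ^ j)"
    have "\<phi> n = \<theta> n + (\<Sum>j\<le>d. h j * (real n / real X) ^ j)" for n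
    proof -
      have "(\<Sum>j\<le>d. h j * (real n / real X) ^ j) = (\<Sum>j\<le>d. (if j = 0 then 0 else t ^ j) * real n ^ j - y j * real n ^ j / real X ^ d)"
        by (intro sum.cong refl) (use X in \<open>simp add: h_def power_divide left_diff_distrib\<close>)
      also have "\<dots> = (\<Sum>j\<le>d. (if j = 0 then 0 else t ^ j) * real n ^ j) - \<theta> n"
        by (simp add: sum_subtractf \<theta>_def sum_divide_distrib)
      also have "(\<Sum>j\<le>d. (if j = 0 then 0 else t ^ j) * real n ^ j) = \<phi> n"
        by (simp add: \<phi>_def atMost_atLeast0 sum.atLeast_Suc_atMost)
      finally show ?thesis by simp
    qed
    moreover have "\<bar>h j\<bar> \<le> 2" if "j \<le> d" for j
      unfolding h_def y_def by (rule grid_point_close[OF assms X(1) v t that])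
    ultimately have "norm (\<Sum>n=1..N. a n * e (\<phi> n)) \<le>
      C * (\<Sum>m<K. norm (\<Sum>n=1..N. a n * of_real ((real n / real X) ^ m) * e (\<theta> n)) / 2 ^ m) + 2 * C * N * M / 2 ^ K"
      using X a by (intro perturb[rule_format]) auto
    moreover have "(\<Sum>n=1..N. a n * e (\<phi> n)) = curve_sum d a N t"
      by (simp add: curve_sum_def \<phi>_def)
    moreover have "(\<Sum>n=1..N. a n * of_real ((real n / real X) ^ m) * e (\<theta> n)) =
        expsum d (X ^ d) (\<lambda>n. a (nat n) * of_real ((real_of_int n / real X) ^ m)) (int ` {1..N}) y" for m
      by (simp add: expsum_def sum.reindex chi_def \<theta>_def)
    ultimately show "norm (curve_sum d a N t) \<le>
      C * (\<Sum>m<K. norm (expsum d (X ^ d) (\<lambda>n. a (nat n) * of_real ((real_of_int n / real X) ^ m)) (int ` {1..N}) (grid_point d X v z)) / 2 ^ m)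
        + 2 * C * N * M / 2 ^ K"
      by (simp only: y_def)
  qed
qed

section \<open>Moments along the curve at the critical exponent\<close>

context prime_scale begin

lemma curve_moment:
  assumes d: "d \<ge> 2" "d < p" and eps: "\<epsilon> > 0"
  defines "r \<equiv> d * (d + 1) div 2"
  shows "\<exists>C\<ge>1. \<forall>B N a M \<delta>. N \<le> p ^ B \<longrightarrow> M \<ge> 1 \<longrightarrow> (\<forall>n\<in>{1..N}. norm (a n) \<le> M) \<longrightarrow> 0 < \<delta> \<longrightarrow> \<delta> < 1 \<longrightarrow>
    integral {\<delta>..1} (\<lambda>t. norm (curve_sum d a N t) ^ r) \<le>
      C * M ^ r * \<delta> powr ((1 - real d) / 2) * p powr (B * (real r - real d / 2 + \<epsilon>))"
proof -
  have d1: "d \<ge> 1" using d by simp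
  have r2: "2 * r = d * (d + 1)" by (simp add: r_def)
  then have rr: "2 * real r = real (d * (d + 1))" by (metis of_nat_mult of_nat_numeral)
  have sq: "(u ^ r)\<^sup>2 = u ^ (d * (d + 1))" for u :: real
    by (simp only: r2[symmetric] power_even_eq)
  have rd: "r \<ge> d" "r \<ge> 2"
  proof -
    have "d * 2 \<le> 2 * r" unfolding r2 using d by (intro mult_left_mono) auto
    then show "r \<ge> d" by simp
    then show "r \<ge> 2" using d by simp
  qed
  obtain Cp where Cp: "Cp > 0" and grid: "\<forall>X N K (a :: nat \<Rightarrow> complex) M v z t. X > 0 \<longrightarrow> N \<le> X \<longrightarrow> (\<forall>n\<in>{1..N}. norm (a n) \<le> M) \<longrightarrow> v < X ^ d \<longrightarrow>
    z \<in> offsets d X \<longrightarrow> node d X v \<le> t \<longrightarrow> t \<le> node d X (Suc v) \<longrightarrow>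
    norm (curve_sum d a N t) \<le>
      Cp * (\<Sum>m<K. norm (expsum d (X ^ d) (\<lambda>n. a (nat n) * of_real ((real_of_int n / real X) ^ m)) (int ` {1..N}) (grid_point d X v z)) / 2 ^ m)
        + 2 * Cp * N * M / 2 ^ K"
    using curve_sum_grid[OF d1] by (elim exE conjE)
  have eps2: "2 * \<epsilon> > 0" using eps by simp
  obtain Cv where Cv: "Cv \<ge> 1" and vmv: "\<forall>B A (c :: int \<Rightarrow> complex) M. M \<ge> 0 \<longrightarrow> A \<subseteq> {1..int p ^ B} \<longrightarrow> (\<forall>n\<in>A. norm (c n) \<le> M) \<longrightarrow>
    moment d (d * B) (d * (d + 1)) c A \<le>
      Cv * p powr (B * (real (d * (d + 1)) / 2 + 2 * \<epsilon>)) * M ^ (d * (d + 1)) * real (p ^ (d * B)) ^ (d + 1)"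
    using vinogradov_mean_value[OF d1 d(2) eps2] by (elim exE conjE)
  define C1 where "C1 = 2 ^ r * (Cp ^ r * 2 ^ r + 1)"
  have C1: "C1 \<ge> 1"
    unfolding C1_def using Cp mult_mono[of 1 "2 ^ r" 1 "Cp ^ r * 2 ^ r + 1"] by simp
  show ?thesis
  proof (intro exI[of _ "C1 * (1 + 2 * Cv)"] conjI allI impI)
    show "1 \<le> C1 * (1 + 2 * Cv)" using C1 Cv mult_mono[of 1 C1 1 "1 + 2 * Cv"] by simp
  next
    fix B N :: nat and a :: "nat \<Rightarrow> complex" and M \<delta> :: real
    assume N: "N \<le> p ^ B" and M: "M \<ge> 1" and a: "\<forall>n\<in>{1..N}. norm (a n) \<le> M" and \<delta>: "0 < \<delta>" "\<delta> < 1"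
    define X where "X = p ^ B"
    have X: "X > 0" "N \<le> X" using N by (simp_all add: X_def)
    have Xd: "p ^ (d * B) = X ^ d" by (simp add: X_def mult.commute flip: power_mult)
    define A where "A = int ` {1..N}"
    define b where "b = (\<lambda>m n. a (nat n) * of_real ((real_of_int n / real X) ^ m))"
    define x where "x = (\<lambda>m v z. norm (expsum d (X ^ d) (b m) A (grid_point d X v z)))"
    have x0: "x m v z \<ge> 0" for m v z by (simp add: x_def)
    define Z where "Z = real X ^ r"
    have Z: "Z > 0" "real (card (offsets d X)) = Z" using X by (simp_all add: Z_def card_offsets r_def)
    \<comment> \<open>Makes the truncation error less than 1. That \<open>K\<close> depends on
      \<open>N\<close> is harmless, since the weights \<open>1 / 2 ^ m\<close> keep later bounds
      free of it.\<close>
    obtain K where K: "2 * Cp * N * M < 2 ^ K" using real_arch_pow[of 2] by auto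
    define H where "H = (\<lambda>v. (\<Sum>z\<in>offsets d X. \<Sum>m<K. x m v z ^ r / 2 ^ m) / Z)"
    have H0: "H v \<ge> 0" for v using Z x0 by (auto simp: H_def intro!: divide_nonneg_pos sum_nonneg)
    define \<tau> where "\<tau> = clipped_node d X \<delta>"
    note \<tau> = clipped_node_props[OF d1 X(1) \<delta>, folded \<tau>_def]
    define D where "D = (\<lambda>v. \<tau> (Suc v) - \<tau> v)"
    have D0: "D v \<ge> 0" for v using \<tau>(3)[of v] by (simp add: D_def)
    define f where "f = (\<lambda>t. norm (curve_sum d a N t) ^ r)"
    have cont: "continuous_on S f" for S unfolding f_def by (rule continuous_on_power, rule continuous_on_norm, rule continuous_curve_sum)
    \<comment> \<open>The comparison holds at every point of the box, so it may be averaged over the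
      box; this brings all its \<open>Z\<close> grid points into play.\<close>
    have pw: "f t \<le> C1 * (1 + H v)"
      if v: "v < X ^ d" and t: "node d X v \<le> t" "t \<le> node d X (Suc v)" for v t
    proof -
      have one: "f t \<le> C1 * (1 + (\<Sum>m<K. x m v z ^ r / 2 ^ m))" if z: "z \<in> offsets d X" for z
      proof -
        define T where "T = (\<Sum>m<K. x m v z / 2 ^ m)"
        have T: "T \<ge> 0" using x0 by (simp add: T_def sum_nonneg)
        have "norm (curve_sum d a N t) \<le> Cp * T + 2 * Cp * N * M / 2 ^ K"
          unfolding T_def x_def A_def b_def by (rule grid[rule_format, OF X _ v z t]) (use a in auto)
        also have "2 * Cp * N * M / 2 ^ K \<le> 1" using K by simp
        finally have "norm (curve_sum d a N t) \<le> 2 * max (Cp * T) 1" by linarith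
        then have "f t \<le> (2 * max (Cp * T) 1) ^ r" unfolding f_def by (intro power_mono) auto
        also have "\<dots> = 2 ^ r * max (Cp * T) 1 ^ r" by (simp add: power_mult_distrib)
        also have "max (Cp * T) 1 ^ r \<le> (Cp * T) ^ r + 1"
          using T Cp by (auto simp: max_def)
        also have "(Cp * T) ^ r + 1 \<le> Cp ^ r * (2 ^ r * (\<Sum>m<K. x m v z ^ r / 2 ^ m)) + 1"
          unfolding power_mult_distrib T_def using Cp sum_halves_power_le[OF x0 rd(2)]
          by (intro add_mono mult_left_mono) auto
        also have "\<dots> \<le> (Cp ^ r * 2 ^ r + 1) * (1 + (\<Sum>m<K. x m v z ^ r / 2 ^ m))"
        proof -
          have "0 \<le> (\<Sum>m<K. x m v z ^ r / 2 ^ m)" "0 \<le> Cp ^ r * 2 ^ r"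
            using x0 Cp by (auto intro!: sum_nonneg)
          then show ?thesis by (simp add: algebra_simps)
        qed
        finally show ?thesis by (simp add: C1_def mult.assoc)
      qed
      have "Z * f t = (\<Sum>z\<in>offsets d X. f t)" using Z by simp
      also have "\<dots> \<le> (\<Sum>z\<in>offsets d X. C1 * (1 + (\<Sum>m<K. x m v z ^ r / 2 ^ m)))"
        by (intro sum_mono one)
      also have "\<dots> = C1 * (Z + (\<Sum>z\<in>offsets d X. \<Sum>m<K. x m v z ^ r / 2 ^ m))"
        using Z by (simp add: sum.distrib flip: sum_distrib_left)
      also have "\<dots> = Z * (C1 * (1 + H v))" using Z by (simp add: H_def field_simps)
      finally show ?thesis using Z by simp
    qed
    have step: "integral {\<tau> v..\<tau> (Suc v)} f \<le> C1 * (1 + H v) * D v" if v: "v < X ^ d" for v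
    proof (cases "\<tau> v < \<tau> (Suc v)")
      case True
      have "integral {\<tau> v..\<tau> (Suc v)} f \<le> integral {\<tau> v..\<tau> (Suc v)} (\<lambda>_. C1 * (1 + H v))"
        using \<tau>(5)[OF True] v
        by (intro integral_le integrable_continuous_real cont continuous_intros pw) auto
      then show ?thesis using True by (simp add: D_def algebra_simps)
    next
      case False
      then have "\<tau> (Suc v) = \<tau> v" using \<tau>(3)[of v] by simp
      then show ?thesis by (simp add: D_def)
    qed
    define L where "L = \<delta> powr (1 - real d) / real X ^ d"
    have L0: "L \<ge> 0" by (simp add: L_def)
    have sumD: "(\<Sum>v<X ^ d. D v) \<le> 1"
    proof -
      have "(\<Sum>v<X ^ d. D v) = \<tau> (X ^ d) - \<tau> 0" unfolding D_def by (rule sum_lessThan_telescope)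
      then show ?thesis using \<tau>(1,2) \<delta> by simp
    qed
    define W where "W = M ^ r * \<delta> powr ((1 - real d) / 2) * p powr (B * (real r - real d / 2 + \<epsilon>))"
    let ?V = "Cv * p powr (B * (real (d * (d + 1)) / 2 + 2 * \<epsilon>)) * M ^ (d * (d + 1)) * real (X ^ d) ^ (d + 1)"
    let ?S = "\<lambda>m. \<Sum>v<X ^ d. \<Sum>z\<in>offsets d X. D v * x m v z ^ r"
    let ?DH = "\<Sum>v<X ^ d. D v * H v"
    have W1: "W \<ge> 1"
    proof -
      have "1 \<le> M ^ r" using M by simp
      moreover have "1 \<le> \<delta> powr ((1 - real d) / 2)"
        using powr_mono'[of "(1 - real d) / 2" 0 \<delta>] \<delta> d by simp
      moreover have "1 \<le> p powr (B * (real r - real d / 2 + \<epsilon>))"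
        by (rule ge_one_powr_ge_zero) (use rd eps in auto)
      ultimately show ?thesis unfolding W_def
        using mult_mono[of 1 "M ^ r * \<delta> powr ((1 - real d) / 2)" 1] mult_mono[of 1 "M ^ r" 1 "\<delta> powr ((1 - real d) / 2)"]
        by simp
    qed
    \<comment> \<open>All lengths are at most \<open>L\<close> and they add up to at most 1, so
      their squares add up to at most \<open>L\<close>: this yields the power of \<delta> and the
      saving X^(-d/2). The other factor is extended from the disjoint boxes to the whole
      grid.\<close>
    have CS: "?S m \<le> Z * (Cv * W)" for m
    proof (rule power2_le_imp_le)
      define I where "I = {..<X ^ d} \<times> offsets d X"
      have "?S m = (\<Sum>(v, z)\<in>I. D v * x m v z ^ r)"
        unfolding I_def by (simp add: sum.cartesian_product)
      then have "(?S m)\<^sup>2 = (\<Sum>i\<in>I. D (fst i) * x m (fst i) (snd i) ^ r)\<^sup>2"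
        by (simp add: case_prod_unfold)
      also have "\<dots> \<le> (\<Sum>i\<in>I. (D (fst i))\<^sup>2) * (\<Sum>i\<in>I. (x m (fst i) (snd i) ^ r)\<^sup>2)"
        by (rule Cauchy_Schwarz_ineq_sum)
      also have "\<dots> \<le> (Z * L) * (?V)"
      proof (rule mult_mono)
        have "(\<Sum>i\<in>I. (D (fst i))\<^sup>2) = (\<Sum>v<X ^ d. \<Sum>z\<in>offsets d X. (D v)\<^sup>2)"
          unfolding I_def sum.cartesian_product by (simp only: case_prod_unfold)
        also have "\<dots> = Z * (\<Sum>v<X ^ d. (D v)\<^sup>2)" using Z by (simp flip: sum_distrib_left)
        also have "(\<Sum>v<X ^ d. (D v)\<^sup>2) \<le> (\<Sum>v<X ^ d. L * D v)"
          unfolding power2_eq_square using \<tau>(4) D0 by (intro sum_mono mult_right_mono) (auto simp: D_def L_def)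
        also have "\<dots> \<le> L * 1" unfolding sum_distrib_left[symmetric] by (intro mult_left_mono sumD L0)
        finally show "(\<Sum>i\<in>I. (D (fst i))\<^sup>2) \<le> Z * L" using Z by simp
        have "(\<Sum>i\<in>I. (x m (fst i) (snd i) ^ r)\<^sup>2) = (\<Sum>i\<in>I. norm (expsum d (X ^ d) (b m) A ((\<lambda>(v, z). grid_point d X v z) i)) ^ (d * (d + 1)))"
          by (simp only: x_def case_prod_unfold sq)
        also have "\<dots> = (\<Sum>y\<in>(\<lambda>(v, z). grid_point d X v z) ` I. norm (expsum d (X ^ d) (b m) A y) ^ (d * (d + 1)))"
          by (rule sum.reindex[symmetric, unfolded o_def]) (rule inj_on_subset[OF inj_grid_point], auto simp: I_def)
        also have "\<dots> \<le> (\<Sum>y\<in>freqs d (X ^ d). norm (expsum d (X ^ d) (b m) A y) ^ (d * (d + 1)))"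
          using grid_point_freqs[OF d1 X(1)] by (intro sum_mono2) (auto simp: I_def)
        also have "\<dots> = moment d (d * B) (d * (d + 1)) (b m) A" by (simp only: moment_def Xd)
        also have "\<dots> \<le> Cv * p powr (B * (real (d * (d + 1)) / 2 + 2 * \<epsilon>)) * M ^ (d * (d + 1)) * real (p ^ (d * B)) ^ (d + 1)"
        proof (intro vmv[THEN spec, THEN spec, THEN spec, THEN spec, THEN mp, THEN mp, THEN mp])
          show "A \<subseteq> {1..int p ^ B}"
            using N unfolding A_def by (auto simp flip: of_nat_power)
          show "\<forall>n\<in>A. norm (b m n) \<le> M"
          proof
            fix n assume "n \<in> A"
            then obtain i where i: "n = int i" "i \<in> {1..N}" by (auto simp: A_def)
            have "norm (a i) * (real i / real X) ^ m \<le> M * 1"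
              using a i X M by (intro mult_mono power_le_one) auto
            then show "norm (b m n) \<le> M" by (simp add: b_def i norm_mult norm_divide norm_power)
          qed
        qed (use M in simp)
        finally show "(\<Sum>i\<in>I. (x m (fst i) (snd i) ^ r)\<^sup>2) \<le> ?V"
          by (simp only: Xd)
      qed (use Z L0 in \<open>auto intro!: sum_nonneg\<close>)
      also have "\<dots> = Z\<^sup>2 * (Cv * W\<^sup>2)"
      proof -
        define lp where "lp = ln (real p)"
        have Xp: "real X = p powr B" by (simp add: X_def powr_realpow)
        have Xpow: "real X ^ i = p powr (real i * B)" for i
          by (simp add: Xp powr_power mult.commute)
        have W2: "W\<^sup>2 = M ^ (d * (d + 1)) * \<delta> powr (1 - real d) * p powr (B * (2 * real r - real d + 2 * \<epsilon>))"
        proof -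
          have "(\<delta> powr ((1 - real d) / 2))\<^sup>2 = \<delta> powr (1 - real d)"
            by (simp add: power2_eq_square flip: powr_add)
          moreover have "(p powr (B * (real r - real d / 2 + \<epsilon>)))\<^sup>2 = p powr (B * (2 * real r - real d + 2 * \<epsilon>))"
            by (simp add: power2_eq_square algebra_simps flip: powr_add)
          moreover have "(M ^ r)\<^sup>2 = M ^ (d * (d + 1))" by (rule sq)
          ultimately show ?thesis unfolding W_def by (simp only: power_mult_distrib)
        qed
        have e1: "real (X ^ d) ^ (d + 1) = p powr (2 * real r * B)"
        proof -
          have "real (X ^ d) ^ (d + 1) = real X ^ (2 * r)" unfolding r2 by (simp only: of_nat_power power_mult)
          then show ?thesis by (simp add: Xpow)
        qed
        have e2: "real (d * (d + 1)) / 2 = real r" using rr by simp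
        have "(Z * L) * (?V) =
           Cv * M ^ (d * (d + 1)) * \<delta> powr (1 - real d) *
             (p powr (real r * B) * p powr (- (real d * B)) * p powr (B * (real r + 2 * \<epsilon>)) * p powr (2 * real r * B))"
          unfolding e1 e2 Z_def L_def Xpow by (simp add: powr_minus_divide mult_ac)
        also have "p powr (real r * B) * p powr (- (real d * B)) * p powr (B * (real r + 2 * \<epsilon>)) * p powr (2 * real r * B) =
            p powr (2 * real r * B) * p powr (B * (2 * real r - real d + 2 * \<epsilon>))"
          by (simp add: algebra_simps flip: powr_add)
        also have "p powr (2 * real r * B) = Z\<^sup>2"
          unfolding Z_def Xpow by (simp add: power2_eq_square algebra_simps flip: powr_add)
        finally show ?thesis unfolding W2 by (simp only: mult_ac)
      qed
      \<comment> \<open>As \<open>Cv \<ge> 1\<close>, replacing it by its square makes the right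
        side a perfect square.\<close>
      also have "\<dots> \<le> Z\<^sup>2 * (Cv\<^sup>2 * W\<^sup>2)"
        using Cv by (intro mult_left_mono mult_right_mono) (auto simp: power2_eq_square)
      finally show "(?S m)\<^sup>2 \<le> (Z * (Cv * W))\<^sup>2"
        by (simp add: power_mult_distrib)
    qed (use Z Cv W1 in simp)
    have "?DH \<le> 2 * Cv * W"
    proof -
      have "Z * ?DH = (\<Sum>v<X ^ d. D v * (Z * H v))"
        unfolding sum_distrib_left by (intro sum.cong refl mult.left_commute)
      also have "\<dots> = (\<Sum>v<X ^ d. D v * (\<Sum>z\<in>offsets d X. \<Sum>m<K. x m v z ^ r / 2 ^ m))"
        using Z(1) by (simp add: H_def)
      also have "\<dots> = (\<Sum>v<X ^ d. \<Sum>z\<in>offsets d X. \<Sum>m<K. D v * x m v z ^ r / 2 ^ m)"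
        by (simp add: sum_distrib_left)
      also have "\<dots> = (\<Sum>v<X ^ d. \<Sum>m<K. \<Sum>z\<in>offsets d X. D v * x m v z ^ r / 2 ^ m)"
        by (rule sum.cong[OF refl], rule sum.swap)
      also have "\<dots> = (\<Sum>m<K. ?S m / 2 ^ m)"
        by (subst sum.swap) (simp add: sum_divide_distrib)
      also have "\<dots> \<le> (\<Sum>m<K. Z * (Cv * W) / 2 ^ m)"
        by (intro sum_mono divide_right_mono CS) simp
      also have "\<dots> = Z * (Cv * W) * (\<Sum>m<K. (1 / 2) ^ m)"
        by (simp add: sum_distrib_left power_one_over)
      also have "(\<Sum>m<K. (1 / 2) ^ m) \<le> (2::real)" by (subst sum_gp_strict) auto
      finally have "Z * ?DH \<le> Z * (Cv * W) * 2" using Z Cv W1 by (simp add: mult_left_mono)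
      then show ?thesis using Z by simp
    qed
    moreover have "integral {\<delta>..1} f \<le> C1 * ((\<Sum>v<X ^ d. D v) + ?DH)"
    proof -
      have "integral {\<delta>..1} f = integral {\<tau> 0..\<tau> (X ^ d)} f" by (simp add: \<tau>)
      also have "\<dots> = (\<Sum>v<X ^ d. integral {\<tau> v..\<tau> (Suc v)} f)"
        by (rule integral_partition) (auto intro: \<tau> integrable_continuous_real cont)
      also have "\<dots> \<le> (\<Sum>v<X ^ d. C1 * (1 + H v) * D v)" by (intro sum_mono step) simp
      also have "\<dots> = C1 * ((\<Sum>v<X ^ d. D v) + ?DH)"
        by (simp add: sum_distrib_left sum.distrib algebra_simps)
      finally show ?thesis .
    qed
    ultimately have "integral {\<delta>..1} f \<le> C1 * (W + 2 * Cv * W)"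
    proof -
      assume h: "?DH \<le> 2 * Cv * W"
        "integral {\<delta>..1} f \<le> C1 * ((\<Sum>v<X ^ d. D v) + ?DH)"
      note h(2)
      also have "C1 * ((\<Sum>v<X ^ d. D v) + ?DH) \<le> C1 * (W + 2 * Cv * W)"
        using sumD W1 C1 h(1) by (intro mult_left_mono) auto
      finally show ?thesis .
    qed
    also have "\<dots> = C1 * (1 + 2 * Cv) * W" by (simp add: algebra_simps)
    finally show "integral {\<delta>..1} (\<lambda>t. norm (curve_sum d a N t) ^ r) \<le>
      C1 * (1 + 2 * Cv) * M ^ r * \<delta> powr ((1 - real d) / 2) * p powr (B * (real r - real d / 2 + \<epsilon>))"
      by (simp only: f_def W_def mult.assoc)
  qed
qed

end

section \<open>Subpolynomial coefficients, general \<open>N\<close> and general exponents\<close>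

lemma subpolynomial_bound:
  assumes "subpolynomial a" "\<epsilon> > 0"
  shows "\<exists>A\<ge>1. \<forall>N. \<forall>n\<in>{1..N}. norm (a n) \<le> A * real N powr \<epsilon>"
proof -
  obtain n0 where n0: "\<And>n. n \<ge> n0 \<Longrightarrow> norm (a n) \<le> real n powr \<epsilon>"
    using assms unfolding subpolynomial_def eventually_sequentially by blast
  define A where "A = 1 + (\<Sum>n<n0. norm (a n))"
  have A: "A \<ge> 1" by (simp add: A_def sum_nonneg)
  have "norm (a n) \<le> A * real N powr \<epsilon>" if n: "n \<in> {1..N}" for N n
  proof (cases "n \<ge> n0")
    case True
    have "norm (a n) \<le> real n powr \<epsilon>" by (rule n0[OF True])
    also have "\<dots> \<le> real N powr \<epsilon>" using n assms by (intro powr_mono2) auto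
    also have "\<dots> \<le> A * real N powr \<epsilon>" using mult_right_mono[OF A, of "real N powr \<epsilon>"] by simp
    finally show ?thesis .
  next
    case False
    have "norm (a n) \<le> (\<Sum>n<n0. norm (a n))" using False by (intro member_le_sum) auto
    also have "\<dots> \<le> A * 1" by (simp add: A_def)
    also have "\<dots> \<le> A * real N powr \<epsilon>"
      using n assms A by (intro mult_left_mono ge_one_powr_ge_zero) auto
    finally show ?thesis .
  qed
  then show ?thesis using A by blast
qed

lemma critical_moment:
  assumes d: "d \<ge> 2" and a: "subpolynomial a" and eps: "\<epsilon> > 0"
  defines "r \<equiv> d * (d + 1) div 2"
  shows "\<exists>C\<ge>1. \<forall>N \<delta>. N \<ge> 1 \<longrightarrow> 0 < \<delta> \<longrightarrow> \<delta> < 1 \<longrightarrow>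
    integral {\<delta>..1} (\<lambda>t. norm (curve_sum d a N t) ^ r) \<le>
      C * \<delta> powr ((1 - real d) / 2) * real N powr (real r - real d / 2 + \<epsilon>)"
proof -
  \<comment> \<open>Of the \<open>r + 1\<close> shares of \<epsilon>, \<open>r\<close> pay for
    \<open>M ^ r\<close> and one for the curve moment.\<close>
  define \<epsilon>1 where "\<epsilon>1 = \<epsilon> / (real r + 1)"
  have "real r + 1 > 0" by simp
  then have e1: "\<epsilon>1 > 0" "real r * \<epsilon>1 + \<epsilon>1 = \<epsilon>"
    using eps distrib_right[of "real r" 1 \<epsilon>1] by (simp_all add: \<epsilon>1_def)
  obtain p where p: "prime p" "p > max d 8" using bigger_prime by blast
  interpret prime_scale p by unfold_locales (use p in auto)
  have dp: "d < p" using p by simp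
  obtain C where C: "C \<ge> 1" and mom: "\<forall>B N a M \<delta>. N \<le> p ^ B \<longrightarrow> M \<ge> 1 \<longrightarrow> (\<forall>n\<in>{1..N}. norm (a n) \<le> M) \<longrightarrow> 0 < \<delta> \<longrightarrow> \<delta> < 1 \<longrightarrow>
    integral {\<delta>..1} (\<lambda>t. norm (curve_sum d a N t) ^ r) \<le>
      C * M ^ r * \<delta> powr ((1 - real d) / 2) * p powr (B * (real r - real d / 2 + \<epsilon>1))"
    using curve_moment[OF d dp e1(1), folded r_def] by (elim exE conjE)
  obtain A where A1: "A \<ge> 1" and A2: "\<forall>N. \<forall>n\<in>{1..N}. norm (a n) \<le> A * real N powr \<epsilon>1"
    using subpolynomial_bound[OF a e1(1)] by (elim exE conjE)
  note A = A1 A2[rule_format]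
  define \<kappa> where "\<kappa> = real r - real d / 2 + \<epsilon>1"
  have \<kappa>: "\<kappa> \<ge> 0"
  proof -
    have "d * 2 \<le> d * (d + 1)" using d by (intro mult_left_mono) auto
    then have "d \<le> r" unfolding r_def by linarith
    then show ?thesis using e1 by (simp add: \<kappa>_def)
  qed
  define C' where "C' = C * A ^ r * p powr \<kappa>"
  show ?thesis
  proof (intro exI[of _ C'] conjI allI impI)
    have "1 * 1 * 1 \<le> C' "
      unfolding C'_def using C A(1) \<kappa> by (intro mult_mono one_le_power ge_one_powr_ge_zero) auto
    then show "1 \<le> C'" by simp
  next
    fix N :: nat and \<delta> :: real assume N: "N \<ge> 1" and \<delta>: "0 < \<delta>" "\<delta> < 1"
    let ?I = "integral {\<delta>..1} (\<lambda>t. norm (curve_sum d a N t) ^ r)"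
    let ?D = "\<delta> powr ((1 - real d) / 2)"
    define M where "M = A * real N powr \<epsilon>1"
    have "1 * 1 \<le> M" unfolding M_def using A(1) N e1 by (intro mult_mono ge_one_powr_ge_zero) auto
    then have M: "M \<ge> 1" by simp
    have ex: "\<exists>B. N \<le> p ^ B"
    proof
      have "N < 2 ^ N" by simp
      also have "(2::nat) ^ N \<le> p ^ N" using p by (intro power_mono) auto
      finally show "N \<le> p ^ N" by simp
    qed
    \<comment> \<open>Minimality gives \<open>p ^ B \<le> p * N\<close>, so rounding up costs the
      constant \<open>p powr \<kappa>\<close>.\<close>
    define B where "B = (LEAST B. N \<le> p ^ B)"
    have B: "N \<le> p ^ B" unfolding B_def using ex by (rule LeastI_ex)
    have B': "p ^ B \<le> p * N"
    proof (cases B)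
      case 0
      have "1 * 1 \<le> p * N" using N by (intro mult_mono) auto
      then show ?thesis using 0 by simp
    next
      case (Suc b)
      then have "\<not> N \<le> p ^ b" using not_less_Least[of b "\<lambda>B. N \<le> p ^ B"] by (simp add: B_def)
      then show ?thesis using Suc by simp
    qed
    have "?I \<le>
      C * M ^ r * ?D * p powr (B * \<kappa>)"
      unfolding \<kappa>_def by (rule mom[THEN spec, THEN spec, THEN spec, THEN spec, THEN spec, THEN mp, THEN mp, THEN mp, THEN mp, THEN mp])
        (use B M A(2) \<delta> in \<open>auto simp: M_def\<close>)
    moreover have "p powr (B * \<kappa>) \<le> p powr \<kappa> * real N powr \<kappa>"
    proof -
      have "p powr (B * \<kappa>) = real (p ^ B) powr \<kappa>" by (simp add: powr_powr flip: powr_realpow)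
      also have "\<dots> \<le> real (p * N) powr \<kappa>" using B' \<kappa> by (intro powr_mono2) (auto simp del: of_nat_power of_nat_mult)
      also have "\<dots> = p powr \<kappa> * real N powr \<kappa>" by (simp add: powr_mult)
      finally show ?thesis .
    qed
    then have "C * M ^ r * ?D * p powr (B * \<kappa>) \<le>
        C * M ^ r * ?D * (p powr \<kappa> * real N powr \<kappa>)"
      using C M by (intro mult_left_mono) auto
    moreover have "M ^ r = A ^ r * real N powr (real r * \<epsilon>1)"
      using N by (simp add: M_def power_mult_distrib powr_power mult.commute)
    ultimately have "?I \<le>
      C * (A ^ r * real N powr (real r * \<epsilon>1)) * ?D * (p powr \<kappa> * real N powr \<kappa>)"
      by simp
    also have "\<dots> = C' * ?D * (real N powr (real r * \<epsilon>1) * real N powr \<kappa>)"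
      by (simp add: C'_def mult_ac)
    also have "real N powr (real r * \<epsilon>1) * real N powr \<kappa> = real N powr (real r - real d / 2 + \<epsilon>)"
      unfolding powr_add[symmetric] \<kappa>_def e1(2)[symmetric] by (simp add: algebra_simps)
    finally show "?I \<le>
      C' * ?D * real N powr (real r - real d / 2 + \<epsilon>)" .
  qed
qed

theorem theorem2p14:
  fixes d :: nat and a :: "nat \<Rightarrow> complex" and s :: real
  assumes "d \<ge> 2"
    and "subpolynomial a"
    and "s \<ge> 1"
  shows "\<forall>\<epsilon>>0. \<forall>\<^sub>F N in sequentially. \<forall>\<delta>::real. 0 < \<delta> \<and> \<delta> < 1 \<and> real N > 1 / \<delta> \<longrightarrow>
           integral {\<delta>..1} (\<lambda>t. norm (curve_sum d a N t) powr (2 * s))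
             \<le> \<delta> powr ((1 - real d) / 2)
                 * (real N powr s + real N powr (2 * s - crit_exp d / 2))
                 * real N powr (crit_exp d / 2 - real d / 2 + \<epsilon>)"
proof (intro allI impI)
  fix \<epsilon> :: real assume eps: "\<epsilon> > 0"
  let ?bound = "\<lambda>N \<delta>. integral {\<delta>..1} (\<lambda>t. norm (curve_sum d a N t) powr (2 * s))
    \<le> \<delta> powr ((1 - real d) / 2) * (real N powr s + real N powr (2 * s - crit_exp d / 2)) * real N powr (crit_exp d / 2 - real d / 2 + \<epsilon>)"

  define r where "r = d * (d + 1) div 2"
  have r2: "2 * r = d * (d + 1)" by (simp add: r_def)
  then have "2 * real r = real (d * (d + 1))" by (metis of_nat_mult of_nat_numeral)
  then have crit: "crit_exp d = real r" by (simp add: crit_exp_def algebra_simps)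
  have rd: "r \<ge> d" "r > 0"
  proof -
    have "d * 2 \<le> 2 * r" unfolding r2 using assms(1) by (intro mult_left_mono) auto
    then show "r \<ge> d" "r > 0" using assms(1) by auto
  qed
  have "\<epsilon> / 4 > 0" using eps by simp
  from critical_moment[OF assms(1,2) this, folded r_def]
  obtain C where C: "C \<ge> 1" and mom: "\<forall>N \<delta>. N \<ge> 1 \<longrightarrow> 0 < \<delta> \<longrightarrow> \<delta> < 1 \<longrightarrow>
    integral {\<delta>..1} (\<lambda>t. norm (curve_sum d a N t) ^ r) \<le>
      C * \<delta> powr ((1 - real d) / 2) * real N powr (real r - real d / 2 + \<epsilon> / 4)"
    by (elim exE conjE)
  \<comment> \<open>The trivial bound will be raised to the power \<open>2 * s - r\<close>; this
    choice keeps its loss below \<epsilon> / 4. The constant \<open>K\<close> that follows is free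
    of \<delta>, so absorbing it into \<open>N powr (\<epsilon> / 2)\<close> is uniform in
    \<delta>.\<close>
  define \<epsilon>1 where "\<epsilon>1 = \<epsilon> / (4 * (2 * s + 1))"
  have "\<epsilon> / (4 * x) * x = \<epsilon> / 4" if "x > 0" for x using that by simp
  from this[of "2 * s + 1"] have e1: "\<epsilon>1 > 0" "\<epsilon>1 * (2 * s + 1) = \<epsilon> / 4"
    using eps assms(3) by (simp add: \<epsilon>1_def, simp only: \<epsilon>1_def)
  obtain A where A1: "A \<ge> 1" and A2: "\<forall>N. \<forall>n\<in>{1..N}. norm (a n) \<le> A * real N powr \<epsilon>1"
    using subpolynomial_bound[OF assms(2) e1(1)] by (elim exE conjE)
  note A = A1 A2[rule_format]
  define K where "K = A powr (2 * s - r) * C + 1 + C"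
  have K: "K > 0" using C by (simp add: K_def add_nonneg_pos)
  have "eventually (\<lambda>N. K \<le> real N powr (\<epsilon> / 2)) sequentially"
    using eventually_ge_at_top[of "nat \<lceil>K powr (2 / \<epsilon>)\<rceil>"]
  proof eventually_elim
    case (elim N)
    then have "K powr (2 / \<epsilon>) \<le> real N" by linarith
    then have "(K powr (2 / \<epsilon>)) powr (\<epsilon> / 2) \<le> real N powr (\<epsilon> / 2)" using eps by (intro powr_mono2) auto
    then show ?case using K eps by (simp add: powr_powr)
  qed
  then show "\<forall>\<^sub>F N in sequentially. \<forall>\<delta>. 0 < \<delta> \<and> \<delta> < 1 \<and> real N > 1 / \<delta> \<longrightarrow> ?bound N \<delta>"
    using eventually_ge_at_top[of 1]
  proof eventually_elim
    case (elim N)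
    have N: "real N \<ge> 1" "real N > 0" using elim(2) by auto
    show ?case
    proof (intro allI impI)
      fix \<delta> :: real assume "0 < \<delta> \<and> \<delta> < 1 \<and> real N > 1 / \<delta>"
      then have \<delta>: "0 < \<delta>" "\<delta> < 1" by auto
      show "?bound N \<delta>"
      proof -
      define D where "D = \<delta> powr ((1 - real d) / 2)"
      have D: "D \<ge> 1" using powr_mono'[of "(1 - real d) / 2" 0 \<delta>] \<delta> assms(1) by (simp add: D_def)
      define u where "u = (\<lambda>t. norm (curve_sum d a N t))"
      have u0: "u t \<ge> 0" for t by (simp add: u_def)
      have cont: "continuous_on S u" for S
        unfolding u_def by (rule continuous_on_norm, rule continuous_curve_sum)
      have int_r: "(\<lambda>t. u t ^ r) integrable_on {\<delta>..1}"
        by (rule integrable_continuous_real, rule continuous_on_power, rule cont)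
      have int_s: "(\<lambda>t. u t powr (2 * s)) integrable_on {\<delta>..1}"
        by (rule integrable_continuous_real, rule continuous_on_powr', rule cont, rule continuous_on_const)
           (use u0 assms(3) in auto)
      have I: "integral {\<delta>..1} (\<lambda>t. u t ^ r) \<le> C * D * real N powr (real r - real d / 2 + \<epsilon> / 4)"
        unfolding u_def D_def using mom elim(2) \<delta> by blast
      have pw: "u t powr real r = u t ^ r" for t
        using u0[of t] rd(2) by (cases "u t = 0") (simp_all add: powr_realpow)
      \<comment> \<open>Common end of both cases: \<open>x = 2 * s\<close> leads to the term
        \<open>N powr (2 * s - r / 2)\<close> and \<open>x = s + r / 2\<close> to
        \<open>N powr s\<close>.\<close>
      have fin: ?thesis if "integral {\<delta>..1} (\<lambda>t. u t powr (2 * s)) \<le> K * D * real N powr (x - real d / 2 + \<epsilon> / 2)"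
        and x: "real N powr (x - real r / 2) \<le> real N powr s + real N powr (2 * s - real r / 2)" for x
      proof -
        have "integral {\<delta>..1} (\<lambda>t. u t powr (2 * s)) \<le> K * D * real N powr (x - real d / 2 + \<epsilon> / 2)" by (rule that)
        also have "\<dots> \<le> real N powr (\<epsilon> / 2) * D * real N powr (x - real d / 2 + \<epsilon> / 2)"
          using elim(1) D by (intro mult_right_mono) auto
        also have "\<dots> = D * real N powr (x - real r / 2) * real N powr (real r / 2 - real d / 2 + \<epsilon>)"
          by (simp add: algebra_simps flip: powr_add)
        also have "\<dots> \<le> D * (real N powr s + real N powr (2 * s - real r / 2)) * real N powr (real r / 2 - real d / 2 + \<epsilon>)"
          using x D by (intro mult_right_mono mult_left_mono) auto
        finally show ?thesis unfolding u_def D_def crit .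
      qed
      show ?thesis
      proof (cases "2 * s \<ge> r")
        case True
        \<comment> \<open>From the critical exponent upwards, the excess power is estimated by the
          trivial bound for the sum.\<close>
        define G where "G = (A * real N powr (1 + \<epsilon>1)) powr (2 * s - r)"
        have sup: "u t \<le> A * real N powr (1 + \<epsilon>1)" for t
        proof -
          have "u t \<le> (\<Sum>n=1..N. A * real N powr \<epsilon>1)"
            unfolding u_def curve_sum_def by (rule sum_norm_le) (use A(2) in \<open>auto simp: norm_mult\<close>)
          also have "\<dots> = A * real N powr (1 + \<epsilon>1)" using N by (simp add: powr_add)
          finally show ?thesis .
        qed
        have "integral {\<delta>..1} (\<lambda>t. u t powr (2 * s)) \<le> integral {\<delta>..1} (\<lambda>t. G * u t ^ r)"
        proof (rule integral_le[OF int_s])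
          show "(\<lambda>t. G * u t ^ r) integrable_on {\<delta>..1}" using int_r by (rule integrable_on_mult_right)
          fix t
          have "u t powr (2 * s) = u t powr (2 * s - r) * u t powr real r" by (simp flip: powr_add)
          also have "\<dots> \<le> G * u t powr real r"
            unfolding G_def using True u0 sup by (intro mult_right_mono powr_mono2) auto
          finally show "u t powr (2 * s) \<le> G * u t ^ r" by (simp only: pw)
        qed
        also have "\<dots> = G * integral {\<delta>..1} (\<lambda>t. u t ^ r)" by simp
        also have "\<dots> \<le> G * (C * D * real N powr (real r - real d / 2 + \<epsilon> / 4))"
          by (intro mult_left_mono I) (simp add: G_def)
        also have "\<dots> = (A powr (2 * s - r) * C) * D * real N powr ((1 + \<epsilon>1) * (2 * s - r) + (real r - real d / 2 + \<epsilon> / 4))"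
        proof -
          have "G = A powr (2 * s - r) * real N powr ((1 + \<epsilon>1) * (2 * s - r))"
            unfolding G_def by (simp only: powr_mult powr_powr)
          then show ?thesis unfolding powr_add by (simp only: mult_ac)
        qed
        also have "\<dots> \<le> K * D * real N powr (2 * s - real d / 2 + \<epsilon> / 2)"
        proof (intro mult_mono powr_mono)
          have "\<epsilon>1 * (2 * s - r) \<le> \<epsilon>1 * (2 * s + 1)" using e1 by (intro mult_left_mono) auto
          then have "\<epsilon>1 * (2 * s - r) \<le> \<epsilon> / 4" by (simp only: e1(2))
          then show "(1 + \<epsilon>1) * (2 * s - r) + (real r - real d / 2 + \<epsilon> / 4) \<le> 2 * s - real d / 2 + \<epsilon> / 2"
            unfolding distrib_right mult_1 by linarith
        qed (use C D N in \<open>auto simp: K_def\<close>)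
        finally show ?thesis by (rule fin) simp
      next
        case False
        define G where "G = real N powr (s - real r / 2)"
        have "integral {\<delta>..1} (\<lambda>t. u t powr (2 * s)) \<le> integral {\<delta>..1} (\<lambda>t. real N powr s + G * u t ^ r)"
        proof (rule integral_le[OF int_s])
          show "(\<lambda>t. real N powr s + G * u t ^ r) integrable_on {\<delta>..1}"
            using int_r by (intro integrable_add integrable_on_mult_right integrable_const_ivl)
          fix t
          show "u t powr (2 * s) \<le> real N powr s + G * u t ^ r"
          \<comment> \<open>Below the critical exponent the split is at square-root size: smaller
            values contribute \<open>N powr s\<close>, and for larger ones the negative power
            \<open>2 * s - r\<close> is greatest at the threshold.\<close>
          proof (cases "u t \<le> real N powr (1 / 2)")
            case True
            then have "u t powr (2 * s) \<le> (real N powr (1 / 2)) powr (2 * s)"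
              using u0 assms(3) by (intro powr_mono2) auto
            also have "\<dots> = real N powr s" by (simp add: powr_powr)
            also have "\<dots> \<le> real N powr s + G * u t ^ r" using u0 by (simp add: G_def)
            finally show ?thesis .
          next
            case large: False
            have pos: "real N powr (1 / 2) > 0" using N by simp
            have "u t powr (2 * s - r) \<le> (real N powr (1 / 2)) powr (2 * s - r)"
              using large pos False by (intro powr_mono2') auto
            also have "\<dots> = G" by (simp add: G_def powr_powr algebra_simps)
            finally have "u t powr (2 * s - r) * u t powr real r \<le> G * u t powr real r"
              by (rule mult_right_mono) simp
            then have "u t powr (2 * s) \<le> G * u t powr real r" by (simp flip: powr_add)
            then have "u t powr (2 * s) \<le> G * u t ^ r" by (simp only: pw)
            moreover have "0 \<le> real N powr s" by simp
            ultimately show ?thesis by linarith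
          qed
        qed
        also have "\<dots> = real N powr s * (1 - \<delta>) + G * integral {\<delta>..1} (\<lambda>t. u t ^ r)"
          using int_r \<delta> by (subst Henstock_Kurzweil_Integration.integral_add)
            (auto intro: integrable_on_mult_right integrable_const_ivl)
        also have "\<dots> \<le> real N powr s * 1 + G * (C * D * real N powr (real r - real d / 2 + \<epsilon> / 4))"
          using \<delta> by (intro add_mono mult_left_mono I) (auto simp: G_def)
        also have "G * (C * D * real N powr (real r - real d / 2 + \<epsilon> / 4)) =
            C * D * real N powr (s + real r / 2 - real d / 2 + \<epsilon> / 4)"
          by (simp add: G_def algebra_simps flip: powr_add)
        also have "real N powr s * 1 + C * D * real N powr (s + real r / 2 - real d / 2 + \<epsilon> / 4) \<le>
            K * D * real N powr ((s + real r / 2) - real d / 2 + \<epsilon> / 2)"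
        proof -
          define Y where "Y = real N powr ((s + real r / 2) - real d / 2 + \<epsilon> / 2)"
          have Y: "real N powr s \<le> Y" "real N powr (s + real r / 2 - real d / 2 + \<epsilon> / 4) \<le> Y"
            unfolding Y_def using N rd eps by (auto intro!: powr_mono)
          have "real N powr s * 1 \<le> Y * D" using Y(1) D by (intro mult_mono) (auto simp: Y_def)
          moreover have "C * D * real N powr (s + real r / 2 - real d / 2 + \<epsilon> / 4) \<le> C * D * Y"
            using Y(2) C D by (intro mult_left_mono) auto
          moreover have "(1 + C) * (D * Y) \<le> K * (D * Y)"
            using C D by (intro mult_right_mono) (auto simp: K_def Y_def)
          ultimately show ?thesis unfolding Y_def[symmetric] by (simp add: algebra_simps)
        qed
        finally show ?thesis by (rule fin) simp
      qed
      qed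
    qed
  qed
qed

end
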